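(* Suppose $\Delta = O(\mathrm{poly}\log n)$. There is an algorithm that solves the $(\Delta+1)$-list coloring problem on $n$-vertex graphs of maximum degree $\Delta$ in the $\mathsf{CONGESTED}\text{-}\mathsf{CLIQUE}$ model in $O(1)$ rounds.
   Context: The $(\Delta+1)$-list coloring problem: given $G=(V,E)$ with maximum degree $\Delta$ and a list $\Psi(v)$ of $\Delta+1$ colors for each vertex, find a proper coloring with each $v$ colored from $\Psi(v)$. $\mathsf{CONGESTED}\text{-}\mathsf{CLIQUE}$ model: $n=|V|$ processors, one per vertex, each knowing its incident edges and list; in each synchronous round each vertex may send a distinct $O(\log n)$-bit message to every other vertex. Convention: randomized algorithms are required to succeed with probability at least $1-1/\mathrm{poly}(n)$.
   Formalization: The colours in the lists are assumed to come from a colour space of size polynomial in n (colours have O(log n)-bit names); with an unbounded colour space the claim fails already for a graph with a single edge. *)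

theory Defs
  imports "HOL-Probability.Probability" "HOL-Library.Landau_Symbols"
begin

text \<open>
  Simple graphs on the vertex set \<open>{..<n}\<close>, given by their edge sets.
\<close>

definition simple_graph :: "nat \<Rightarrow> nat set set \<Rightarrow> bool" where
  "simple_graph n E \<longleftrightarrow> E \<subseteq> {{u, v} | u v. u < n \<and> v < n \<and> u \<noteq> v}"

definition neighbours :: "nat set set \<Rightarrow> nat \<Rightarrow> nat set" where
  "neighbours E v = {u. {u, v} \<in> E}"

definition max_degree :: "nat \<Rightarrow> nat set set \<Rightarrow> nat" where
  "max_degree n E = Max ((\<lambda>v. card (neighbours E v)) ` {..<n})"

definition list_assignment :: "nat \<Rightarrow> nat set set \<Rightarrow> (nat \<Rightarrow> nat set) \<Rightarrow> bool" where
  "list_assignment n E \<Psi> \<longleftrightarrow> (\<forall>v<n. card (\<Psi> v) = max_degree n E + 1)"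

definition proper_list_colouring ::
    "nat \<Rightarrow> nat set set \<Rightarrow> (nat \<Rightarrow> nat set) \<Rightarrow> (nat \<Rightarrow> nat) \<Rightarrow> bool" where
  "proper_list_colouring n E \<Psi> f \<longleftrightarrow>
     (\<forall>v<n. f v \<in> \<Psi> v) \<and> (\<forall>u v. {u, v} \<in> E \<longrightarrow> f u \<noteq> f v)"

text \<open>
  The \<open>CONGESTED-CLIQUE\<close> model. Local computation and memory are unbounded, so
  the behaviour of a processor is an arbitrary function of everything it has learnt so far:
  the number of vertices, its own name, its incident edges (equivalently its neighbours), its
  list of colours, its private random bits, and all messages received. The message received
  from \<open>u\<close> in round \<open>i\<close> (counting from 0) is \<open>received w ! i u\<close>.
\<close>

record view =
  num_vertices :: nat
  self :: nat
  nbrs :: "nat set"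
  palette :: "nat set"
  coins :: "bool list"
  received :: "(nat \<Rightarrow> bool list) list"

text \<open>
  On \<open>n\<close>-vertex graphs every processor draws \<open>num_coins A n\<close> private fair bits.
  \<open>send A w u\<close> is the message that a processor with view \<open>w\<close> sends to \<open>u\<close> in the
  next round, the empty bit string standing for silence; \<open>decide A w\<close> is the colour it
  adopts when it stops.
\<close>

record clique_algorithm =
  num_coins :: "nat \<Rightarrow> nat"
  send :: "view \<Rightarrow> nat \<Rightarrow> bool list"
  decide :: "view \<Rightarrow> nat"

text \<open>
  The view of vertex \<open>v\<close> after \<open>t\<close> synchronous rounds, where \<open>\<omega> u\<close> is the
  private bit string of \<open>u\<close>.
\<close>

primrec view_after ::
    "clique_algorithm \<Rightarrow> nat \<Rightarrow> nat set set \<Rightarrow> (nat \<Rightarrow> nat set) \<Rightarrow> (nat \<Rightarrow> bool list)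
      \<Rightarrow> nat \<Rightarrow> nat \<Rightarrow> view" where
  "view_after A n E \<Psi> \<omega> 0 =
     (\<lambda>v. \<lparr>num_vertices = n, self = v, nbrs = neighbours E v, palette = \<Psi> v,
           coins = \<omega> v, received = []\<rparr>)"
| "view_after A n E \<Psi> \<omega> (Suc t) =
     (\<lambda>v. view_after A n E \<Psi> \<omega> t v
        \<lparr>received := received (view_after A n E \<Psi> \<omega> t v) @
           [\<lambda>u. if u < n \<and> u \<noteq> v then send A (view_after A n E \<Psi> \<omega> t u) v else []]\<rparr>)"

definition result ::
    "clique_algorithm \<Rightarrow> nat \<Rightarrow> nat \<Rightarrow> nat set set \<Rightarrow> (nat \<Rightarrow> nat set) \<Rightarrow> (nat \<Rightarrow> bool list)
      \<Rightarrow> nat \<Rightarrow> nat" where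
  "result A R n E \<Psi> \<omega> v = decide A (view_after A n E \<Psi> \<omega> R v)"

definition coin_space :: "clique_algorithm \<Rightarrow> nat \<Rightarrow> (nat \<Rightarrow> bool list) pmf" where
  "coin_space A n =
     Pi_pmf {..<n} [] (\<lambda>_. pmf_of_set {bs. length bs = num_coins A n})"

text \<open>
  Every message has \<open>O(log n)\<close> bits. Imposing the bound on all views, reachable or not,
  loses no generality, since longer messages in unreachable views can be truncated.
  As usual in this model, colours are meant to have \<open>O(log n)\<close>-bit names too; with an
  unbounded colour space even a single edge cannot be coloured in a bounded number of rounds.
\<close>

definition logarithmic_messages :: "clique_algorithm \<Rightarrow> bool" where
  "logarithmic_messages A \<longleftrightarrow>
     (\<exists>B::real. \<forall>w u. real (length (send A w u)) \<le> B * log 2 (real (num_vertices w)))"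

end

theory Submission
  imports Defs "HOL-Real_Asymp.Real_Asymp" "HOL-Library.Nat_Bijection"
begin

text \<open>
  The algorithm is deterministic. Whenever a random object \<open>x\<close> is needed, \<open>n\<close> candidates for it are
  hard-wired into the algorithm such that, for every local view of a vertex, only a small fraction
  of the candidates is bad; they exist because there are only
  \<open>exp (polylog n)\<close> local views. In the network, every vertex tells vertex \<open>i\<close> whether candidate
  \<open>i\<close> is bad for it, and a candidate with the fewest complaints is adopted.

  Let \<open>s\<^sup>2\<^sup>0\<close> be about \<open>\<Delta>\<close>. A public \<open>y v < s\<^sup>1\<^sup>5\<close> is chosen for every vertex. For
  \<open>K = s\<^sup>1\<^sup>1, s\<^sup>7, s\<^sup>3\<close> in turn, the vertices with \<open>K \<le> y v < s\<^sup>4 K\<close> are split into the bins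
  \<open>y v mod K\<close> and the colours are hashed into \<open>K\<close> bins. The uncoloured vertices with
  \<open>y v < K\<close> give enough slack that inside every bin the palettes exceed the degrees, for all but the
  vertices for which some choice was bad. A bin has only about \<open>n / s\<^sup>1\<^sup>1\<close> vertices of degree at most
  \<open>3 s\<^sup>9\<close>, so a leader can collect it through relays in two rounds and colour it greedily.
  Afterwards the vertices with \<open>y v < s\<^sup>3\<close>, and then the bad vertices, are few enough to be
  collected by a single leader. Small \<open>n\<close> and bounded \<open>\<Delta>\<close> are handled directly.
\<close>

section \<open>Knowledge after a number of rounds\<close>

text \<open>The obstacle is that \<Delta> may be tiny compared with n. The concentration bounds fail
  with probability about exp (- s / 192), which beats 1 / \<Delta> but not 1 / n, so bad vertices
  cannot be excluded. It is enough that each of the four selections spoils at most n / (16 (\<Delta>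
  + 1)) vertices: a single leader can then receive the degrees and lists of all of them. For bounded
  \<Delta> even 1 / \<Delta> need not be beaten, hence the separate case. The exponents balance as
  follows. A bin has density (s ^ 4 - 1) / s ^ 15, so a vertex expects at most about \<Delta> / s ^
  11 - \<Delta> / s ^ 15 neighbours in its bin, while at least about \<Delta> / s ^ 11 of its free
  colours should hash there. The gap \<Delta> / s ^ 15 is at least s ^ 5; deviations of quantities
  of size s ^ 9 are of order s powr 4.5, and the surplus factor s powr 0.5 gives the exponent linear
  in s. On the other side, n / s ^ 11 vertices with O(s ^ 9) words each stay within the n words that
  a leader can receive, with a factor s ^ 2 to spare.\<close>

type_synonym inst = "nat \<times> nat set set \<times> (nat \<Rightarrow> nat set)"

text \<open>As \<open>num_coins\<close> is zero, the only possible coin strings are empty.\<close>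

definition know :: "inst set \<Rightarrow> nat \<Rightarrow> (inst \<Rightarrow> nat \<Rightarrow> 'k) \<Rightarrow> bool" where
  "know C r K \<longleftrightarrow> (\<exists>A \<psi>. logarithmic_messages A \<and> num_coins A = (\<lambda>_. 0) \<and>
     (\<forall>n E \<Psi>. (n, E, \<Psi>) \<in> C \<longrightarrow>
        (\<forall>v<n. \<psi> (view_after A n E \<Psi> (\<lambda>_. []) r v) = K (n, E, \<Psi>) v)))"

text \<open>The number of messages received so far tells the round, so an algorithm changed only
  from round r on produces the same views up to round r. This is what allows further rounds to be
  appended.\<close>

lemma view_after_cong:
  assumes "\<And>w. length (received w) < r \<Longrightarrow> send A w = send A' w"
  shows "view_after A n E \<Psi> \<omega> r v = view_after A' n E \<Psi> \<omega> r v
    \<and> length (received (view_after A n E \<Psi> \<omega> r v)) = r"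
  using assms
proof (induction r arbitrary: v)
  case (Suc r)
  have IH: "view_after A n E \<Psi> \<omega> r u = view_after A' n E \<Psi> \<omega> r u \<and>
      length (received (view_after A n E \<Psi> \<omega> r u)) = r" for u
    by (rule Suc.IH) (simp add: Suc.prems)
  then have *: "view_after A n E \<Psi> \<omega> r u = view_after A' n E \<Psi> \<omega> r u"
    "length (received (view_after A' n E \<Psi> \<omega> r u)) = r" for u
    using IH[of u] by simp_all
  show ?case by (simp add: * Suc.prems cong: if_cong)
qed auto

lemma view_after_fixed [simp]:
  "num_vertices (view_after A n E \<Psi> \<omega> r v) = n" "self (view_after A n E \<Psi> \<omega> r v) = v"
  "nbrs (view_after A n E \<Psi> \<omega> r v) = neighbours E v"
  "palette (view_after A n E \<Psi> \<omega> r v) = \<Psi> v"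
  "length (received (view_after A n E \<Psi> \<omega> r v)) = r"
  by (induction r) auto

definition inp :: "inst \<Rightarrow> nat \<Rightarrow> nat \<times> nat \<times> nat set \<times> nat set" where
  "inp I v = (fst I, v, neighbours (fst (snd I)) v, snd (snd I) v)"

lemma inp_simp [simp]: "inp (n, E, \<Psi>) v = (n, v, neighbours E v, \<Psi> v)"
  by (simp add: inp_def)

lemma know_inp: "know C 0 inp"
  unfolding know_def
  by (rule exI[of _ "\<lparr>num_coins = \<lambda>_. 0, send = \<lambda>_ _. [], decide = \<lambda>_. 0\<rparr>"],
      rule exI[of _ "\<lambda>w. (num_vertices w, self w, nbrs w, palette w)"])
     (auto simp: logarithmic_messages_def intro!: exI[of _ 0])

text \<open>Local computation is free: post-composing with any function costs no round. The equation
  is only required for actual vertices of instances in the class.\<close>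

lemma know_map:
  assumes "know C r K" and "\<And>I v. I \<in> C \<Longrightarrow> v < fst I \<Longrightarrow> K' I v = h (K I v)"
  shows "know C r K'"
proof -
  from assms(1) obtain A \<psi> where "logarithmic_messages A" "num_coins A = (\<lambda>_. 0)"
    and "\<And>n E \<Psi> v. (n, E, \<Psi>) \<in> C \<Longrightarrow> v < n \<Longrightarrow>
      \<psi> (view_after A n E \<Psi> (\<lambda>_. []) r v) = K (n, E, \<Psi>) v"
    unfolding know_def by blast
  then show ?thesis
    unfolding know_def
    by (intro exI[of _ A] exI[of _ "\<lambda>w. h (\<psi> w)"]) (auto simp: assms(2))
qed

section \<open>Numbers below a power of n as messages of logarithmic length\<close>

definition word_length :: "nat \<Rightarrow> nat" where
  "word_length n = nat \<lceil>log 2 (real n)\<rceil>"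

text \<open>The factor 2 absorbs the rounding once the logarithm is at least 1; for n = 0 and n = 1
  both sides vanish, as \<open>ln 0 = 0\<close>.\<close>

lemma word_length_le: "real (word_length n) \<le> 2 * log 2 (real n)"
proof (cases "n \<ge> 2")
  case True
  then have "log 2 (real n) \<ge> 1" by simp
  then show ?thesis unfolding word_length_def by linarith
next
  case False
  then have "n = 0 \<or> n = 1" by auto
  then show ?thesis by (auto simp: word_length_def log_def)
qed

lemma le_two_power_word_length: "n \<le> 2 ^ word_length n"
proof (cases "n \<ge> 1")
  case True
  have "log 2 (real n) \<le> real (word_length n)"
    unfolding word_length_def by linarith
  then have "real n \<le> 2 powr real (word_length n)"
    using True by (simp add: log_le_iff)
  then have "real n \<le> real (2 ^ word_length n)" by (simp add: powr_realpow)
  then show ?thesis by linarith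
qed simp

definition encode :: "nat \<Rightarrow> nat \<Rightarrow> nat \<Rightarrow> bool list" where
  "encode B n x = map (bit x) [0..<B * word_length n]"

definition decode :: "bool list \<Rightarrow> nat" where
  "decode bs = horner_sum of_bool 2 bs"

lemma decode_encode:
  assumes "x < n ^ B" shows "decode (encode B n x) = x"
proof -
  have "x < (2 ^ word_length n) ^ B"
    using assms power_mono[OF le_two_power_word_length, of n B] by simp
  then have "x < 2 ^ (B * word_length n)" by (simp add: power_mult [symmetric] mult.commute)
  then show ?thesis
    unfolding decode_def encode_def horner_sum_bit_eq_take_bit by (simp add: take_bit_nat_eq_self)
qed

lemma log_bound_weaken:
  assumes "x \<le> B * log 2 (real m)" "B \<le> B'"
  shows "x \<le> B' * log 2 (real m)"
proof -
  have "log 2 (real m) \<ge> 0" by (cases "m = 0") (auto simp: log_def)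
  from mult_right_mono[OF assms(2) this] assms(1) show ?thesis by linarith
qed

text \<open>The old algorithm runs for r rounds and then every vertex sends one word computed from
  what it knows. A word below n ^ B fits into a message of B * \<open>word_length n\<close>
  bits.\<close>

lemma know_send:
  assumes "know C r K"
    and "\<And>I u v. I \<in> C \<Longrightarrow> u < fst I \<Longrightarrow> v < fst I \<Longrightarrow> u \<noteq> v \<Longrightarrow> w (K I u) v < fst I ^ B"
  shows "know C (Suc r) (\<lambda>I v. (K I v, \<lambda>u. if u < fst I then w (K I u) v else (0::nat)))"
proof -
  from assms(1) obtain A \<psi> where A: "logarithmic_messages A" "num_coins A = (\<lambda>_. 0)"
    and \<psi>: "\<And>n E \<Psi> v. (n, E, \<Psi>) \<in> C \<Longrightarrow> v < n \<Longrightarrow>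
      \<psi> (view_after A n E \<Psi> (\<lambda>_. []) r v) = K (n, E, \<Psi>) v"
    unfolding know_def by blast
  from A obtain B' :: real where B': "\<And>(x::view) u. real (length (send A x u)) \<le> B' * log 2 (real (num_vertices x))"
    unfolding logarithmic_messages_def by blast
  define A' where "A' = A\<lparr>send := \<lambda>x u. if length (received x) < r then send A x u
    else encode B (num_vertices x) (w (\<psi> x) u)\<rparr>"
  have "logarithmic_messages A'"
    unfolding logarithmic_messages_def
  proof (intro exI allI)
    fix x :: view and u
    let ?l = "log 2 (real (num_vertices x))"
    have "real (length (send A x u)) \<le> max B' (2 * B) * ?l"
      by (rule log_bound_weaken[OF B']) simp
    moreover have "real (length (encode B (num_vertices x) (w (\<psi> x) u))) \<le> max B' (2 * B) * ?l"
    proof -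
      have "real B * real (word_length (num_vertices x)) \<le> real B * (2 * ?l)"
        by (intro mult_left_mono word_length_le) auto
      then have "real (length (encode B (num_vertices x) (w (\<psi> x) u))) \<le> (2 * real B) * ?l"
        by (simp add: encode_def)
      then show ?thesis by (rule log_bound_weaken) simp
    qed
    ultimately show "real (length (send A' x u)) \<le> max B' (2 * B) * ?l"
      by (simp add: A'_def)
  qed
  moreover have "num_coins A' = (\<lambda>_. 0)" by (simp add: A'_def A)
  moreover have "\<exists>\<phi>. \<forall>n E \<Psi>. (n, E, \<Psi>) \<in> C \<longrightarrow>
        (\<forall>v<n. \<phi> (view_after A' n E \<Psi> (\<lambda>_. []) (Suc r) v) =
          (K (n, E, \<Psi>) v, \<lambda>u. if u < n then w (K (n, E, \<Psi>) u) v else 0))"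
  \<comment> \<open>\<open>\<psi>\<close> reads views after r rounds, so the newest block of
    messages is dropped. Nothing is received from oneself, so the entry at \<open>self x\<close> is
    recomputed locally.\<close>
  proof (intro exI[of _ "\<lambda>x. let k = \<psi> (x\<lparr>received := butlast (received x)\<rparr>) in
      (k, \<lambda>u. if u < num_vertices x then if u = self x then w k u else decode (last (received x) u) else 0)"] allI impI)
    fix n E \<Psi> v assume *: "(n, E, \<Psi>) \<in> C" "v < n"
    have same: "view_after A' n E \<Psi> (\<lambda>_. []) r u = view_after A n E \<Psi> (\<lambda>_. []) r u" for u
      using view_after_cong[of r A A'] by (simp add: A'_def)
    have strip: "x\<lparr>received := received x\<rparr> = x" for x :: view by (cases x) simp
    have "decode (send A' (view_after A' n E \<Psi> (\<lambda>_. []) r u) v) = w (K (n, E, \<Psi>) u) v"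
      if "u < n" "u \<noteq> v" for u
      unfolding same using * that assms(2)[of "(n, E, \<Psi>)" u v]
      by (simp add: A'_def \<psi> decode_encode)
    then show "(let k = \<psi> ((view_after A' n E \<Psi> (\<lambda>_. []) (Suc r) v)\<lparr>received := butlast (received (view_after A' n E \<Psi> (\<lambda>_. []) (Suc r) v))\<rparr>) in
      (k, \<lambda>u. if u < num_vertices (view_after A' n E \<Psi> (\<lambda>_. []) (Suc r) v) then if u = self (view_after A' n E \<Psi> (\<lambda>_. []) (Suc r) v) then w k u else decode (last (received (view_after A' n E \<Psi> (\<lambda>_. []) (Suc r) v)) u) else 0))
      = (K (n, E, \<Psi>) v, \<lambda>u. if u < n then w (K (n, E, \<Psi>) u) v else 0)"
      using * by (auto simp: same strip \<psi> Let_def fun_eq_iff)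
  qed
  ultimately show ?thesis unfolding know_def by auto
qed

lemma know_Suc:
  assumes "know C r K" shows "know C (Suc r) K"
  by (rule know_map[OF know_send[where w="\<lambda>_ _. 0" and B=0, OF assms], where h=fst]) auto

lemma know_mono:
  assumes "know C r K" "r \<le> r'" shows "know C r' K"
  using assms(2) by (induction rule: dec_induct) (auto intro: assms know_Suc)

text \<open>All vertices of an instance give the same answer to \<open>P\<close>, each from its own
  input. They therefore agree without communication on which of the two algorithms to run.\<close>

lemma know_merge:
  assumes "know C r K" "know C' r' K'"
    and "\<And>I v. I \<in> C \<Longrightarrow> v < fst I \<Longrightarrow> P (inp I v)"
    and "\<And>I v. I \<in> C' \<Longrightarrow> v < fst I \<Longrightarrow> \<not> P (inp I v)"
  shows "know (C \<union> C') (max r r') (\<lambda>I v. if P (inp I v) then K I v else K' I v)"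
proof -
  define t where "t = max r r'"
  obtain A \<psi> where A: "logarithmic_messages A" "num_coins A = (\<lambda>_. 0)"
    and \<psi>: "\<And>n E \<Psi> v. (n, E, \<Psi>) \<in> C \<Longrightarrow> v < n \<Longrightarrow>
      \<psi> (view_after A n E \<Psi> (\<lambda>_. []) t v) = K (n, E, \<Psi>) v"
    using know_mono[OF assms(1), of t] unfolding know_def t_def by (metis max.cobounded1)
  obtain A' \<psi>' where A': "logarithmic_messages A'" "num_coins A' = (\<lambda>_. 0)"
    and \<psi>': "\<And>n E \<Psi> v. (n, E, \<Psi>) \<in> C' \<Longrightarrow> v < n \<Longrightarrow>
      \<psi>' (view_after A' n E \<Psi> (\<lambda>_. []) t v) = K' (n, E, \<Psi>) v"
    using know_mono[OF assms(2), of t] unfolding know_def t_def by (metis max.cobounded2)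
  \<comment> \<open>Reads \<open>P\<close> off those fields of a view that never change, so a vertex
    follows the same algorithm in every round.\<close>
  define Q where "Q (x :: view) = P (num_vertices x, self x, nbrs x, palette x)" for x
  define M where "M = A\<lparr>send := \<lambda>x. if Q x then send A x else send A' x\<rparr>"
  obtain B B' :: real
    where B: "\<And>(x::view) u. real (length (send A x u)) \<le> B * log 2 (real (num_vertices x))"
      and B': "\<And>(x::view) u. real (length (send A' x u)) \<le> B' * log 2 (real (num_vertices x))"
    using A A' unfolding logarithmic_messages_def by blast
  have "real (length (send M x u)) \<le> max B B' * log 2 (real (num_vertices x))" for x :: view and u
    using log_bound_weaken[OF B, of "max B B'" x u] log_bound_weaken[OF B', of "max B B'" x u]
    by (auto simp: M_def)
  then have "logarithmic_messages M" unfolding logarithmic_messages_def by blast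
  moreover have same: "view_after M n E \<Psi> (\<lambda>_. []) i v = view_after A n E \<Psi> (\<lambda>_. []) i v"
    if "(n, E, \<Psi>) \<in> C" "v < n" for n E \<Psi> i v
    using that
  proof (induction i arbitrary: v)
    case (Suc i)
    have "Q (view_after A n E \<Psi> (\<lambda>_. []) i u)" if "u < n" for u
      using assms(3)[OF Suc.prems(1), of u] that by (simp add: Q_def)
    with Suc show ?case
      by (auto simp: M_def fun_eq_iff intro!: arg_cong[where f="\<lambda>m. _\<lparr>received := _ @ [m]\<rparr>"])
  qed simp
  moreover have same': "view_after M n E \<Psi> (\<lambda>_. []) i v = view_after A' n E \<Psi> (\<lambda>_. []) i v"
    if "(n, E, \<Psi>) \<in> C'" "v < n" for n E \<Psi> i v
    using that
  proof (induction i arbitrary: v)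
    case (Suc i)
    have "\<not> Q (view_after A' n E \<Psi> (\<lambda>_. []) i u)" if "u < n" for u
      using assms(4)[OF Suc.prems(1), of u] that by (simp add: Q_def)
    with Suc show ?case
      by (auto simp: M_def fun_eq_iff intro!: arg_cong[where f="\<lambda>m. _\<lparr>received := _ @ [m]\<rparr>"])
  qed simp
  ultimately have "(if Q (view_after M n E \<Psi> (\<lambda>_. []) t v) then \<psi> (view_after M n E \<Psi> (\<lambda>_. []) t v)
      else \<psi>' (view_after M n E \<Psi> (\<lambda>_. []) t v)) =
      (if P (inp (n, E, \<Psi>) v) then K (n, E, \<Psi>) v else K' (n, E, \<Psi>) v)"
    if "(n, E, \<Psi>) \<in> C \<union> C'" "v < n" for n E \<Psi> v
    using that assms(3)[of "(n, E, \<Psi>)" v] assms(4)[of "(n, E, \<Psi>)" v]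
    by (auto simp: Q_def \<psi> \<psi>')
  then show ?thesis
    unfolding know_def t_def[symmetric] using A(2) \<open>logarithmic_messages M\<close>
    by (intro exI[of _ M] exI[of _ "\<lambda>x. if Q x then \<psi> x else \<psi>' x"]) (auto simp: M_def)
qed

text \<open>Without coins the coin space is a point mass at the constantly empty assignment, so a
  correct outcome has probability 1.\<close>

lemma know_imp_algorithm:
  assumes "know C r (\<lambda>I v. f I v :: nat)"
  shows "\<exists>A. logarithmic_messages A \<and> (\<forall>n E \<Psi>. (n, E, \<Psi>) \<in> C \<longrightarrow>
     measure_pmf.prob (coin_space A n) {\<omega>. \<forall>v<n. result A r n E \<Psi> \<omega> v = f (n, E, \<Psi>) v} = 1)"
proof -
  from assms obtain A \<psi> where A: "logarithmic_messages A" "num_coins A = (\<lambda>_. 0)"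
    and \<psi>: "\<And>n E \<Psi> v. (n, E, \<Psi>) \<in> C \<Longrightarrow> v < n \<Longrightarrow>
      \<psi> (view_after A n E \<Psi> (\<lambda>_. []) r v) = f (n, E, \<Psi>) v"
    unfolding know_def by blast
  define A' where "A' = A\<lparr>decide := \<psi>\<rparr>"
  have "logarithmic_messages A'" using A by (simp add: A'_def logarithmic_messages_def)
  moreover have "coin_space A' n = return_pmf (\<lambda>_. [])" for n
    by (simp add: coin_space_def A'_def A pmf_of_set_singleton Pi_pmf_return_pmf)
  moreover have "view_after A' n E \<Psi> \<omega> r v = view_after A n E \<Psi> \<omega> r v" for n E \<Psi> \<omega> v
    using view_after_cong[of r A A'] by (simp add: A'_def)
  ultimately show ?thesis
    by (intro exI[of _ A']) (auto simp: result_def \<psi> A'_def indicator_def)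
qed

section \<open>Public knowledge and collecting information\<close>

text \<open>The form in which stages are chained: every vertex has its own input and a value common
  to all. Any deterministic choice made from the common value alone is automatically made
  consistently.\<close>

definition pub :: "inst set \<Rightarrow> nat \<Rightarrow> (inst \<Rightarrow> 'p) \<Rightarrow> bool" where
  "pub C r P \<longleftrightarrow> know C r (\<lambda>I v. (inp I v, P I))"

lemma pub_unit: "pub C 0 (\<lambda>_. ())"
  unfolding pub_def by (rule know_map[OF know_inp, where h="\<lambda>k. (k, ())"]) simp

lemma pub_map:
  assumes "pub C r P" "\<And>I. I \<in> C \<Longrightarrow> fst I > 0 \<Longrightarrow> P' I = h (fst I) (P I)"
  shows "pub C r P'"
  unfolding pub_def
  by (rule know_map[OF assms(1)[unfolded pub_def], where h="\<lambda>(k, p). (k, h (fst k) p)"])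
     (auto simp: assms(2) inp_def)

text \<open>The bound on words is asked for only when n \<ge> 2, since a lone vertex sends
  nothing.\<close>

lemma pub_broadcast:
  assumes "pub C r P"
    and "\<And>I v. I \<in> C \<Longrightarrow> v < fst I \<Longrightarrow> fst I \<ge> 2 \<Longrightarrow> w (inp I v) (P I) < fst I ^ B"
  shows "pub C (Suc r) (\<lambda>I. (P I, \<lambda>v. if v < fst I then w (inp I v) (P I) else (0::nat)))"
  unfolding pub_def
  by (rule know_map[OF know_send[OF assms(1)[unfolded pub_def], where w="\<lambda>k v. w (fst k) (snd k)" and B=B],
        where h="\<lambda>k. (fst (fst k), snd (fst k), snd k)"])
     (auto intro!: assms(2))

text \<open>In one round every vertex sends its verdict on candidate i to vertex i; in the next,
  vertex i broadcasts the sum. The sum is at most n, hence below n ^ 2 as soon as there are two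
  vertices.\<close>

lemma pub_count:
  assumes "pub C r P"
  shows "pub C (r + 2) (\<lambda>I. (P I, \<lambda>i. if i < fst I then card {v. v < fst I \<and> bad (inp I v) (P I) i} else 0))"
proof -
  let ?K1 = "\<lambda>I i. ((inp I i, P I), \<lambda>u. if u < fst I then (if bad (inp I u) (P I) i then 1 else 0) else (0::nat))"
  have K1: "know C (Suc r) ?K1"
    by (rule know_map[OF know_send[OF assms[unfolded pub_def],
          where w="\<lambda>k i. if bad (fst k) (snd k) i then 1 else 0" and B=1], where h=id]) auto
  have bound: "card {v. v < fst (fst (fst (?K1 I u))) \<and> snd (?K1 I u) v = 1} < (fst I)\<^sup>2"
    if "u < fst I" "v < fst I" "u \<noteq> v" for I :: inst and u v
  proof -
    have "card {v. v < fst (fst (fst (?K1 I u))) \<and> snd (?K1 I u) v = 1} \<le> card {..<fst I}"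
      by (rule card_mono) (auto simp: inp_def)
    also have "\<dots> < (fst I)\<^sup>2" using that by (auto simp: power2_eq_square)
    finally show ?thesis .
  qed
  have "know C (Suc (Suc r)) (\<lambda>I v. (?K1 I v, \<lambda>u. if u < fst I
      then card {v. v < fst (fst (fst (?K1 I u))) \<and> snd (?K1 I u) v = 1} else 0))"
    by (rule know_send[OF K1, where w="\<lambda>k _. card {v. v < fst (fst (fst k)) \<and> snd k v = 1}" and B=2]) (rule bound)
  then have "know C (r + 2) (\<lambda>I v. (?K1 I v, \<lambda>u. if u < fst I
      then card {v. v < fst (fst (fst (?K1 I u))) \<and> snd (?K1 I u) v = 1} else 0))"
    by (simp only: add_2_eq_Suc')
  then show ?thesis unfolding pub_def
    by (rule know_map[where h="\<lambda>k. (fst (fst (fst k)), snd (fst (fst k)), snd k)"])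
       (auto simp: inp_def fun_eq_iff intro!: arg_cong[where f=card])
qed

text \<open>Two rounds make all complaint counts public, and everyone picks the same minimiser
  because \<open>SOME\<close> breaks ties by a fixed rule. The third round makes public who is bad
  for the winner.\<close>

lemma pub_choose:
  fixes fam :: "'p \<Rightarrow> nat \<Rightarrow> 'x"
  assumes "pub C r P"
  shows "\<exists>X B. pub C (r + 3) (\<lambda>I. (P I, X I, B I)) \<and>
    (\<forall>I\<in>C. fst I > 0 \<longrightarrow> X I \<in> fam (P I) ` {..<fst I} \<and> B I = {v. v < fst I \<and> bad (inp I v) (P I) (X I)} \<and>
       (\<forall>i<fst I. card (B I) \<le> card {v. v < fst I \<and> bad (inp I v) (P I) (fam (P I) i)}))"
proof -
  define cnt where "cnt I = (\<lambda>i. if i < fst I then card {v. v < fst I \<and> bad (inp I v) (P I) (fam (P I) i)} else 0)" for I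
  define best where "best n c = (SOME i. i < n \<and> (\<forall>j<n. c i \<le> (c j :: nat)))" for n :: nat and c
  have best: "best n c < n \<and> (\<forall>j<n. c (best n c) \<le> c j)" if "n > 0" for n c
    unfolding best_def
  proof (rule someI_ex)
    have fin: "finite (c ` {..<n})" "c ` {..<n} \<noteq> {}" using that by auto
    obtain i where "i < n" "c i = Min (c ` {..<n})" using Min_in[OF fin] by force
    moreover have "Min (c ` {..<n}) \<le> c j" if "j < n" for j using fin that by (intro Min_le) auto
    ultimately show "\<exists>i. i < n \<and> (\<forall>j<n. c i \<le> c j)" by (intro exI[of _ i]) simp
  qed
  define X where "X I = fam (P I) (best (fst I) (cnt I))" for I
  define B where "B I = {v. v < fst I \<and> bad (inp I v) (P I) (X I)}" for I
  have "pub C (r + 2) (\<lambda>I. (P I, cnt I))"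
    unfolding cnt_def by (rule pub_count[OF assms])
  then have "pub C (r + 2) (\<lambda>I. (P I, X I))"
    by (rule pub_map[where h="\<lambda>n p. (fst p, fam (fst p) (best n (snd p)))"]) (simp add: X_def)
  then have "pub C (Suc (r + 2)) (\<lambda>I. ((P I, X I), \<lambda>v. if v < fst I then
      (\<lambda>i p. if bad i (fst p) (snd p) then 1 else 0) (inp I v) (P I, X I) else (0::nat)))"
    by (rule pub_broadcast[where B=1]) auto
  then have "pub C (r + 3) (\<lambda>I. (P I, X I, B I))"
    unfolding numeral_3_eq_3 add_2_eq_Suc' add_Suc_right Nat.add_0_right
    by (rule pub_map[where h="\<lambda>n p. (fst (fst p), snd (fst p), {v. snd p v = 1})"]) (auto simp: B_def)
  moreover have "X I \<in> fam (P I) ` {..<fst I}" if "fst I > 0" for I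
    using best[OF that, of "cnt I"] by (auto simp: X_def)
  moreover have "card (B I) \<le> card {v. v < fst I \<and> bad (inp I v) (P I) (fam (P I) i)}" if "i < fst I" for I i
    using best[of "fst I" "cnt I"] that by (auto simp: B_def X_def cnt_def split: if_splits)
  ultimately show ?thesis by (intro exI[of _ X] exI[of _ B]) (simp add: B_def)
qed

section \<open>Delivering many words per vertex to the leader of its group\<close>

text \<open>The value \<open>M\<close> pads the transmitted list to a fixed length.\<close>

definition word_of :: "nat \<Rightarrow> nat set \<Rightarrow> nat \<Rightarrow> nat" where
  "word_of M S j = (if j < card S then sorted_list_of_set S ! j else M)"

lemma word_of_le:
  assumes "S \<subseteq> {..<M}" shows "word_of M S j \<le> M"
proof -
  have "finite S" using assms finite_subset by blast
  then have "sorted_list_of_set S ! j \<in> S" if "j < card S"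
    using that nth_mem[of j "sorted_list_of_set S"] by simp
  then show ?thesis using assms by (force simp: word_of_def)
qed

lemma word_of_decode:
  assumes "S \<subseteq> {..<M}" "card S \<le> W"
  shows "word_of M S ` {..<W} - {M} = S"
proof -
  have fin: "finite S" using assms finite_subset by blast
  have "S = set (sorted_list_of_set S)" using fin by simp
  also have "\<dots> = (\<lambda>j. sorted_list_of_set S ! j) ` {..<card S}"
    using fin by (auto simp: set_conv_nth)
  also have "\<dots> = word_of M S ` {..<card S}" by (auto simp: word_of_def)
  finally have *: "S = word_of M S ` {..<card S}" .
  show ?thesis
  proof
    show "word_of M S ` {..<W} - {M} \<subseteq> S"
    proof
      fix x assume "x \<in> word_of M S ` {..<W} - {M}"
      then obtain j where "x = word_of M S j" "x \<noteq> M" by blast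
      then have "x \<in> word_of M S ` {..<card S}" by (auto simp: word_of_def split: if_splits)
      then show "x \<in> S" using * by blast
    qed
    show "S \<subseteq> word_of M S ` {..<W} - {M}"
    proof
      fix x assume "x \<in> S"
      with * obtain j where "j < card S" "x = word_of M S j" by blast
      with assms \<open>x \<in> S\<close> show "x \<in> word_of M S ` {..<W} - {M}" by auto
    qed
  qed
qed

definition rank :: "nat set \<Rightarrow> (nat \<Rightarrow> nat) \<Rightarrow> nat \<Rightarrow> nat" where
  "rank S l v = card {u \<in> S. l u = l v \<and> u < v}"

lemma rank_less:
  assumes "finite S" "v \<in> S" shows "rank S l v < card {u \<in> S. l u = l v}"
  unfolding rank_def using assms by (intro psubset_card_mono) auto

lemma rank_inj:
  assumes "finite S" "u \<in> S" "v \<in> S" "l u = l v" "rank S l u = rank S l v"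
  shows "u = v"
proof (rule ccontr)
  have *: "rank S l u < rank S l v" if "u < v" "u \<in> S" "l u = l v" for u v
    unfolding rank_def using assms(1) that by (intro psubset_card_mono) auto
  assume "u \<noteq> v"
  with *[of u v] *[of v u] assms show False by (auto simp: neq_iff)
qed

text \<open>
  The \<open>j\<close>-th word of \<open>v\<close> travels via relay \<open>rank v * W + j\<close>; for a fixed leader these relays are
  pairwise different, hence no link carries more than one word.
\<close>

lemma pub_collect:
  fixes S :: "nat \<times> nat \<times> nat set \<times> nat set \<Rightarrow> 'p \<Rightarrow> nat set"
  assumes P: "pub C r P"
    and act: "\<And>I. I \<in> C \<Longrightarrow> act (P I) \<subseteq> {..<fst I}"
    and leader: "\<And>I v. I \<in> C \<Longrightarrow> v \<in> act (P I) \<Longrightarrow> leader (P I) v < fst I"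
    and S: "\<And>I v. I \<in> C \<Longrightarrow> v \<in> act (P I) \<Longrightarrow> S (inp I v) (P I) \<subseteq> {..<M (P I)}"
    and card_S: "\<And>I v. I \<in> C \<Longrightarrow> v \<in> act (P I) \<Longrightarrow> card (S (inp I v) (P I)) \<le> W (P I)"
    and M: "\<And>I. I \<in> C \<Longrightarrow> fst I \<ge> 2 \<Longrightarrow> M (P I) < fst I ^ B"
    and size: "\<And>I b. I \<in> C \<Longrightarrow> card {v \<in> act (P I). leader (P I) v = b} * W (P I) \<le> fst I"
    and out: "\<And>I b F v. I \<in> C \<Longrightarrow> fst I \<ge> 2 \<Longrightarrow> out (P I) b F v < fst I ^ B"
  shows "pub C (r + 4) (\<lambda>I. (P I, \<lambda>v. if v \<in> act (P I) then
     out (P I) (leader (P I) v)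
       (\<lambda>u. if u \<in> act (P I) \<and> leader (P I) u = leader (P I) v then S (inp I u) (P I) else {}) v else 0))"
proof -
  define rk where "rk p = rank (act p) (leader p)" for p
  have rk_bound: "rk (P I) v * W (P I) + j < fst I" if "I \<in> C" "v \<in> act (P I)" "j < W (P I)" for I v j
  proof -
    have fin: "finite (act (P I))" using finite_subset[OF act[OF that(1)]] by simp
    have "rk (P I) v * W (P I) + j < (rk (P I) v + 1) * W (P I)" using that by simp
    also have "\<dots> \<le> card {u \<in> act (P I). leader (P I) u = leader (P I) v} * W (P I)"
      using rank_less[OF fin that(2), of "leader (P I)"] by (intro mult_right_mono) (auto simp: rk_def)
    also have "\<dots> \<le> fst I" by (rule size[OF that(1)])
    finally show ?thesis .
  qed
  \<comment> \<open>Every x is sent a word, with index x - rank * W. For an x outside the block of v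
    this is junk that stays below the word bound; only words on relays of the block are ever
    decoded.\<close>
  define w1 where "w1 k x = (let (i, p) = k; v = fst (snd i) in
    if v \<in> act p then word_of (M p) (S i p) (x - rk p v * W p) else 0)"
    for k :: "(nat \<times> nat \<times> nat set \<times> nat set) \<times> 'p" and x
  define K1 where "K1 I v = ((inp I v, P I), \<lambda>u. if u < fst I then w1 (inp I u, P I) v else 0)" for I v
  have rc_bound: "w1 (inp I u, P I) v < fst I ^ B" if "I \<in> C" "2 \<le> fst I" for I u v
  proof (cases "u \<in> act (P I)")
    case True
    then show ?thesis
      using le_less_trans[OF word_of_le[OF S[OF that(1)]] M[OF that]]
      by (simp add: w1_def inp_def Let_def)
  qed (use that in \<open>simp add: w1_def inp_def Let_def\<close>)
  have w1_bound: "w1 (inp I u, P I) v < fst I ^ B" if "I \<in> C" "u < fst I" "v < fst I" "u \<noteq> v" for I u v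
    using rc_bound[OF that(1)] that by simp
  have "know C (Suc r) K1"
    by (rule know_map[OF know_send[OF P[unfolded pub_def], where w=w1 and B=B], where h=id])
       (auto simp: K1_def w1_bound)
  \<comment> \<open>Relay x forwards to leader b the word of the member of rank x div W, unique by
    \<open>rank_inj\<close>. Entries \<open>rc x\<close> that a relay has from itself are available
    because \<open>know_send\<close> supplies them.\<close>
  moreover define w2 where "w2 k b = (let ((i, p), rc) = k; x = fst (snd i) in
     if \<exists>v. v \<in> act p \<and> v \<noteq> x \<and> leader p v = b \<and> rk p v = x div W p
     then rc (THE v. v \<in> act p \<and> leader p v = b \<and> rk p v = x div W p) else
     if x \<in> act p \<and> leader p x = b \<and> rk p x = x div W p then rc x else 0)"
    for k :: "((nat \<times> nat \<times> nat set \<times> nat set) \<times> 'p) \<times> (nat \<Rightarrow> nat)" and b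
  define K2 where "K2 I v = (K1 I v, \<lambda>x. if x < fst I then w2 (K1 I x) v else 0)" for I v
  have K1_eq: "w2 (K1 I (rk (P I) v * W (P I) + j)) b = word_of (M (P I)) (S (inp I v) (P I)) j"
    if I: "I \<in> C" and v: "v \<in> act (P I)" "leader (P I) v = b" and j: "j < W (P I)" for I v b j
  proof -
    let ?x = "rk (P I) v * W (P I) + j"
    have fin: "finite (act (P I))" using finite_subset[OF act[OF I]] by simp
    have div: "?x div W (P I) = rk (P I) v" using j by simp
    have uniq: "u = v" if "u \<in> act (P I)" "leader (P I) u = b" "rk (P I) u = rk (P I) v" for u
      using rank_inj[OF fin that(1) v(1), of "leader (P I)"] that v by (simp add: rk_def)
    then have "(THE u. u \<in> act (P I) \<and> leader (P I) u = b \<and> rk (P I) u = rk (P I) v) = v"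
      using v by (intro the_equality) auto
    moreover have "v < fst I" using act[OF I] v by auto
    ultimately show ?thesis
      using v div uniq by (auto simp: w2_def K1_def inp_def w1_def Let_def simp del: div_mult_self3)
  qed
  have w2_bound: "w2 (K1 I x) b < fst I ^ B" if "I \<in> C" "x < fst I" "b < fst I" "x \<noteq> b" for I x b
  proof -
    have "fst I \<ge> 2" using that by linarith
    with rc_bound[OF that(1)] that(1) show ?thesis
      by (simp add: w2_def K1_def Let_def inp_def)
  qed
  have "know C (Suc (Suc r)) K2"
    by (rule know_map[OF know_send[OF \<open>know C (Suc r) K1\<close>, where w=w2 and B=B], where h=id])
       (auto simp: K2_def w2_bound)
  define F where "F I b = (\<lambda>u. if u \<in> act (P I) \<and> leader (P I) u = b then S (inp I u) (P I) else {})" for I b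
  \<comment> \<open>Ranks depend on public data only, so the leader knows which relays carry the
    words of which member and can strip the padding \<open>M\<close>.\<close>
  define dec where "dec k = (\<lambda>u. let (((i, p), _), rc) = k; b = fst (snd i) in
    if u \<in> act p \<and> leader p u = b then (\<lambda>j. rc (rk p u * W p + j)) ` {..<W p} - {M p} else {})"
    for k :: "(((nat \<times> nat \<times> nat set \<times> nat set) \<times> 'p) \<times> (nat \<Rightarrow> nat)) \<times> (nat \<Rightarrow> nat)"
  have dec: "dec (K2 I b) = F I b" if I: "I \<in> C" for I b
  proof
    fix u
    show "dec (K2 I b) u = F I b u"
    proof (cases "u \<in> act (P I) \<and> leader (P I) u = b")
      case True
      then have "snd (K2 I b) (rk (P I) u * W (P I) + j) = word_of (M (P I)) (S (inp I u) (P I)) j"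
        if "j < W (P I)" for j
        using K1_eq[OF I _ _ that] rk_bound[OF I _ that] by (auto simp: K2_def)
      then have "dec (K2 I b) u = word_of (M (P I)) (S (inp I u) (P I)) ` {..<W (P I)} - {M (P I)}"
        using True by (auto simp: dec_def K1_def K2_def Let_def inp_def)
      then show ?thesis using word_of_decode[OF S[OF I] card_S[OF I]] True by (simp add: F_def)
    qed (auto simp: dec_def F_def K1_def K2_def Let_def inp_def)
  qed
  define K2' where "K2' I b = ((inp I b, P I), F I b)" for I b
  have "know C (Suc (Suc r)) K2'"
    by (rule know_map[OF \<open>know C (Suc (Suc r)) K2\<close>, where h="\<lambda>k. (fst (fst k), dec k)"])
       (simp add: K2'_def dec, simp add: K2_def K1_def)
  define w3 where "w3 k v = (let ((i, p), f) = k in out p (fst (snd i)) f v)"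
    for k :: "((nat \<times> nat \<times> nat set \<times> nat set) \<times> 'p) \<times> (nat \<Rightarrow> nat set)" and v
  define K3 where "K3 I v = ((inp I v, P I), if v \<in> act (P I) then out (P I) (leader (P I) v) (F I (leader (P I) v)) v else 0)" for I v
  have "know C (Suc (Suc (Suc r))) K3"
  proof (rule know_map[OF know_send[OF \<open>know C (Suc (Suc r)) K2'\<close>, where w=w3 and B=B],
      where h="\<lambda>k. let ((i, p), _) = fst k; v = fst (snd i) in ((i, p), if v \<in> act p then snd k (leader p v) else 0)"])
    show "w3 (K2' I u) v < fst I ^ B" if "I \<in> C" "u < fst I" "v < fst I" "u \<noteq> v" for I u v
      using out[OF that(1)] that by (auto simp: w3_def K2'_def)
  qed (auto simp: K3_def K2'_def w3_def inp_def leader)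
  \<comment> \<open>Fourth round: every vertex broadcasts the output it received, which makes the
    whole result public.\<close>
  from know_send[OF this, where w="\<lambda>k _. snd k" and B=B]
  have "know C (Suc (Suc (Suc (Suc r)))) (\<lambda>I v. (K3 I v, \<lambda>u. if u < fst I then snd (K3 I u) else 0))"
    using out by (auto simp: K3_def)
  moreover have "Suc (Suc (Suc (Suc r))) = r + 4" by simp
  ultimately have "know C (r + 4) (\<lambda>I v. (K3 I v, \<lambda>u. if u < fst I then snd (K3 I u) else 0))" by metis
  then show ?thesis unfolding pub_def
    by (rule know_map[where h="\<lambda>k. (fst (fst (fst k)), snd (fst (fst k)), snd k)"])
       (use act in \<open>auto simp: K3_def F_def fun_eq_iff\<close>)
qed

section \<open>Colouring bins of vertices\<close>

abbreviation nbs :: "inst \<Rightarrow> nat \<Rightarrow> nat set" where "nbs I \<equiv> neighbours (fst (snd I))"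
abbreviation pal :: "inst \<Rightarrow> nat \<Rightarrow> nat set" where "pal I \<equiv> snd (snd I)"
abbreviation deg :: "inst \<Rightarrow> nat" where "deg I \<equiv> max_degree (fst I) (fst (snd I))"

definition wf_inst :: "inst \<Rightarrow> bool" where
  "wf_inst I \<longleftrightarrow> simple_graph (fst I) (fst (snd I)) \<and> list_assignment (fst I) (fst (snd I)) (pal I)"

lemma nbs_sym: "u \<in> nbs I v \<longleftrightarrow> v \<in> nbs I u"
  by (simp add: neighbours_def insert_commute)

lemma nbs_bounds:
  assumes "wf_inst I" "u \<in> nbs I v" shows "u < fst I" "v < fst I" "u \<noteq> v"
  using assms by (auto simp: wf_inst_def simple_graph_def neighbours_def subset_iff doubleton_eq_iff)

lemma nbs_subset: "wf_inst I \<Longrightarrow> nbs I v \<subseteq> {..<fst I}"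
  using nbs_bounds by blast

lemma finite_nbs: "wf_inst I \<Longrightarrow> finite (nbs I v)"
  using nbs_subset finite_subset by blast

lemma card_nbs: "v < fst I \<Longrightarrow> card (nbs I v) \<le> deg I"
  unfolding max_degree_def by (rule Max_ge) auto

lemma card_pal: "wf_inst I \<Longrightarrow> v < fst I \<Longrightarrow> card (pal I v) = deg I + 1"
  by (simp add: wf_inst_def list_assignment_def)

lemma finite_pal: "wf_inst I \<Longrightarrow> v < fst I \<Longrightarrow> finite (pal I v)"
  by (metis card_pal card.infinite add_is_0 one_neq_zero)

text \<open>Vertices are added one at a time. The neighbours of the new vertex occupy fewer colours
  than its list has, so the pigeonhole principle leaves one.\<close>

lemma greedy_colouring:
  assumes "finite A" "\<And>v. v \<in> A \<Longrightarrow> card {u \<in> A. u \<in> N v} < card (L v)"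
    and sym: "\<And>u v. u \<in> N v \<Longrightarrow> v \<in> N u" and irrefl: "\<And>v. v \<notin> N v"
  shows "\<exists>g. (\<forall>v\<in>A. g v \<in> L v) \<and> (\<forall>v\<in>A. \<forall>u\<in>A. u \<in> N v \<longrightarrow> g u \<noteq> g v)"
  using assms(1,2)
proof (induction A rule: finite_induct)
  case (insert x A)
  have "card {u \<in> A. u \<in> N v} < card (L v)" if "v \<in> A" for v
  proof -
    have "card {u \<in> A. u \<in> N v} \<le> card {u \<in> insert x A. u \<in> N v}"
      using insert.hyps by (intro card_mono) auto
    with insert.prems[of v] that show ?thesis by auto
  qed
  with insert.IH obtain g where g: "\<forall>v\<in>A. g v \<in> L v" "\<forall>v\<in>A. \<forall>u\<in>A. u \<in> N v \<longrightarrow> g u \<noteq> g v"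
    by blast
  have "{u \<in> insert x A. u \<in> N x} = {u \<in> A. u \<in> N x}" using irrefl by auto
  then have "card (g ` {u \<in> A. u \<in> N x}) < card (L x)"
    using insert.prems[of x] card_image_le[of "{u \<in> A. u \<in> N x}" g] insert.hyps by force
  then obtain c where c: "c \<in> L x" "c \<notin> g ` {u \<in> A. u \<in> N x}"
    using card_mono[of "g ` {u \<in> A. u \<in> N x}" "L x"] insert.hyps(1) by fastforce
  show ?case
  proof (intro exI[of _ "g(x := c)"] conjI ballI impI)
    fix v u assume "v \<in> insert x A" "u \<in> insert x A" "u \<in> N v"
    then show "(g(x := c)) u \<noteq> (g(x := c)) v"
      using g(2) c(2) insert.hyps(2) irrefl sym[of u v] by (cases "v = x"; cases "u = x") auto
  qed (use g c in auto)
qed simp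

definition partial_colouring :: "inst \<Rightarrow> (nat \<Rightarrow> nat option) \<Rightarrow> bool" where
  "partial_colouring I f \<longleftrightarrow> (\<forall>v c. f v = Some c \<longrightarrow> v < fst I \<and> c \<in> pal I v) \<and>
     (\<forall>u v c. u \<in> nbs I v \<longrightarrow> f u = Some c \<longrightarrow> f v \<noteq> Some c)"

text \<open>Takes a neighbourhood and a list instead of an instance and a vertex, so that a vertex
  can evaluate it from its own input and the public colouring.\<close>

definition free :: "nat set \<Rightarrow> nat set \<Rightarrow> (nat \<Rightarrow> nat option) \<Rightarrow> nat set" where
  "free N L f = {c \<in> L. \<forall>u\<in>N. f u \<noteq> Some c}"

text \<open>Each coloured neighbour removes at most one colour. Both a deficit of the degree against
  \<Delta> and uncoloured neighbours therefore count as slack.\<close>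

lemma card_free:
  assumes "wf_inst I" "v < fst I"
  shows "card (free (nbs I v) (pal I v) f) \<ge> deg I + 1 - card (nbs I v) + card {u \<in> nbs I v. f u = None}"
proof -
  let ?C = "{u \<in> nbs I v. f u \<noteq> None}"
  have fin: "finite (nbs I v)" by (rule finite_nbs[OF assms(1)])
  have "free (nbs I v) (pal I v) f = pal I v - (the \<circ> f) ` ?C"
    by (force simp: free_def)
  then have "card (free (nbs I v) (pal I v) f) \<ge> card (pal I v) - card ((the \<circ> f) ` ?C)"
    using fin diff_card_le_card_Diff[of "(the \<circ> f) ` ?C" "pal I v"] by simp
  moreover have "card ((the \<circ> f) ` ?C) \<le> card ?C" using fin by (intro card_image_le) auto
  moreover have "card (nbs I v) = card ?C + card {u \<in> nbs I v. f u = None}"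
    using fin by (subst card_Un_disjoint[symmetric]) (auto intro: arg_cong[where f=card])
  moreover have "card (nbs I v) \<le> deg I" by (rule card_nbs[OF assms(2)])
  ultimately show ?thesis using card_pal[OF assms] by linarith
qed

text \<open>All bins are coloured at once without interaction: a vertex only uses free colours
  hashed to its own leader, so adjacent vertices of different bins cannot clash. Inside a bin the
  leader colours greedily.\<close>

lemma pub_colour_bins:
  fixes f :: "'p \<Rightarrow> nat \<Rightarrow> nat option"
  assumes P: "pub C r P"
    and wf: "\<And>I. I \<in> C \<Longrightarrow> wf_inst I"
    and f: "\<And>I. I \<in> C \<Longrightarrow> partial_colouring I (f (P I))"
    and act: "\<And>I. I \<in> C \<Longrightarrow> act (P I) \<subseteq> {..<fst I}"
    and leader: "\<And>I v. I \<in> C \<Longrightarrow> v \<in> act (P I) \<Longrightarrow> leader (P I) v < fst I"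
    and uncoloured: "\<And>I v. I \<in> C \<Longrightarrow> v \<in> act (P I) \<Longrightarrow> f (P I) v = None"
    and bin_deg: "\<And>I v. I \<in> C \<Longrightarrow> v \<in> act (P I) \<Longrightarrow>
      card {u \<in> nbs I v. u \<in> act (P I) \<and> leader (P I) u = leader (P I) v} \<le> d (P I)"
    and bin_pal: "\<And>I v. I \<in> C \<Longrightarrow> v \<in> act (P I) \<Longrightarrow>
      card {u \<in> nbs I v. u \<in> act (P I) \<and> leader (P I) u = leader (P I) v}
        < card {c \<in> free (nbs I v) (pal I v) (f (P I)). hash (P I) c = leader (P I) v}"
    and size: "\<And>I b. I \<in> C \<Longrightarrow> card {v \<in> act (P I). leader (P I) v = b} * (2 * d (P I) + 1) \<le> fst I"
    and M: "\<And>I v. I \<in> C \<Longrightarrow> v < fst I \<Longrightarrow> pal I v \<subseteq> {..<M (P I)}" "\<And>I. I \<in> C \<Longrightarrow> fst I \<le> M (P I)"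
      "\<And>I. I \<in> C \<Longrightarrow> fst I \<ge> 2 \<Longrightarrow> 2 * M (P I) < fst I ^ B"
  shows "\<exists>f'. pub C (r + 4) (\<lambda>I. (P I, f' I)) \<and> (\<forall>I\<in>C. partial_colouring I (f' I) \<and>
    (\<forall>v\<in>act (P I). f' I v \<noteq> None) \<and> (\<forall>v. v \<notin> act (P I) \<longrightarrow> f' I v = f (P I) v))"
proof -
  define Nb where "Nb p v N = {u \<in> N. u \<in> act p \<and> leader p u = leader p v}" for p v N
  define Cs where "Cs p v N L = {c \<in> free N L (f p). hash p c = leader p v}" for p v N L
  \<comment> \<open>The list is cut down to one colour more than the degree in the bin. Greedy
    colouring needs no more, and a vertex then has at most 2 d + 1 words to send.\<close>
  define Ds where "Ds p v N L = (SOME D. D \<subseteq> Cs p v N L \<and> card D = card (Nb p v N) + 1)" for p v N L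
  \<comment> \<open>Neighbours become even and colours odd numbers, so a single set below 2 M
    carries both.\<close>
  define S where "S i p = (let (n, v, N, L) = i in (\<lambda>u. 2 * u) ` Nb p v N \<union> (\<lambda>c. 2 * c + 1) ` Ds p v N L)"
    for i :: "nat \<times> nat \<times> nat set \<times> nat set" and p
  \<comment> \<open>Phrased through the collected sets alone, without the instance, so that the
    leader can search for such a colouring.\<close>
  define good where "good p b F g \<longleftrightarrow> (\<forall>v. v \<in> act p \<and> leader p v = b \<longrightarrow> 2 * g v + 1 \<in> F v \<and> (\<forall>u. 2 * u \<in> F v \<longrightarrow> g u \<noteq> g v))"
    for p b and F :: "nat \<Rightarrow> nat set" and g :: "nat \<Rightarrow> nat"
  \<comment> \<open>The cut at 2 M gives the word bound for arbitrary \<open>F\<close>, as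
    \<open>pub_collect\<close> demands; the colours that really occur pass it unchanged.\<close>
  define out where "out p b F v = (let x = (SOME g. good p b F g) v in if x < 2 * M p then x else 0)" for p b F v
  define F where "F I v = (\<lambda>u. if u \<in> act (P I) \<and> leader (P I) u = leader (P I) v then S (inp I u) (P I) else {})" for I v
  define res where "res I v = (if v \<in> act (P I) then out (P I) (leader (P I) v) (F I v) v else 0)" for I v
  define f' where "f' I v = (if v \<in> act (P I) then Some (res I v) else f (P I) v)" for I v
  have Ds: "Ds (P I) v (nbs I v) (pal I v) \<subseteq> Cs (P I) v (nbs I v) (pal I v)"
    "card (Ds (P I) v (nbs I v) (pal I v)) = card (Nb (P I) v (nbs I v)) + 1"
    if "I \<in> C" "v \<in> act (P I)" for I v
  proof -
    have "card (Nb (P I) v (nbs I v)) + 1 \<le> card (Cs (P I) v (nbs I v) (pal I v))"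
      using bin_pal[OF that] by (simp add: Nb_def Cs_def)
    then have "\<exists>D. D \<subseteq> Cs (P I) v (nbs I v) (pal I v) \<and> card D = card (Nb (P I) v (nbs I v)) + 1"
      by (metis obtain_subset_with_card_n)
    from someI_ex[OF this] show "Ds (P I) v (nbs I v) (pal I v) \<subseteq> Cs (P I) v (nbs I v) (pal I v)"
      "card (Ds (P I) v (nbs I v) (pal I v)) = card (Nb (P I) v (nbs I v)) + 1"
      unfolding Ds_def by auto
  qed
  have S_subset: "S (inp I v) (P I) \<subseteq> {..<2 * M (P I)}" if "I \<in> C" "v \<in> act (P I)" for I v
  proof -
    have "v < fst I" using act that by blast
    moreover have "Ds (P I) v (nbs I v) (pal I v) \<subseteq> pal I v" using Ds(1)[OF that] by (auto simp: Cs_def free_def)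
    ultimately show ?thesis
      using nbs_subset[OF wf[OF that(1)], of v] M(1)[OF that(1), of v] M(2)[OF that(1)]
      by (fastforce simp: S_def inp_def Nb_def)
  qed
  have S_card: "card (S (inp I v) (P I)) \<le> 2 * d (P I) + 1" if "I \<in> C" "v \<in> act (P I)" for I v
  proof -
    have "card (S (inp I v) (P I)) \<le> card ((\<lambda>u. 2 * u) ` Nb (P I) v (nbs I v)) + card ((\<lambda>c. 2 * c + 1) ` Ds (P I) v (nbs I v) (pal I v))"
      by (auto simp: S_def inp_def intro: card_Un_le)
    also have "\<dots> = card (Nb (P I) v (nbs I v)) + card (Ds (P I) v (nbs I v) (pal I v))"
      by (simp add: card_image inj_on_def)
    also have "\<dots> \<le> 2 * d (P I) + 1"
      using Ds(2)[OF that] bin_deg[OF that] by (simp add: Nb_def)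
    finally show ?thesis .
  qed
  have "pub C (r + 4) (\<lambda>I. (P I, \<lambda>v. if v \<in> act (P I) then
     out (P I) (leader (P I) v)
       (\<lambda>u. if u \<in> act (P I) \<and> leader (P I) u = leader (P I) v then S (inp I u) (P I) else {}) v else 0))"
  proof (rule pub_collect[where act=act and leader=leader and S=S and M="\<lambda>p. 2 * M p" and
        W="\<lambda>p. 2 * d p + 1" and B=B and out=out])
    show "out (P I) b F v < fst I ^ B" if "I \<in> C" "2 \<le> fst I" for I b F v
      using M(3)[OF that] that by (auto simp: out_def Let_def)
  qed (use P act leader S_subset S_card M size in auto)
  then have "pub C (r + 4) (\<lambda>I. (P I, res I))"
    by (simp add: res_def[abs_def] F_def cong: if_cong)
  then have "pub C (r + 4) (\<lambda>I. (P I, f' I))"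
    by (rule pub_map[where h="\<lambda>n p. (fst p, \<lambda>v. if v \<in> act (fst p) then Some (snd p v) else f (fst p) v)"])
       (auto simp: f'_def)
  moreover have res: "res I v \<in> Cs (P I) v (nbs I v) (pal I v) \<and>
      (\<forall>u \<in> Nb (P I) v (nbs I v). res I u \<noteq> res I v)" if I: "I \<in> C" and v: "v \<in> act (P I)" for I v
  proof -
    define b where "b = leader (P I) v"
    let ?A = "{u \<in> act (P I). leader (P I) u = b}"
    have "finite (act (P I))" using finite_subset[OF act[OF I]] by simp
    then have ex_g: "\<exists>g. (\<forall>u\<in>?A. g u \<in> Ds (P I) u (nbs I u) (pal I u)) \<and> (\<forall>u\<in>?A. \<forall>w\<in>?A. w \<in> nbs I u \<longrightarrow> g w \<noteq> g u)"
    proof (intro greedy_colouring)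
      fix u assume "u \<in> {u \<in> act (P I). leader (P I) u = b}"
      then have "{w \<in> ?A. w \<in> nbs I u} = Nb (P I) u (nbs I u)" "u \<in> act (P I)" by (auto simp: Nb_def)
      then show "card {w \<in> ?A. w \<in> nbs I u} < card (Ds (P I) u (nbs I u) (pal I u))"
        using Ds(2)[OF I] by simp
    qed (use nbs_bounds[OF wf[OF I]] nbs_sym in auto)
    have FS: "F I v u = S (inp I u) (P I)" if "u \<in> ?A" for u
      using that by (simp add: F_def b_def)
    have S_iff: "2 * x + 1 \<in> S (inp I u) (P I) \<longleftrightarrow> x \<in> Ds (P I) u (nbs I u) (pal I u)"
      "2 * x \<in> S (inp I u) (P I) \<longleftrightarrow> x \<in> Nb (P I) u (nbs I u)" for x u
      by (auto simp: S_def inp_def) presburger+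
    have ex_good: "\<exists>g. good (P I) b (F I v) g"
    proof -
      from ex_g obtain g where g: "\<And>u. u \<in> ?A \<Longrightarrow> g u \<in> Ds (P I) u (nbs I u) (pal I u)"
        "\<And>u w. u \<in> ?A \<Longrightarrow> w \<in> ?A \<Longrightarrow> w \<in> nbs I u \<Longrightarrow> g w \<noteq> g u" by blast
      have "2 * g u + 1 \<in> F I v u \<and> (\<forall>w. 2 * w \<in> F I v u \<longrightarrow> g w \<noteq> g u)" if u: "u \<in> ?A" for u
        unfolding FS[OF u] S_iff using g(1)[OF u] g(2)[OF u] u by (simp add: Nb_def)
      then show ?thesis unfolding good_def by blast
    qed
    define g where "g = (SOME g. good (P I) b (F I v) g)"
    have "good (P I) b (F I v) g"
      unfolding g_def by (rule someI_ex[OF ex_good])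
    then have g: "2 * g u + 1 \<in> F I v u \<and> (\<forall>w. 2 * w \<in> F I v u \<longrightarrow> g w \<noteq> g u)" if "u \<in> ?A" for u
      using that unfolding good_def by blast
    \<comment> \<open>All vertices of the bin refer to the same collected data, hence to one and the
      same \<open>SOME\<close> colouring g.\<close>
    have F_eq: "F I u = F I v" if "u \<in> ?A" for u using that by (auto simp: F_def b_def)
    have gD: "g u \<in> Ds (P I) u (nbs I u) (pal I u)" "w \<in> Nb (P I) u (nbs I u) \<Longrightarrow> g w \<noteq> g u" if "u \<in> ?A" for u w
      using g[OF that] unfolding FS[OF that] S_iff by auto
    have "res I u = g u" if u: "u \<in> ?A" for u
    proof -
      have "2 * g u + 1 \<in> S (inp I u) (P I)" using gD(1)[OF u] S_iff by simp
      with S_subset[OF I, of u] u have "g u < 2 * M (P I)" by auto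
      then show ?thesis using u F_eq[OF u] by (simp add: res_def out_def g_def)
    qed
    moreover have "v \<in> ?A" using v by (simp add: b_def)
    moreover have "Nb (P I) v (nbs I v) \<subseteq> ?A" by (auto simp: Nb_def b_def)
    ultimately show ?thesis using gD[of v] Ds(1)[OF I v] by auto
  qed
  moreover have "partial_colouring I (f' I)" if I: "I \<in> C" for I
    unfolding partial_colouring_def
  proof (intro conjI allI impI)
    fix v c assume "f' I v = Some c"
    then show "v < fst I" "c \<in> pal I v"
      using f[OF I] act[OF I] res[OF I, of v]
      by (auto simp: f'_def partial_colouring_def Cs_def free_def split: if_splits)
  next
    fix u v c assume uv: "u \<in> nbs I v" and "f' I u = Some c"
    moreover have False if "f' I v = Some c"
    proof -
      have free: "res I x \<in> Cs (P I) x (nbs I x) (pal I x)" if "x \<in> act (P I)" for x using res[OF I that] by blast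
      have vu: "v \<in> nbs I u" using uv nbs_sym by blast
      show False
      \<comment> \<open>Two active vertices with a common colour have the same hash value, hence the
        same leader, so the colouring of that bin separates them. If one is not active,
        \<open>free\<close> or the old colouring does.\<close>
      proof (cases "u \<in> act (P I) \<and> v \<in> act (P I)")
        case True
        with \<open>f' I u = Some c\<close> that have "res I u = c" "res I v = c" by (auto simp: f'_def)
        with free[of u] free[of v] True have "leader (P I) u = leader (P I) v" by (auto simp: Cs_def)
        with res[OF I, of v] True uv \<open>res I u = c\<close> \<open>res I v = c\<close> show False by (auto simp: Nb_def)
      next
        case False
        with \<open>f' I u = Some c\<close> that show False
          using f[OF I] uv vu free[of u] free[of v]
          by (auto simp: f'_def Cs_def free_def partial_colouring_def split: if_splits)
      qed
    qed
    ultimately show "f' I v \<noteq> Some c" by blast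
  qed
  ultimately show ?thesis by (intro exI[of _ f']) (auto simp: f'_def)
qed

text \<open>The case of a single bin with leader 0 and constant hash. The palettes are then large
  enough by themselves, because active neighbours are uncoloured and so have removed no
  colour.\<close>

lemma pub_colour_set:
  fixes f :: "'p \<Rightarrow> nat \<Rightarrow> nat option"
  assumes P: "pub C r P"
    and wf: "\<And>I. I \<in> C \<Longrightarrow> wf_inst I"
    and f: "\<And>I. I \<in> C \<Longrightarrow> partial_colouring I (f (P I))"
    and act: "\<And>I. I \<in> C \<Longrightarrow> act (P I) \<subseteq> {..<fst I}"
    and uncoloured: "\<And>I v. I \<in> C \<Longrightarrow> v \<in> act (P I) \<Longrightarrow> f (P I) v = None"
    and act_deg: "\<And>I v. I \<in> C \<Longrightarrow> v \<in> act (P I) \<Longrightarrow> card {u \<in> nbs I v. u \<in> act (P I)} \<le> d (P I)"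
    and size: "\<And>I. I \<in> C \<Longrightarrow> card (act (P I)) * (2 * d (P I) + 1) \<le> fst I"
    and M: "\<And>I v. I \<in> C \<Longrightarrow> v < fst I \<Longrightarrow> pal I v \<subseteq> {..<M (P I)}" "\<And>I. I \<in> C \<Longrightarrow> fst I \<le> M (P I)"
      "\<And>I. I \<in> C \<Longrightarrow> fst I \<ge> 2 \<Longrightarrow> 2 * M (P I) < fst I ^ B"
  shows "\<exists>f'. pub C (r + 4) (\<lambda>I. (P I, f' I)) \<and> (\<forall>I\<in>C. partial_colouring I (f' I) \<and>
    (\<forall>v\<in>act (P I). f' I v \<noteq> None) \<and> (\<forall>v. v \<notin> act (P I) \<longrightarrow> f' I v = f (P I) v))"
proof (rule pub_colour_bins[where leader="\<lambda>_ _. 0" and hash="\<lambda>_ _. 0" and d=d and M=M and B=B, OF P wf f act _ uncoloured _ _ _ M])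
  show "card {u \<in> nbs I v. u \<in> act (P I) \<and> (0::nat) = 0}
        < card {c \<in> free (nbs I v) (pal I v) (f (P I)). (0::nat) = 0}"
    if I: "I \<in> C" and v: "v \<in> act (P I)" for I v
  proof -
    have "v < fst I" using act[OF I] v by blast
    have "card {u \<in> nbs I v. u \<in> act (P I)} \<le> card {u \<in> nbs I v. f (P I) u = None}"
      using finite_nbs[OF wf[OF I]] uncoloured[OF I] by (intro card_mono) auto
    then show ?thesis
      using card_free[OF wf[OF I] \<open>v < fst I\<close>, of "f (P I)"] card_nbs[OF \<open>v < fst I\<close>] by simp
  qed
  show "card {v \<in> act (P I). (0::nat) = b} * (2 * d (P I) + 1) \<le> fst I" if "I \<in> C" for I b
    using size[OF that] by (cases "b = 0") auto
  show "0 < fst I" if "I \<in> C" "v \<in> act (P I)" for I v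
    using act[OF that(1)] that(2) by auto
  show "card {u \<in> nbs I v. u \<in> act (P I) \<and> (0::nat) = 0} \<le> d (P I)"
    if "I \<in> C" "v \<in> act (P I)" for I v using act_deg[OF that] by simp
qed

section \<open>Concentration and hard-wired candidates\<close>

text \<open>The exponential turns the count into a product of independent factors, each 1 + (exp t -
  1) times an indicator.\<close>

lemma expectation_exp_count:
  fixes q :: "'b pmf"
  assumes "finite A" "S \<subseteq> A"
  shows "measure_pmf.expectation (Pi_pmf A d (\<lambda>_. q)) (\<lambda>x. exp (t * real (card {i \<in> S. x i \<in> Q}))) =
    (1 + (exp t - 1) * measure_pmf.prob q Q) ^ card S"
    and "integrable (measure_pmf (Pi_pmf A d (\<lambda>_. q))) (\<lambda>x. exp (t * real (card {i \<in> S. x i \<in> Q})))"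
proof -
  define h where "h i y = 1 + (if i \<in> S then exp t - 1 else 0) * indicator Q y" for i and y :: 'b
  have fin: "finite S" using assms finite_subset by blast
  have eq: "exp (t * real (card {i \<in> S. x i \<in> Q})) = (\<Prod>i\<in>A. h i (x i))" for x
  proof -
    have "(\<Prod>i\<in>A. h i (x i)) = (\<Prod>i\<in>{i \<in> S. x i \<in> Q}. exp t)"
      using assms by (intro prod.mono_neutral_cong_right) (auto simp: h_def indicator_def)
    then show ?thesis by (simp add: exp_of_nat_mult[symmetric] mult.commute)
  qed
  have int: "integrable (measure_pmf q) (h i)" for i
    unfolding h_def by (intro Bochner_Integration.integrable_add integrable_mult_right)
      (auto intro!: integrable_real_indicator simp: measure_pmf.emeasure_eq_measure)
  have nonneg: "h i y \<ge> 0" for i y by (simp add: h_def indicator_def)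
  have "measure_pmf.expectation (Pi_pmf A d (\<lambda>_. q)) (\<lambda>x. \<Prod>i\<in>A. h i (x i)) = (\<Prod>i\<in>A. measure_pmf.expectation q (h i))"
    by (rule expectation_prod_Pi_pmf) (use assms int nonneg in auto)
  also have "\<dots> = (\<Prod>i\<in>A. if i \<in> S then 1 + (exp t - 1) * measure_pmf.prob q Q else 1)"
  proof (intro prod.cong refl)
    fix i
    have "measure_pmf.expectation q (h i) = measure_pmf.expectation q (\<lambda>_. 1) +
        measure_pmf.expectation q (\<lambda>y. (if i \<in> S then exp t - 1 else 0) * indicator Q y)"
      unfolding h_def
      by (intro Bochner_Integration.integral_add integrable_mult_right)
         (auto intro!: integrable_real_indicator simp: measure_pmf.emeasure_eq_measure)
    then show "measure_pmf.expectation q (h i) = (if i \<in> S then 1 + (exp t - 1) * measure_pmf.prob q Q else 1)"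
      by simp
  qed
  also have "\<dots> = (1 + (exp t - 1) * measure_pmf.prob q Q) ^ card S"
    using assms by (simp add: prod.If_cases Int_absorb1)
  finally show "measure_pmf.expectation (Pi_pmf A d (\<lambda>_. q)) (\<lambda>x. exp (t * real (card {i \<in> S. x i \<in> Q}))) =
    (1 + (exp t - 1) * measure_pmf.prob q Q) ^ card S" unfolding eq .
  show "integrable (measure_pmf (Pi_pmf A d (\<lambda>_. q))) (\<lambda>x. exp (t * real (card {i \<in> S. x i \<in> Q})))"
    unfolding eq by (rule integrable_prod_Pi_pmf) (use assms int in auto)
qed

lemma exp_le_quadratic:
  fixes t :: real assumes "\<bar>t\<bar> \<le> 1" shows "exp t \<le> 1 + t + t\<^sup>2"
proof (cases "t \<ge> 0")
  case False
  have "1 \<le> 1 + (- t) ^ 3" using False by simp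
  also have "\<dots> = (1 + t + t\<^sup>2) * (1 + (- t))" by (simp add: algebra_simps power2_eq_square power3_eq_cube)
  also have "\<dots> \<le> (1 + t + t\<^sup>2) * exp (- t)"
  proof (rule mult_left_mono[OF exp_ge_add_one_self])
    show "0 \<le> 1 + t + t\<^sup>2" using assms zero_le_power2[of t] by linarith
  qed
  finally show ?thesis by (simp add: exp_minus field_simps)
qed (use assms exp_bound in auto)

text \<open>Markov's inequality for the exponential moment. The sign of t is left open so that both
  tails follow from one statement.\<close>

lemma chernoff:
  fixes q :: "'b pmf"
  assumes "finite A" "S \<subseteq> A" "\<bar>t\<bar> \<le> 1"
  shows "measure_pmf.prob (Pi_pmf A d (\<lambda>_. q)) {x. t * real (card {i \<in> S. x i \<in> Q}) \<ge> b}
    \<le> exp (real (card S) * measure_pmf.prob q Q * (t + t\<^sup>2) - b)"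
proof -
  let ?M = "Pi_pmf A d (\<lambda>_. q)" and ?p = "measure_pmf.prob q Q"
  let ?X = "\<lambda>x. exp (t * real (card {i \<in> S. x i \<in> Q}))"
  have "measure_pmf.prob ?M {x \<in> space (measure_pmf ?M). ?X x \<ge> exp b} \<le> measure_pmf.expectation ?M ?X / exp b"
    by (rule integral_Markov_inequality_measure[where A="{}"])
       (auto intro: expectation_exp_count(2)[OF assms(1,2)])
  also have "\<dots> = (1 + (exp t - 1) * ?p) ^ card S / exp b"
    by (simp add: expectation_exp_count(1)[OF assms(1,2)])
  also have "\<dots> \<le> exp ((t + t\<^sup>2) * ?p) ^ card S / exp b"
  proof (intro divide_right_mono power_mono)
    have "exp t - 1 \<le> t + t\<^sup>2"
      using exp_le_quadratic[OF assms(3)] by linarith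
    then have "(exp t - 1) * ?p \<le> (t + t\<^sup>2) * ?p" by (intro mult_right_mono) auto
    then show "1 + (exp t - 1) * ?p \<le> exp ((t + t\<^sup>2) * ?p)"
      using exp_ge_add_one_self[of "(t + t\<^sup>2) * ?p"] by linarith
    have "exp t * ?p \<ge> 0" "?p \<le> 1" by (simp_all add: measure_pmf.prob_le_1)
    then have "(exp t - 1) * ?p \<ge> - 1"
      unfolding left_diff_distrib by linarith
    then show "0 \<le> 1 + (exp t - 1) * ?p" by linarith
  qed auto
  also have "\<dots> = exp (real (card S) * ?p * (t + t\<^sup>2) - b)"
    by (simp add: exp_of_nat_mult[symmetric] exp_diff mult_ac)
  finally show ?thesis by simp
qed

text \<open>Here m bounds the mean in the threshold and the possibly larger M bounds it in the
  quadratic term, so rough bounds on the mean suffice.\<close>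

lemma chernoff_upper:
  fixes q :: "'b pmf"
  assumes "finite A" "S \<subseteq> A" "real (card S) * measure_pmf.prob q Q \<le> m" "m \<le> M" "0 \<le> l" "l \<le> 2 * M" "M > 0"
  shows "measure_pmf.prob (Pi_pmf A d (\<lambda>_. q)) {x. real (card {i \<in> S. x i \<in> Q}) \<ge> m + l}
    \<le> exp (- l\<^sup>2 / (4 * M))"
proof (cases "l = 0")
  case False
  let ?m = "real (card S) * measure_pmf.prob q Q"
  define t where "t = l / (2 * M)"
  have t: "0 < t" "t \<le> 1" using assms False by (auto simp: t_def)
  have eq: "{x. real (card {i \<in> S. x i \<in> Q}) \<ge> m + l} = {x. t * real (card {i \<in> S. x i \<in> Q}) \<ge> t * (m + l)}"
    using t by simp
  have "measure_pmf.prob (Pi_pmf A d (\<lambda>_. q)) {x. real (card {i \<in> S. x i \<in> Q}) \<ge> m + l}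
    \<le> exp (?m * (t + t\<^sup>2) - t * (m + l))"
    unfolding eq using t by (intro chernoff assms) auto
  also have "\<dots> \<le> exp (M * t\<^sup>2 - t * l)"
  proof -
    have "?m * t \<le> m * t" "?m * t\<^sup>2 \<le> M * t\<^sup>2"
      using assms(3,4) t by (auto intro!: mult_right_mono)
    then show ?thesis by (simp add: algebra_simps)
  qed
  also have "M * t\<^sup>2 - t * l = - l\<^sup>2 / (4 * M)"
    using assms(7) by (simp add: t_def field_simps power2_eq_square)
  finally show ?thesis .
qed (simp add: measure_pmf.prob_le_1)

lemma chernoff_lower:
  fixes q :: "'b pmf"
  assumes "finite A" "S \<subseteq> A" "real (card S) * measure_pmf.prob q Q \<le> M" "0 \<le> l" "l \<le> 2 * M" "M > 0"
  shows "measure_pmf.prob (Pi_pmf A d (\<lambda>_. q))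
      {x. real (card {i \<in> S. x i \<in> Q}) \<le> real (card S) * measure_pmf.prob q Q - l} \<le> exp (- l\<^sup>2 / (4 * M))"
proof (cases "l = 0")
  case False
  let ?m = "real (card S) * measure_pmf.prob q Q"
  define t where "t = l / (2 * M)"
  have t: "0 < t" "t \<le> 1" using assms False by (auto simp: t_def)
  have eq: "{x. real (card {i \<in> S. x i \<in> Q}) \<le> ?m - l} = {x. (- t) * real (card {i \<in> S. x i \<in> Q}) \<ge> (- t) * (?m - l)}"
    using t by simp
  have "measure_pmf.prob (Pi_pmf A d (\<lambda>_. q)) {x. real (card {i \<in> S. x i \<in> Q}) \<le> ?m - l}
    \<le> exp (?m * (- t + (- t)\<^sup>2) - (- t) * (?m - l))"
    unfolding eq using t by (intro chernoff assms) auto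
  also have "\<dots> = exp (?m * t\<^sup>2 - t * l)" by (simp add: algebra_simps)
  also have "\<dots> \<le> exp (M * t\<^sup>2 - t * l)"
    using assms(3) t by (simp add: mult_right_mono)
  also have "M * t\<^sup>2 - t * l = - l\<^sup>2 / (4 * M)"
    using assms(6) by (simp add: t_def field_simps power2_eq_square)
  finally show ?thesis .
qed (simp add: measure_pmf.prob_le_1)

text \<open>Draw n independent candidates. For one view the number of bad ones has mean at most n p
  and reaches twice that with probability at most exp (- n p / 4); a union bound over the views
  leaves a good draw.\<close>

lemma exists_good_family:
  fixes q :: "'x pmf"
  assumes "finite \<V>" and p: "p > 0" and bad: "\<And>\<nu>. \<nu> \<in> \<V> \<Longrightarrow> measure_pmf.prob q {x. bad x \<nu>} \<le> p"
    and n: "n > 0" "real (card \<V>) * exp (- real n * p / 4) < 1"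
  shows "\<exists>fam :: nat \<Rightarrow> 'x. (\<forall>i<n. fam i \<in> set_pmf q) \<and>
    (\<forall>\<nu>\<in>\<V>. real (card {i. i < n \<and> bad (fam i) \<nu>}) \<le> 2 * p * real n)"
proof -
  let ?M = "Pi_pmf {..<n} undefined (\<lambda>_. q)"
  define F where "F \<nu> = {f. real (card {i \<in> {..<n}. f i \<in> {x. bad x \<nu>}}) \<ge> real n * p + real n * p}" for \<nu>
  have F: "measure_pmf.prob ?M (F \<nu>) \<le> exp (- real n * p / 4)" if "\<nu> \<in> \<V>" for \<nu>
  proof -
    have "measure_pmf.prob ?M (F \<nu>) \<le> exp (- (real n * p)\<^sup>2 / (4 * (real n * p)))"
      unfolding F_def
      by (rule chernoff_upper) (use bad[OF that] p n in \<open>auto intro!: mult_left_mono\<close>)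
    also have "- (real n * p)\<^sup>2 / (4 * (real n * p)) = - real n * p / 4"
      using p n by (simp add: power2_eq_square)
    finally show ?thesis .
  qed
  have "measure_pmf.prob ?M (\<Union>\<nu>\<in>\<V>. F \<nu>) \<le> (\<Sum>\<nu>\<in>\<V>. measure_pmf.prob ?M (F \<nu>))"
    by (rule measure_pmf.finite_measure_subadditive_finite) (use assms(1) in auto)
  also have "\<dots> \<le> (\<Sum>\<nu>\<in>\<V>. exp (- real n * p / 4))" by (intro sum_mono F)
  also have "\<dots> < 1" using n by simp
  finally have "measure_pmf.prob ?M (\<Union>\<nu>\<in>\<V>. F \<nu>) \<noteq> 1" by simp
  then have "\<not> set_pmf ?M \<subseteq> (\<Union>\<nu>\<in>\<V>. F \<nu>)"
    by (subst (asm) measure_pmf.prob_eq_1) (auto simp: AE_measure_pmf_iff)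
  then obtain f where f: "f \<in> set_pmf ?M" "\<forall>\<nu>\<in>\<V>. f \<notin> F \<nu>" by auto
  from f(1) have "\<forall>i<n. f i \<in> set_pmf q" by (auto simp: set_Pi_pmf PiE_dflt_def)
  with f(2) show ?thesis by (intro exI[of _ f]) (auto simp: F_def)
qed

text \<open>Double counting turns a bound for every local view into one for some candidate.\<close>

lemma exists_good_member:
  fixes bad :: "nat \<Rightarrow> nat \<Rightarrow> bool"
  assumes "n > 0" "\<And>v. v < n \<Longrightarrow> real (card {i. i < n \<and> bad i v}) \<le> c * real n"
  shows "\<exists>i<n. real (card {v. v < n \<and> bad i v}) \<le> c * real n"
proof (rule ccontr)
  assume "\<not> ?thesis"
  then have "(\<Sum>i<n. c * real n) < (\<Sum>i<n. real (card {v. v < n \<and> bad i v}))"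
    using assms(1) by (intro sum_strict_mono) (auto simp: not_le)
  also have "\<dots> = (\<Sum>i<n. \<Sum>v<n. of_bool (bad i v))"
    by (intro sum.cong refl) (simp add: of_bool_def sum.If_cases Int_def conj_commute)
  also have "\<dots> = (\<Sum>v<n. \<Sum>i<n. of_bool (bad i v))" by (rule sum.swap)
  also have "\<dots> = (\<Sum>v<n. real (card {i. i < n \<and> bad i v}))"
    by (intro sum.cong refl) (simp add: of_bool_def sum.If_cases Int_def conj_commute)
  also have "\<dots> \<le> (\<Sum>v<n. c * real n)" by (intro sum_mono assms(2)) auto
  finally show False by simp
qed

text \<open>A set of at most k elements is the content of a list of length k over A and one padding
  symbol.\<close>

lemma card_subsets_le:
  assumes "finite A"
  shows "finite {S. S \<subseteq> A \<and> card S \<le> k}" "card {S. S \<subseteq> A \<and> card S \<le> k} \<le> (card A + 1) ^ k"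
proof -
  show fin: "finite {S. S \<subseteq> A \<and> card S \<le> k}" using assms by simp
  let ?L = "{xs. set xs \<subseteq> insert None (Some ` A) \<and> length xs = k}"
  have finL: "finite ?L" using assms by (intro finite_lists_length_eq) auto
  have "{S. S \<subseteq> A \<and> card S \<le> k} \<subseteq> (\<lambda>xs. {a. Some a \<in> set xs}) ` ?L"
  proof
    fix S assume S: "S \<in> {S. S \<subseteq> A \<and> card S \<le> k}"
    then have "finite S" using assms finite_subset by blast
    then obtain xs where xs: "set xs = S" "length xs = card S"
      using finite_distinct_list distinct_card by metis
    let ?ys = "map Some xs @ replicate (k - card S) None"
    have "?ys \<in> ?L" using xs S by auto
    moreover have "{a. Some a \<in> set ?ys} = S" using xs by auto
    ultimately show "S \<in> (\<lambda>xs. {a. Some a \<in> set xs}) ` ?L" by blast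
  qed
  then have "card {S. S \<subseteq> A \<and> card S \<le> k} \<le> card ?L" by (rule surj_card_le[OF finL])
  also have "\<dots> = card (insert None (Some ` A)) ^ k" using assms by (intro card_lists_length_eq) auto
  also have "card (insert None (Some ` A)) = card A + 1"
    using assms by (subst card_insert_disjoint) (auto simp: card_image)
  finally show "card {S. S \<subseteq> A \<and> card S \<le> k} \<le> (card A + 1) ^ k" .
qed

section \<open>Random partitions and random hashing of colours\<close>

text \<open>
  All bins have the same density \<open>(s\<^sup>4 - 1) / s\<^sup>1\<^sup>5\<close> among \<open>{..<s\<^sup>1\<^sup>5}\<close>, whatever the scale \<open>K\<close>.
\<close>

definition bin :: "nat \<Rightarrow> nat \<Rightarrow> nat \<Rightarrow> nat set" where
  "bin s K b = {z. K \<le> z \<and> z < s ^ 4 * K \<and> z mod K = b}"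

text \<open>The ratio is s ^ 4 and the range of y is s ^ 15 = s ^ 4 * s ^ 11, so the three intervals
  from K to s ^ 4 K tile everything from s ^ 3 up to s ^ 15.\<close>

definition scales :: "nat \<Rightarrow> nat set" where
  "scales s = {s ^ 11, s ^ 7, s ^ 3}"

text \<open>
  The last two conditions do not depend on \<open>N\<close>; a chosen \<open>y\<close> violating them would be
  bad for all vertices, which the selection rules out.
\<close>

definition good_partition :: "nat \<Rightarrow> nat \<Rightarrow> (nat \<Rightarrow> nat) \<Rightarrow> nat set \<Rightarrow> bool" where
  "good_partition n s y N \<longleftrightarrow>
    (\<forall>K\<in>scales s. \<forall>b<K. real (card {u \<in> N. y u \<in> bin s K b}) <
        real (card N) * (real s ^ 4 - 1) / real s ^ 15 + real s ^ 5 / 4) \<and>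
    (\<forall>K\<in>scales s. real (card {u \<in> N. y u \<in> {..<s ^ 4 * K}}) >
        real (card N) * real K / real s ^ 11 - real K * real s ^ 5 / 4) \<and>
    real (card {u \<in> N. y u \<in> {..<s ^ 3}}) < 4 * real s ^ 8 \<and>
    (\<forall>K\<in>scales s. \<forall>b<K. real (card {u \<in> {..<n}. y u \<in> bin s K b}) < 2 * real n / real s ^ 11) \<and>
    real (card {u \<in> {..<n}. y u \<in> {..<s ^ 3}}) < 2 * real n / real s ^ 12"

definition partition_pmf :: "nat \<Rightarrow> nat \<Rightarrow> (nat \<Rightarrow> nat) pmf" where
  "partition_pmf n s = Pi_pmf {..<n} 0 (\<lambda>_. pmf_of_set {..<s ^ 15})"

definition hash_pmf :: "nat \<Rightarrow> nat \<Rightarrow> (nat \<Rightarrow> nat) pmf" where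
  "hash_pmf U K = Pi_pmf {..<U} 0 (\<lambda>_. pmf_of_set {..<K})"

lemma prob_UN_le:
  assumes "finite F" "\<And>i. i \<in> F \<Longrightarrow> measure_pmf.prob M (B i) \<le> e" "real (card F) \<le> c" "0 \<le> e"
  shows "measure_pmf.prob M (\<Union>i\<in>F. B i) \<le> c * e"
proof -
  have "measure_pmf.prob M (\<Union>i\<in>F. B i) \<le> (\<Sum>i\<in>F. measure_pmf.prob M (B i))"
    by (rule measure_pmf.finite_measure_subadditive_finite) (use assms(1) in auto)
  also have "\<dots> \<le> (\<Sum>i\<in>F. e)" by (intro sum_mono assms)
  also have "\<dots> \<le> c * e" using assms by (simp add: mult_right_mono)
  finally show ?thesis .
qed

lemma prob_uniform: "m > 0 \<Longrightarrow> measure_pmf.prob (pmf_of_set {..<m}) Q = real (card ({..<m} \<inter> Q)) / real m"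
  by (subst measure_pmf_of_set) auto

text \<open>With the remainder fixed, an element is determined by its quotient by K, which lies
  between 1 and s ^ 4 - 1. The missing quotient 0 is the source of the slack.\<close>

lemma card_bin_le:
  assumes "K > 0" "s > 0" shows "card (bin s K b) \<le> s ^ 4 - 1"
proof -
  have "bin s K b \<subseteq> (\<lambda>q. q * K + b) ` {1..<s ^ 4}"
  proof
    fix z assume z: "z \<in> bin s K b"
    have "z = z div K * K + b" using z by (auto simp: bin_def)
    moreover have "z div K \<ge> 1" using z assms by (simp add: bin_def div_greater_zero_iff Suc_le_eq)
    moreover have "z div K < s ^ 4" using z by (simp add: bin_def less_mult_imp_div_less)
    ultimately show "z \<in> (\<lambda>q. q * K + b) ` {1..<s ^ 4}" by auto
  qed
  from surj_card_le[OF _ this] show ?thesis by simp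
qed

lemma scales_le: "K \<in> scales s \<Longrightarrow> s > 0 \<Longrightarrow> K \<le> s ^ 11 \<and> K > 0"
  unfolding scales_def by (auto intro: power_increasing)

text \<open>The critical event is the degree into a bin: deviation s ^ 5 / 4 from a mean of at most
  2 s ^ 9 gives the exponent - s / 128. All other events are at most as likely in these bounds; 192
  is the weaker constant needed for the hashing.\<close>

lemma prob_bad_partition:
  assumes s: "s \<ge> 2" and N: "N \<subseteq> {..<n}" "card N \<le> 2 * s ^ 20" and n: "n \<ge> s ^ 13"
  shows "measure_pmf.prob (partition_pmf n s) {y. \<not> good_partition n s y N} \<le> 11 * real s ^ 11 * exp (- real s / 192)"
proof -
  let ?M = "partition_pmf n s"
  define e where "e = exp (- real s / 192)"
  have e_ge: "exp x \<le> e" if "x \<le> - real s / 192" for x using that by (simp add: e_def)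
  have e_nonneg: "0 \<le> e" by (simp add: e_def)
  let ?q = "pmf_of_set {..<s ^ 15}"
  have s_pos: "real s > 0" "s > 0" using s by auto
  have s59: "real s ^ 5 \<le> real s ^ 9" using s by (intro power_increasing) auto
  have npos: "real n > 0" using n s_pos by (simp add: less_le_trans[OF zero_less_power])
  have nge: "real n \<ge> real s ^ 13" using n by (metis of_nat_le_iff of_nat_power)
  have cN: "real (card N) \<le> 2 * real s ^ 20" using N(2) by (metis of_nat_le_iff of_nat_mult of_nat_numeral of_nat_power)
  have s15: "s ^ 15 > 0" using s_pos by simp
  have p_bin: "measure_pmf.prob ?q (bin s K b) \<le> (real s ^ 4 - 1) / real s ^ 15" if "K > 0" for K b
  proof -
    have "card ({..<s ^ 15} \<inter> bin s K b) \<le> s ^ 4 - 1"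
    proof (rule order.trans[OF card_mono card_bin_le[OF that s_pos(2), of b]])
      show "finite (bin s K b)" by (rule finite_subset[of _ "{..<s ^ 4 * K}"]) (auto simp: bin_def)
    qed auto
    then have "real (card ({..<s ^ 15} \<inter> bin s K b)) \<le> real (s ^ 4 - 1)"
      by (simp only: of_nat_le_iff)
    also have "\<dots> = real s ^ 4 - 1" using s_pos by (simp add: of_nat_diff)
    finally have "real (card ({..<s ^ 15} \<inter> bin s K b)) \<le> real s ^ 4 - 1" .
    then show ?thesis unfolding prob_uniform[OF s15] by (simp add: divide_right_mono)
  qed
  have p_init: "measure_pmf.prob ?q {..<m} = real m / real s ^ 15" if "m \<le> s ^ 15" for m
    using that by (simp add: prob_uniform[OF s15] Int_absorb1 Int_absorb2)
  have p_bin': "(real s ^ 4 - 1) / real s ^ 15 \<le> 1 / real s ^ 11"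
    using s_pos by (simp add: field_simps flip: power_add)
  have G1: "measure_pmf.prob ?M {y. real (card {u \<in> N. y u \<in> bin s K b}) \<ge>
      real (card N) * (real s ^ 4 - 1) / real s ^ 15 + real s ^ 5 / 4} \<le> e" if "K > 0" for K b
  proof -
    have m: "real (card N) * (real s ^ 4 - 1) / real s ^ 15 \<le> 2 * real s ^ 9"
    proof -
      have "real (card N) * ((real s ^ 4 - 1) / real s ^ 15) \<le> (2 * real s ^ 20) * (1 / real s ^ 11)"
        using cN p_bin' s_pos by (intro mult_mono) auto
      also have "\<dots> = 2 * real s ^ 9" using s_pos by (simp add: field_simps flip: power_add)
      finally show ?thesis by simp
    qed
    have l: "real s ^ 5 / 4 \<le> 2 * (2 * real s ^ 9)"
      using s59 zero_le_power[of "real s" 9] by linarith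
    have "measure_pmf.prob ?M {y. real (card {u \<in> N. y u \<in> bin s K b}) \<ge>
      real (card N) * (real s ^ 4 - 1) / real s ^ 15 + real s ^ 5 / 4}
      \<le> exp (- (real s ^ 5 / 4)\<^sup>2 / (4 * (2 * real s ^ 9)))"
      unfolding partition_pmf_def
      by (rule chernoff_upper[OF _ N(1) _ m _ l])
         (use p_bin[OF that] s_pos in \<open>auto intro: mult_left_mono simp flip: times_divide_eq_right\<close>)
    also have "- (real s ^ 5 / 4)\<^sup>2 / (4 * (2 * real s ^ 9)) = - real s / 128"
      using s_pos by (simp add: field_simps power2_eq_square flip: power_add power_Suc)
    also have "exp (- real s / 128) \<le> e" by (rule e_ge) simp
    finally show ?thesis .
  qed
  have G2: "measure_pmf.prob ?M {y. real (card {u \<in> N. y u \<in> {..<s ^ 4 * K}}) \<le>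
      real (card N) * real K / real s ^ 11 - real K * real s ^ 5 / 4} \<le> e" if K: "0 < K" "K \<le> s ^ 11" for K
  proof -
    have "s ^ 4 * K \<le> s ^ 15" using K mult_left_mono[of K "s ^ 11" "s ^ 4"] by (simp flip: power_add)
    then have p: "measure_pmf.prob ?q {..<s ^ 4 * K} = real K / real s ^ 11"
      using s_pos by (simp add: p_init field_simps flip: power_add)
    have m: "real (card N) * measure_pmf.prob ?q {..<s ^ 4 * K} \<le> 2 * real s ^ 9 * real K"
    proof -
      have "real (card N) * (real K / real s ^ 11) \<le> (2 * real s ^ 20) * (real K / real s ^ 11)"
        using cN by (intro mult_right_mono) auto
      also have "\<dots> = 2 * real s ^ 9 * real K" using s_pos by (simp add: field_simps flip: power_add)
      finally show ?thesis by (simp add: p)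
    qed
    have l: "real K * real s ^ 5 / 4 \<le> 2 * (2 * real s ^ 9 * real K)"
    proof -
      have "real K * real s ^ 5 \<le> real K * real s ^ 9" using s59 by (intro mult_left_mono) auto
      moreover have "real K * real s ^ 9 \<ge> 0" by simp
      ultimately show ?thesis unfolding mult.assoc mult.commute[of "real s ^ 9"] by linarith
    qed
    have "measure_pmf.prob ?M {y. real (card {u \<in> N. y u \<in> {..<s ^ 4 * K}}) \<le>
      real (card N) * measure_pmf.prob ?q {..<s ^ 4 * K} - real K * real s ^ 5 / 4}
      \<le> exp (- (real K * real s ^ 5 / 4)\<^sup>2 / (4 * (2 * real s ^ 9 * real K)))"
      unfolding partition_pmf_def
      by (rule chernoff_lower[OF _ N(1) m _ l]) (use K s_pos in auto)
    also have "- (real K * real s ^ 5 / 4)\<^sup>2 / (4 * (2 * real s ^ 9 * real K)) = - (real K * real s) / 128"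
      using s_pos K by (simp add: field_simps power2_eq_square flip: power_add power_Suc)
    also have "exp (- (real K * real s) / 128) \<le> e"
      by (rule e_ge) (use mult_right_mono[of 1 "real K" "real s"] K in simp)
    finally show ?thesis by (simp add: p)
  qed
  have p3: "measure_pmf.prob ?q {..<s ^ 3} = 1 / real s ^ 12"
  proof -
    have "s ^ 3 \<le> s ^ 15" using s_pos by (intro power_increasing) auto
    moreover have "real (s ^ 3) / real s ^ 15 = 1 / real s ^ 12"
      using s_pos by (simp add: field_simps flip: power_add)
    ultimately show ?thesis by (simp only: p_init)
  qed
  have G3: "measure_pmf.prob ?M {y. real (card {u \<in> N. y u \<in> {..<s ^ 3}}) \<ge> 4 * real s ^ 8} \<le> e"
  proof -
    have "real (card N) * (1 / real s ^ 12) \<le> (2 * real s ^ 20) * (1 / real s ^ 12)"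
      using cN by (intro mult_right_mono) auto
    also have "\<dots> = 2 * real s ^ 8" using s_pos by (simp add: field_simps flip: power_add)
    finally have m: "real (card N) * measure_pmf.prob ?q {..<s ^ 3} \<le> 2 * real s ^ 8" by (simp add: p3)
    have "measure_pmf.prob ?M {y. real (card {u \<in> N. y u \<in> {..<s ^ 3}}) \<ge> 2 * real s ^ 8 + 2 * real s ^ 8}
      \<le> exp (- (2 * real s ^ 8)\<^sup>2 / (4 * (2 * real s ^ 8)))"
      unfolding partition_pmf_def
      by (rule chernoff_upper[OF _ N(1) m]) (use s_pos in auto)
    also have "- (2 * real s ^ 8)\<^sup>2 / (4 * (2 * real s ^ 8)) = - (real s ^ 8) / 2"
      using s_pos by (simp add: field_simps power2_eq_square flip: power_add power_Suc)
    also have "exp (- (real s ^ 8) / 2) \<le> e"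
    proof -
      have "real s \<le> real s ^ 8" using s by (intro self_le_power) auto
      then have "- (real s ^ 8) / 2 \<le> - real s / 192" by linarith
      then show ?thesis by (rule e_ge)
    qed
    finally show ?thesis by simp
  qed
  have double: "2 * real n / x = real n / x + real n / x" for x
    by (metis add_divide_distrib mult_2)
  \<comment> \<open>From n \<ge> s ^ 13 the bound n / s ^ k on the mean is at least s, so reaching
    twice this bound is unlikely enough.\<close>
  have large_n: "- (real n / real s ^ k)\<^sup>2 / (4 * (real n / real s ^ k)) \<le> - real s / 192" if "k \<le> 12" for k
  proof -
    have "real s \<le> real n / real s ^ 12" using nge s_pos by (simp add: field_simps flip: power_Suc)
    also have "\<dots> \<le> real n / real s ^ k"
      using that s npos power_increasing[of k 12 "real s"] by (intro divide_left_mono) auto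
    finally have "- (real n / real s ^ k) / 4 \<le> - real s / 192" using s_pos by simp
    moreover have "- (real n / real s ^ k)\<^sup>2 / (4 * (real n / real s ^ k)) = - (real n / real s ^ k) / 4"
      using npos s_pos by (simp add: power2_eq_square)
    ultimately show ?thesis by simp
  qed
  have G4: "measure_pmf.prob ?M {y. real (card {u \<in> {..<n}. y u \<in> bin s K b}) \<ge> 2 * real n / real s ^ 11} \<le> e"
    if "K > 0" for K b
  proof -
    have "real (card {..<n}) * measure_pmf.prob ?q (bin s K b) \<le> real n * (1 / real s ^ 11)"
      using order.trans[OF p_bin[OF that] p_bin'] by (intro mult_mono) auto
    then have m: "real (card {..<n}) * measure_pmf.prob ?q (bin s K b) \<le> real n / real s ^ 11" by simp
    have "measure_pmf.prob ?M {y. real (card {u \<in> {..<n}. y u \<in> bin s K b}) \<ge> real n / real s ^ 11 + real n / real s ^ 11}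
      \<le> exp (- (real n / real s ^ 11)\<^sup>2 / (4 * (real n / real s ^ 11)))"
      unfolding partition_pmf_def
      by (rule chernoff_upper[OF _ _ m]) (use s_pos npos in \<open>auto simp: divide_right_mono\<close>)
    also have "\<dots> \<le> e" by (rule e_ge, rule large_n) simp
    finally show ?thesis by (simp only: double)
  qed
  have G5: "measure_pmf.prob ?M {y. real (card {u \<in> {..<n}. y u \<in> {..<s ^ 3}}) \<ge> 2 * real n / real s ^ 12} \<le> e"
  proof -
    have m: "real (card {..<n}) * measure_pmf.prob ?q {..<s ^ 3} \<le> real n / real s ^ 12" by (simp add: p3)
    have "measure_pmf.prob ?M {y. real (card {u \<in> {..<n}. y u \<in> {..<s ^ 3}}) \<ge> real n / real s ^ 12 + real n / real s ^ 12}
      \<le> exp (- (real n / real s ^ 12)\<^sup>2 / (4 * (real n / real s ^ 12)))"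
      unfolding partition_pmf_def
      by (rule chernoff_upper[OF _ _ m]) (use s_pos npos in \<open>auto simp: divide_right_mono\<close>)
    also have "\<dots> \<le> e" by (rule e_ge, rule large_n) simp
    finally show ?thesis by (simp only: double)
  qed
  define I where "I = Sigma (scales s) (\<lambda>K. {..<K})"
  have fin: "finite (scales s)" by (simp add: scales_def)
  have card_scales: "card (scales s) \<le> 3" unfolding scales_def by (metis card_insert_le_m1 card.empty numeral_3_eq_3 card_2_iff card_insert_if le_SucI order_refl card_length length_Cons list.set(1) list.set(2) list.size(3))
  have "card I = (\<Sum>K\<in>scales s. K)" by (simp add: I_def fin)
  also have "\<dots> \<le> (\<Sum>K\<in>scales s. s ^ 11)" using scales_le[OF _ s_pos(2)] by (intro sum_mono) auto
  also have "\<dots> \<le> 3 * s ^ 11" using card_scales by simp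
  finally have "card I \<le> 3 * s ^ 11" .
  then have card_I: "real (card I) \<le> 3 * real s ^ 11" by (metis of_nat_le_iff of_nat_mult of_nat_numeral of_nat_power)
  have finI: "finite I" by (simp add: I_def fin)
  let ?A1 = "\<Union>(K, b)\<in>I. {y. real (card {u \<in> N. y u \<in> bin s K b}) \<ge> real (card N) * (real s ^ 4 - 1) / real s ^ 15 + real s ^ 5 / 4}"
  let ?A2 = "\<Union>K\<in>scales s. {y. real (card {u \<in> N. y u \<in> {..<s ^ 4 * K}}) \<le> real (card N) * real K / real s ^ 11 - real K * real s ^ 5 / 4}"
  let ?A3 = "{y. real (card {u \<in> N. y u \<in> {..<s ^ 3}}) \<ge> 4 * real s ^ 8}"
  let ?A4 = "\<Union>(K, b)\<in>I. {y. real (card {u \<in> {..<n}. y u \<in> bin s K b}) \<ge> 2 * real n / real s ^ 11}"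
  let ?A5 = "{y. real (card {u \<in> {..<n}. y u \<in> {..<s ^ 3}}) \<ge> 2 * real n / real s ^ 12}"
  have "{y. \<not> good_partition n s y N} \<subseteq> ?A1 \<union> (?A2 \<union> (?A3 \<union> (?A4 \<union> ?A5)))"
    unfolding good_partition_def I_def by (force simp: not_less)
  then have "measure_pmf.prob ?M {y. \<not> good_partition n s y N} \<le> measure_pmf.prob ?M (?A1 \<union> (?A2 \<union> (?A3 \<union> (?A4 \<union> ?A5))))"
    by (intro measure_pmf.finite_measure_mono) auto
  also have "\<dots> \<le> measure_pmf.prob ?M ?A1 + (measure_pmf.prob ?M ?A2 + (measure_pmf.prob ?M ?A3 + (measure_pmf.prob ?M ?A4 + measure_pmf.prob ?M ?A5)))"
    by (intro order.trans[OF measure_Un_le] add_mono order_refl) auto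
  also have "\<dots> \<le> 3 * real s ^ 11 * e + (3 * e + (e + (3 * real s ^ 11 * e + e)))"
  proof (intro add_mono)
    show "measure_pmf.prob ?M ?A1 \<le> 3 * real s ^ 11 * e"
      by (rule prob_UN_le[OF finI _ card_I]) (use scales_le[OF _ s_pos(2)] e_nonneg in \<open>auto simp: I_def simp del: lessThan_iff intro!: G1\<close>)
    show "measure_pmf.prob ?M ?A4 \<le> 3 * real s ^ 11 * e"
      by (rule prob_UN_le[OF finI _ card_I]) (use scales_le[OF _ s_pos(2)] e_nonneg in \<open>auto simp: I_def simp del: lessThan_iff intro!: G4\<close>)
    show "measure_pmf.prob ?M ?A2 \<le> 3 * e"
      by (rule prob_UN_le[OF fin]) (use card_scales scales_le[OF _ s_pos(2)] e_nonneg in \<open>auto simp del: lessThan_iff intro!: G2\<close>)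
  qed (use G3 G5 in auto)
  \<comment> \<open>At most three scales with at most s ^ 11 bins each: the sum is (6 s ^ 11 + 5)
    e.\<close>
  also have "\<dots> \<le> 11 * real s ^ 11 * e"
  proof -
    have "1 * e \<le> real s ^ 11 * e" using s e_nonneg by (intro mult_right_mono) auto
    then show ?thesis unfolding mult.assoc by linarith
  qed
  finally show ?thesis unfolding e_def .
qed

text \<open>T may be larger than assumed, which would spoil the upper bound on the mean. The
  estimate is therefore made for a subset T' whose size is the assumed bound rounded up; further
  colours only help.\<close>

lemma prob_bad_hash:
  assumes s: "s \<ge> 2" and d: "s ^ 20 \<le> d" "d \<le> 2 * s ^ 20" and T: "T \<subseteq> {..<U}" and K: "0 < K" and b: "b < K"
    and cT: "real (card T) \<ge> real d * real K / real s ^ 11 - real K * real s ^ 5 / 4"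
  shows "measure_pmf.prob (hash_pmf U K) {g. real (card {c \<in> T. g c \<in> {b}}) \<le> real d / real s ^ 11 - real s ^ 5 / 2}
    \<le> exp (- real s / 192)"
proof -
  let ?q = "pmf_of_set {..<K}"
  let ?a = "real d * real K / real s ^ 11 - real K * real s ^ 5 / 4"
  have s_pos: "real s > 0" "s > 0" using s by auto
  define m where "m = nat \<lceil>?a\<rceil>"
  have "real d / real s ^ 11 \<ge> real s ^ 9"
    using d s_pos by (simp add: field_simps flip: power_add)
  moreover have "real s ^ 9 \<ge> real s ^ 5" using s by (intro power_increasing) auto
  ultimately have "real d / real s ^ 11 - real s ^ 5 / 4 \<ge> 0"
    using zero_le_power[of "real s" 5] by linarith
  then have "real K * (real d / real s ^ 11 - real s ^ 5 / 4) \<ge> 0" by simp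
  then have a0: "?a \<ge> 0" by (simp add: algebra_simps)
  have m: "?a \<le> real m" "real m \<le> ?a + 1" using a0 unfolding m_def by linarith+
  have "m \<le> card T" using cT unfolding m_def by linarith
  then obtain T' where T': "T' \<subseteq> T" "card T' = m" by (metis obtain_subset_with_card_n)
  have p: "measure_pmf.prob ?q {b} = 1 / real K" using b K by (simp add: prob_uniform)
  have mean: "real (card T') * measure_pmf.prob ?q {b} = real m / real K" by (simp add: p T')
  have mean_lower: "real m / real K \<ge> real d / real s ^ 11 - real s ^ 5 / 4"
    using m(1) K by (simp add: field_simps)
  have "real d \<le> 2 * real s ^ 20" using d by (metis of_nat_le_iff of_nat_mult of_nat_numeral of_nat_power)
  then have "real d / real s ^ 11 \<le> 2 * real s ^ 9" using s_pos by (simp add: field_simps flip: power_add)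
  moreover have "real m / real K \<le> real d / real s ^ 11 - real s ^ 5 / 4 + 1 / real K"
  proof -
    have "real m / real K \<le> (?a + 1) / real K" using m(2) by (intro divide_right_mono) auto
    also have "\<dots> = real d / real s ^ 11 - real s ^ 5 / 4 + 1 / real K" using K by (simp add: field_simps)
    finally show ?thesis .
  qed
  moreover have "1 / real K \<le> 1" "real s ^ 9 \<ge> 1" "0 \<le> real s ^ 5" using K s by auto
  ultimately have mean_upper: "real (card T') * measure_pmf.prob ?q {b} \<le> 3 * real s ^ 9"
    unfolding mean by linarith
  have l: "real s ^ 5 / 4 \<le> 2 * (3 * real s ^ 9)"
    using \<open>real s ^ 9 \<ge> real s ^ 5\<close> zero_le_power[of "real s" 9] by linarith
  have "finite T" using T finite_subset by blast
  have "measure_pmf.prob (hash_pmf U K) {g. real (card {c \<in> T. g c \<in> {b}}) \<le> real d / real s ^ 11 - real s ^ 5 / 2}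
    \<le> measure_pmf.prob (hash_pmf U K) {g. real (card {c \<in> T'. g c \<in> {b}}) \<le> real (card T') * measure_pmf.prob ?q {b} - real s ^ 5 / 4}"
  proof (intro measure_pmf.finite_measure_mono)
    show "{g. real (card {c \<in> T. g c \<in> {b}}) \<le> real d / real s ^ 11 - real s ^ 5 / 2} \<subseteq>
      {g. real (card {c \<in> T'. g c \<in> {b}}) \<le> real (card T') * measure_pmf.prob ?q {b} - real s ^ 5 / 4}"
    proof
      fix g :: "nat \<Rightarrow> nat"
      assume "g \<in> {g. real (card {c \<in> T. g c \<in> {b}}) \<le> real d / real s ^ 11 - real s ^ 5 / 2}"
      moreover have "card {c \<in> T'. g c \<in> {b}} \<le> card {c \<in> T. g c \<in> {b}}"
        using T' \<open>finite T\<close> by (intro card_mono) auto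
      ultimately have "real (card {c \<in> T'. g c \<in> {b}}) \<le> real d / real s ^ 11 - real s ^ 5 / 2" by simp
      with mean_lower show "g \<in> {g. real (card {c \<in> T'. g c \<in> {b}}) \<le> real (card T') * measure_pmf.prob ?q {b} - real s ^ 5 / 4}"
        unfolding mean mem_Collect_eq by linarith
    qed
  qed auto
  \<comment> \<open>Rounding raises the bound on the mean from 2 s ^ 9 to 3 s ^ 9, and 16 * 4 * 3 =
    192.\<close>
  also have "\<dots> \<le> exp (- (real s ^ 5 / 4)\<^sup>2 / (4 * (3 * real s ^ 9)))"
    unfolding hash_pmf_def
    by (rule chernoff_lower[OF _ _ mean_upper _ l]) (use T T' s_pos in auto)
  also have "- (real s ^ 5 / 4)\<^sup>2 / (4 * (3 * real s ^ 9)) = - real s / 192"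
    using s_pos by (simp add: field_simps power2_eq_square flip: power_add power_Suc)
  finally show ?thesis .
qed

section \<open>Choice of s for a given degree\<close>

lemma eventually_small_probability:
  "\<exists>s0. \<forall>s\<ge>s0. 11 * real s ^ 11 * exp (- real s / 192) \<le> 1 / (32 * (2 * real s ^ 20 + 1))"
proof -
  have "eventually (\<lambda>s::nat. 11 * real s ^ 11 * exp (- real s / 192) \<le> 1 / (32 * (2 * real s ^ 20 + 1))) at_top"
    by real_asymp
  then show ?thesis by (simp add: eventually_at_top_linorder)
qed

text \<open>Take the largest s with s ^ 20 \<le> d. Then d < (s + 1) ^ 20, and (1 + 1 / 40) ^ 20 < 2
  explains the lower limit 40.\<close>

lemma exists_root:
  fixes d :: nat
  assumes "d \<ge> (40 + s0) ^ 20"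
  shows "\<exists>s\<ge>40 + s0. s ^ 20 \<le> d \<and> d \<le> 2 * s ^ (20 :: nat)"
proof -
  let ?A = "{s. s ^ 20 \<le> d}"
  have fin: "finite ?A"
  proof (rule finite_subset)
    have "x \<le> d" if "x ^ 20 \<le> d" for x :: nat
      using self_le_power[of x 20] that by (cases "x = 0") auto
    then show "?A \<subseteq> {..d}" by auto
  qed auto
  define s where "s = Max ?A"
  have "40 + s0 \<in> ?A" using assms by simp
  then have s: "s \<ge> 40 + s0" "s ^ 20 \<le> d" using fin Max_in[of ?A] unfolding s_def by auto
  have "s + 1 \<notin> ?A" using Max_ge[OF fin, of "s + 1"] unfolding s_def by auto
  then have "d \<le> (s + 1) ^ 20" by simp
  then have "real d \<le> (real s + 1) ^ 20" by (metis of_nat_1 of_nat_add of_nat_le_iff of_nat_power)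
  also have "\<dots> = real s ^ 20 * (1 + 1 / real s) ^ 20"
    using s(1) by (simp add: field_simps flip: power_mult_distrib)
  also have "\<dots> \<le> real s ^ 20 * (1 + 1 / 40) ^ 20"
    using s(1) by (intro mult_left_mono power_mono) (auto simp: field_simps)
  also have "\<dots> \<le> real s ^ 20 * 2" by (intro mult_left_mono) (simp_all add: field_simps)
  finally have "real d \<le> real (2 * s ^ 20)" by simp
  then have "d \<le> 2 * s ^ 20" by (subst (asm) of_nat_le_iff)
  with s show ?thesis by blast
qed

section \<open>Instances of large degree\<close>

definition admissible :: "nat \<Rightarrow> nat \<Rightarrow> bool" where
  "admissible s d \<longleftrightarrow> 41 \<le> s \<and> s ^ 20 \<le> d \<and> d \<le> 2 * s ^ 20 \<and>
     11 * real s ^ 11 * exp (- real s / 192) \<le> 1 / (32 * (2 * real s ^ 20 + 1))"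

text \<open>The second condition is the union bound over local views with p = 1 / (32 (d + 1)). A
  view is a set of at most d vertices, or at most d + 1 colours and a bin number, whence the
  exponent d + 2.\<close>

definition large_enough :: "nat \<Rightarrow> nat \<Rightarrow> nat \<Rightarrow> bool" where
  "large_enough n U d \<longleftrightarrow> 32 * (d + 1)\<^sup>2 \<le> n \<and>
     (real (max n U) + 1) ^ (d + 2) * exp (- real n / (128 * (real d + 1))) < 1"

text \<open>Equal to 2 p n for p = 1 / (32 (d + 1)). Four times this many vertices, with 2 d + 1
  words each, still amount to at most n words.\<close>

definition tolerance :: "nat \<Rightarrow> nat \<Rightarrow> real" where
  "tolerance n d = real n / (16 * (real d + 1))"

definition bad_hash :: "nat \<Rightarrow> nat \<Rightarrow> (nat \<Rightarrow> nat) \<Rightarrow> nat set \<Rightarrow> nat \<Rightarrow> bool" where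
  "bad_hash s d g T b \<longleftrightarrow> real (card {c \<in> T. g c \<in> {b}}) \<le> real d / real s ^ 11 - real s ^ 5 / 2"

lemma large_enough_bounds:
  assumes "large_enough n U d"
  shows "32 * (d + 1) \<le> n" "d < n" "2 \<le> n" "32 * (real d + 1) \<le> real n"
proof -
  have "32 * (d + 1) \<le> 32 * (d + 1)\<^sup>2" by (simp add: power2_eq_square)
  then show *: "32 * (d + 1) \<le> n" using assms unfolding large_enough_def by linarith
  then show "d < n" "2 \<le> n" by simp_all
  have "real (32 * (d + 1)) \<le> real n" using * by (simp only: of_nat_le_iff)
  then show "32 * (real d + 1) \<le> real n" by simp
qed

lemma admissible_pow_le:
  assumes "admissible s d" "k \<le> 20" shows "s ^ k \<le> d"
proof -
  have "s ^ k \<le> s ^ 20" using assms by (intro power_increasing) (auto simp: admissible_def)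
  also have "\<dots> \<le> d" using assms(1) by (simp add: admissible_def)
  finally show ?thesis .
qed

lemma admissible_small:
  assumes "admissible s d"
  shows "11 * real s ^ 11 * exp (- real s / 192) \<le> 1 / (32 * (real d + 1))"
    "exp (- real s / 192) \<le> 1 / (32 * (real d + 1))"
proof -
  have "real d \<le> 2 * real s ^ 20"
    using assms unfolding admissible_def by (metis of_nat_le_iff of_nat_mult of_nat_numeral of_nat_power)
  then have "1 / (32 * (2 * real s ^ 20 + 1)) \<le> 1 / (32 * (real d + 1))"
    by (intro divide_left_mono mult_pos_pos) auto
  then show *: "11 * real s ^ 11 * exp (- real s / 192) \<le> 1 / (32 * (real d + 1))"
    using assms unfolding admissible_def by linarith
  have "1 \<le> real s ^ 11" using assms by (simp add: admissible_def)
  then have "1 * exp (- real s / 192) \<le> 11 * real s ^ 11 * exp (- real s / 192)"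
    by (intro mult_right_mono) auto
  with * show "exp (- real s / 192) \<le> 1 / (32 * (real d + 1))" by linarith
qed

lemma exists_family:
  fixes q :: "'x pmf"
  assumes "large_enough n U d" "finite \<V>" "card \<V> \<le> (max n U + 1) ^ (d + 2)"
    and "\<And>\<nu>. \<nu> \<in> \<V> \<Longrightarrow> measure_pmf.prob q {x. bad x \<nu>} \<le> 1 / (32 * (real d + 1))"
  shows "\<exists>fam :: nat \<Rightarrow> 'x. (\<forall>i<n. fam i \<in> set_pmf q) \<and>
    (\<forall>\<nu>\<in>\<V>. real (card {i. i < n \<and> bad (fam i) \<nu>}) \<le> tolerance n d)"
proof -
  let ?p = "1 / (32 * (real d + 1))"
  have "real (card \<V>) \<le> real ((max n U + 1) ^ (d + 2))" using assms(3) by (simp only: of_nat_le_iff)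
  also have "\<dots> = (real (max n U) + 1) ^ (d + 2)" by (simp only: of_nat_power of_nat_add of_nat_1)
  finally have card_V: "real (card \<V>) \<le> (real (max n U) + 1) ^ (d + 2)" .
  have exponent: "- real n * ?p / 4 = - real n / (128 * (real d + 1))" by simp
  have "real (card \<V>) * exp (- real n * ?p / 4) \<le> (real (max n U) + 1) ^ (d + 2) * exp (- real n / (128 * (real d + 1)))"
    unfolding exponent using card_V by (intro mult_right_mono) auto
  also have "(real (max n U) + 1) ^ (d + 2) * exp (- real n / (128 * (real d + 1))) < 1"
    using assms(1) by (simp add: large_enough_def)
  finally have "real (card \<V>) * exp (- real n * ?p / 4) < 1" .
  moreover have "2 * (1 / (32 * x)) * real n = real n / (16 * x)" if "x > 0" for x :: real
    using that by (simp add: field_simps)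
  from this[of "real d + 1"] have tol: "tolerance n d = 2 * ?p * real n"
    unfolding tolerance_def by (metis add_nonneg_pos of_nat_0_le_iff zero_less_one)
  moreover have "n > 0" using large_enough_bounds(3)[OF assms(1)] by simp
  ultimately show ?thesis
    unfolding tol using assms(2,4) by (intro exists_good_family) auto
qed

lemma exists_partition_family:
  assumes "admissible s d" "large_enough n U d"
  shows "\<exists>fam. (\<forall>i<n. \<forall>v. fam i v < s ^ 15) \<and> (\<forall>N. N \<subseteq> {..<n} \<and> card N \<le> d \<longrightarrow>
     real (card {i. i < n \<and> \<not> good_partition n s (fam i) N}) \<le> tolerance n d)"
proof -
  let ?V = "{N. N \<subseteq> {..<n} \<and> card N \<le> d}"
  have fin: "finite ?V" by (rule card_subsets_le) simp
  have "card ?V \<le> (n + 1) ^ d" using card_subsets_le(2)[of "{..<n}" d] by simp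
  also have "\<dots> \<le> (max n U + 1) ^ d" by (intro power_mono) auto
  also have "\<dots> \<le> (max n U + 1) ^ (d + 2)" by (intro power_increasing) auto
  finally have "card ?V \<le> (max n U + 1) ^ (d + 2)" .
  moreover have "measure_pmf.prob (partition_pmf n s) {y. \<not> good_partition n s y N} \<le> 1 / (32 * (real d + 1))"
    if "N \<in> ?V" for N
  proof -
    have "s ^ 13 \<le> n" using admissible_pow_le[OF assms(1), of 13] large_enough_bounds[OF assms(2)] by simp
    then have "measure_pmf.prob (partition_pmf n s) {y. \<not> good_partition n s y N} \<le> 11 * real s ^ 11 * exp (- real s / 192)"
      using assms(1) that by (intro prob_bad_partition) (auto simp: admissible_def)
    with admissible_small(1)[OF assms(1)] show ?thesis by linarith
  qed
  ultimately obtain fam where fam: "\<And>i. i < n \<Longrightarrow> fam i \<in> set_pmf (partition_pmf n s)"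
    "\<And>N. N \<in> ?V \<Longrightarrow> real (card {i. i < n \<and> \<not> good_partition n s (fam i) N}) \<le> tolerance n d"
    using exists_family[OF assms(2) fin, of "partition_pmf n s" "\<lambda>y N. \<not> good_partition n s y N"] by blast
  have "s > 0" using assms(1) by (simp add: admissible_def)
  then have "{..<s ^ 15} \<noteq> {}" by (simp add: lessThan_empty_iff)
  then have "set_pmf (pmf_of_set {..<s ^ 15}) = {..<s ^ 15}" by (intro set_pmf_of_set) auto
  then have "fam i v < s ^ 15" if "i < n" for i v
    using fam(1)[OF that] \<open>s > 0\<close> unfolding partition_pmf_def
    by (cases "v < n") (auto simp: set_Pi_pmf PiE_dflt_def)
  with fam(2) show ?thesis by (intro exI[of _ fam]) auto
qed

text \<open>Hashing matters to a vertex only through its set T of free colours and its bin b; the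
  lower bound on T singles out the views for which the hashing estimate applies.\<close>

lemma exists_hash_family:
  assumes "admissible s d" "large_enough n U d" "K \<in> scales s"
  shows "\<exists>fam. \<forall>T b. T \<subseteq> {..<U} \<and> card T \<le> d + 1 \<and> b < K \<and>
       real (card T) \<ge> real d * real K / real s ^ 11 - real K * real s ^ 5 / 4 \<longrightarrow>
     real (card {i. i < n \<and> bad_hash s d (fam i) T b}) \<le> tolerance n d"
proof -
  have s: "s \<ge> 2" "s > 0" "s ^ 20 \<le> d" "d \<le> 2 * s ^ 20" using assms(1) by (auto simp: admissible_def)
  have K: "0 < K" "K \<le> n"
    using scales_le[OF assms(3) s(2)] admissible_pow_le[OF assms(1), of 11] large_enough_bounds[OF assms(2)] by auto
  let ?L = "\<lambda>T. real (card T) \<ge> real d * real K / real s ^ 11 - real K * real s ^ 5 / 4"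
  let ?V = "{T \<in> {T. T \<subseteq> {..<U} \<and> card T \<le> d + 1}. ?L T} \<times> {..<K}"
  have fin': "finite {T. T \<subseteq> {..<U} \<and> card T \<le> d + 1}" by (rule card_subsets_le) simp
  then have fin: "finite ?V" by simp
  have "card ?V = card {T \<in> {T. T \<subseteq> {..<U} \<and> card T \<le> d + 1}. ?L T} * K" by (simp add: card_cartesian_product)
  also have "\<dots> \<le> card {T. T \<subseteq> {..<U} \<and> card T \<le> d + 1} * K"
    using fin' by (intro mult_right_mono card_mono) auto
  also have "\<dots> \<le> (U + 1) ^ (d + 1) * (n + 1)"
    using card_subsets_le(2)[of "{..<U}" "d + 1"] K by (intro mult_mono) auto
  also have "\<dots> \<le> (max n U + 1) ^ (d + 1) * (max n U + 1)"
    by (intro mult_mono power_mono) auto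
  also have "\<dots> = (max n U + 1) ^ (d + 2)" by simp
  finally have "card ?V \<le> (max n U + 1) ^ (d + 2)" .
  moreover have "measure_pmf.prob (hash_pmf U K) {g. case \<nu> of (T, b) \<Rightarrow> bad_hash s d g T b} \<le> 1 / (32 * (real d + 1))"
    if "\<nu> \<in> ?V" for \<nu>
  proof -
    obtain T b where \<nu>: "\<nu> = (T, b)" by (cases \<nu>)
    have "measure_pmf.prob (hash_pmf U K) {g. bad_hash s d g T b} \<le> exp (- real s / 192)"
      unfolding bad_hash_def by (rule prob_bad_hash) (use s K that \<nu> in auto)
    with admissible_small(2)[OF assms(1)] show ?thesis unfolding \<nu> by simp
  qed
  ultimately obtain fam where
    "\<And>\<nu>. \<nu> \<in> ?V \<Longrightarrow> real (card {i. i < n \<and> (case \<nu> of (T, b) \<Rightarrow> bad_hash s d (fam i) T b)}) \<le> tolerance n d"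
    using exists_family[OF assms(2) fin, of "hash_pmf U K" "\<lambda>g (T, b). bad_hash s d g T b"] by blast
  then have "\<And>T b. (T, b) \<in> ?V \<Longrightarrow> real (card {i. i < n \<and> bad_hash s d (fam i) T b}) \<le> tolerance n d"
    by fastforce
  then show ?thesis by (intro exI[of _ fam]) auto
qed

text \<open>Every list has \<Delta> + 1 colours, so \<Delta> is known to each vertex from the
  start.\<close>

lemma pub_degree:
  assumes "\<And>I. I \<in> C \<Longrightarrow> wf_inst I"
  shows "pub C 0 (\<lambda>I. (fst I, deg I))"
  unfolding pub_def
  by (rule know_map[OF know_inp, where h="\<lambda>i. (i, fst i, card (snd (snd (snd i))) - 1)"])
     (use assms card_pal in \<open>auto simp: inp_def\<close>)

lemma colour_bound:
  fixes n u :: nat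
  assumes "n \<ge> 2" "u \<le> n ^ a"
  shows "2 * (n + u) < n ^ (a + 4)"
proof -
  have "n \<le> n ^ (a + 1)" using assms(1) by (intro self_le_power) auto
  moreover have "n ^ a \<le> n ^ (a + 1)" using assms(1) by (intro power_increasing) auto
  moreover have "2 * (x + y) \<le> 4 * z" if "x \<le> z" "w \<le> z" "y \<le> w" for x y z w :: nat
    using that by arith
  ultimately have "2 * (n + u) \<le> 4 * n ^ (a + 1)" using assms(2) by blast
  also have "\<dots> < 2 ^ 3 * n ^ (a + 1)" using assms(1) by simp
  also have "\<dots> \<le> n ^ 3 * n ^ (a + 1)" using assms(1) by (intro mult_right_mono power_mono) auto
  also have "\<dots> = n ^ (3 + (a + 1))" by (simp only: power_add)
  also have "3 + (a + 1) = a + 4" by simp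
  finally show ?thesis .
qed

section \<open>The invariant and the stages for large degree\<close>

type_synonym state = "nat \<times> nat \<times> (nat \<Rightarrow> nat) \<times> nat set \<times> (nat \<Rightarrow> nat option)"

locale large_degree =
  fixes C :: "inst set" and \<sigma> U :: "nat \<Rightarrow> nat" and a :: nat
  assumes wf: "I \<in> C \<Longrightarrow> wf_inst I"
    and colours: "I \<in> C \<Longrightarrow> v < fst I \<Longrightarrow> pal I v \<subseteq> {..<U (fst I)}"
    and U_le: "I \<in> C \<Longrightarrow> U (fst I) \<le> fst I ^ a"
    and admissible: "I \<in> C \<Longrightarrow> admissible (\<sigma> (deg I)) (deg I)"
    and large_enough: "I \<in> C \<Longrightarrow> large_enough (fst I) (U (fst I)) (deg I)"
begin

text \<open>
  The public state consists of \<open>n\<close>, \<open>\<Delta>\<close>, the partition \<open>y\<close>, the set \<open>B\<close> of vertices given up so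
  far, and the current partial colouring.
\<close>

definition invariant :: "nat \<Rightarrow> nat \<Rightarrow> inst \<Rightarrow> state \<Rightarrow> bool" where
  "invariant j e I = (\<lambda>(n, d, y, B, f). n = fst I \<and> d = deg I \<and> partial_colouring I f \<and>
     (\<forall>v<n. v \<notin> B \<longrightarrow> good_partition n (\<sigma> d) y (nbs I v)) \<and>
     (\<forall>v. y v < \<sigma> d ^ e \<longrightarrow> f v = None) \<and>
     (\<forall>v<n. \<sigma> d ^ e \<le> y v \<longrightarrow> v \<notin> B \<longrightarrow> f v \<noteq> None) \<and>
     B \<subseteq> {..<n} \<and> real (card B) \<le> real j * tolerance n d)"

lemma invariantD:
  assumes "invariant j e I (n, d, y, B, f)"
  shows "n = fst I" "d = deg I" "partial_colouring I f"
    "\<And>v. v < n \<Longrightarrow> v \<notin> B \<Longrightarrow> good_partition n (\<sigma> d) y (nbs I v)"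
    "\<And>v. y v < \<sigma> d ^ e \<Longrightarrow> f v = None"
    "\<And>v. v < n \<Longrightarrow> \<sigma> d ^ e \<le> y v \<Longrightarrow> v \<notin> B \<Longrightarrow> f v \<noteq> None"
    "B \<subseteq> {..<n}" "real (card B) \<le> real j * tolerance n d"
  using assms unfolding invariant_def prod.case by blast+

text \<open>At most n / 4 vertices have been given up. Any remaining one certifies the conditions on
  bin sizes, which concern all n vertices.\<close>

lemma ex_good_vertex:
  assumes I: "I \<in> C" and inv: "invariant j e I (n, d, y, B, f)" and j: "j \<le> 4"
  shows "\<exists>v<n. good_partition n (\<sigma> d) y (nbs I v)"
proof -
  note n = invariantD(1,2)[OF inv]
  have pos: "real n > 0" using large_enough_bounds[OF large_enough[OF I]] n by simp
  have "real (card B) \<le> real j * tolerance n d" by (rule invariantD[OF inv])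
  also have "\<dots> \<le> 4 * (real n / (16 * 1))"
    unfolding tolerance_def using j by (intro mult_mono divide_left_mono) auto
  also have "\<dots> < real n" using pos by simp
  finally have "card B < n" by simp
  then have "\<not> {..<n} \<subseteq> B"
    using card_mono[of B "{..<n}"] finite_subset[OF invariantD(7)[OF inv]] by auto
  then show ?thesis using invariantD(4)[OF inv] by auto
qed

lemma start:
  "\<exists>P. pub C 3 P \<and> (\<forall>I\<in>C. invariant 1 15 I (P I))"
proof -
  \<comment> \<open>The family is chosen as a function of n and \<Delta> alone; this makes it
    hard-wired and known to everybody.\<close>
  have "\<exists>fam. \<forall>I\<in>C. (\<forall>i<fst I. \<forall>v. fam (fst I, deg I) i v < \<sigma> (deg I) ^ 15) \<and>
     (\<forall>N. N \<subseteq> {..<fst I} \<and> card N \<le> deg I \<longrightarrow>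
       real (card {i. i < fst I \<and> \<not> good_partition (fst I) (\<sigma> (deg I)) (fam (fst I, deg I) i) N}) \<le> tolerance (fst I) (deg I))"
    (is "\<exists>fam. \<forall>I\<in>C. ?Q (fst I) (deg I) (fam (fst I, deg I))")
  proof (intro exI ballI)
    fix I assume "I \<in> C"
    from someI_ex[OF exists_partition_family[OF admissible large_enough, OF this this]]
    show "?Q (fst I) (deg I) ((\<lambda>(n, d). SOME fam. ?Q n d fam) (fst I, deg I))" by simp
  qed
  then obtain fam where fam: "\<And>I. I \<in> C \<Longrightarrow> ?Q (fst I) (deg I) (fam (fst I, deg I))" by blast
  have "\<exists>y B. pub C 3 (\<lambda>I. ((fst I, deg I), y I, B I)) \<and>
      (\<forall>I\<in>C. fst I > 0 \<longrightarrow> y I \<in> fam (fst I, deg I) ` {..<fst I} \<and>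
        B I = {v. v < fst I \<and> \<not> good_partition (fst I) (\<sigma> (deg I)) (y I) (nbs I v)} \<and>
       (\<forall>i<fst I. card (B I) \<le> card {v. v < fst I \<and> \<not> good_partition (fst I) (\<sigma> (deg I)) (fam (fst I, deg I) i) (nbs I v)}))"
    using pub_choose[OF pub_degree[OF wf], of C fam
      "\<lambda>i p y. \<not> good_partition (fst p) (\<sigma> (snd p)) y (fst (snd (snd i)))"]
    by (simp add: inp_def)
  then obtain y B where "pub C 3 (\<lambda>I. ((fst I, deg I), y I, B I))"
    and yB: "\<And>I. I \<in> C \<Longrightarrow> fst I > 0 \<Longrightarrow> y I \<in> fam (fst I, deg I) ` {..<fst I} \<and>
        B I = {v. v < fst I \<and> \<not> good_partition (fst I) (\<sigma> (deg I)) (y I) (nbs I v)} \<and>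
       (\<forall>i<fst I. card (B I) \<le> card {v. v < fst I \<and> \<not> good_partition (fst I) (\<sigma> (deg I)) (fam (fst I, deg I) i) (nbs I v)})"
    by blast
  define P :: "inst \<Rightarrow> state" where "P I = (fst I, deg I, y I, B I, (\<lambda>_. None))" for I :: inst
  have "pub C 3 P"
    by (rule pub_map[OF \<open>pub C 3 (\<lambda>I. ((fst I, deg I), y I, B I))\<close>,
          where h="\<lambda>n p. (fst (fst p), snd (fst p), fst (snd p), snd (snd p), \<lambda>_. None)"])
       (simp add: P_def)
  moreover have "invariant 1 15 I (P I)" if I: "I \<in> C" for I
  proof -
    note bounds = large_enough_bounds[OF large_enough[OF I]]
    have pos: "fst I > 0" using bounds by simp
    have "\<exists>i<fst I. real (card {v. v < fst I \<and> \<not> good_partition (fst I) (\<sigma> (deg I)) (fam (fst I, deg I) i) (nbs I v)})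
        \<le> 1 / (16 * (real (deg I) + 1)) * real (fst I)"
      using fam[OF I] nbs_subset[OF wf[OF I]] card_nbs[of _ I] pos
      by (intro exists_good_member) (auto simp: tolerance_def)
    then have "real (card (B I)) \<le> tolerance (fst I) (deg I)"
      using yB[OF I pos] by (force simp: tolerance_def)
    then show ?thesis
      using yB[OF I pos] fam[OF I]
      by (auto simp: invariant_def P_def partial_colouring_def not_le[symmetric])
  qed
  ultimately show ?thesis by blast
qed

text \<open>The last inequality is the heart of the counting: the gap d / s ^ 15 \<ge> s ^ 5 pays
  for the deviation s ^ 5 / 4 of the degrees and the loss s ^ 5 / 2 of the palettes.\<close>

lemma bin_estimates:
  assumes I: "I \<in> C" and s: "s = \<sigma> (deg I)" and d: "d = deg I"
  shows "2 \<le> s" "real s ^ 20 \<le> real d" "real d \<le> 2 * real s ^ 20"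
    and "N \<le> d \<Longrightarrow> real N * (real s ^ 4 - 1) / real s ^ 15 + real s ^ 5 / 4 \<le> 3 * real s ^ 9"
    and "N \<le> d \<Longrightarrow> real N * (real s ^ 4 - 1) / real s ^ 15 + real s ^ 5 / 4 \<le> real d / real s ^ 11 - real s ^ 5 / 2"
proof -
  have adm: "admissible s d" using admissible[OF I] s d by simp
  then show s2: "2 \<le> s" by (simp add: admissible_def)
  have "real (s ^ 20) \<le> real d" "real d \<le> real (2 * s ^ 20)"
    using adm unfolding admissible_def of_nat_le_iff by auto
  then show d_bounds: "real s ^ 20 \<le> real d" "real d \<le> 2 * real s ^ 20" by simp_all
  have pos: "real s > 0" using s2 by simp
  have s4: "real s ^ 4 - 1 \<ge> 0" using s2 by simp
  assume "N \<le> d"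
  then have "real N * (real s ^ 4 - 1) \<le> real d * (real s ^ 4 - 1)"
    using s4 by (intro mult_right_mono) auto
  then have "real N * (real s ^ 4 - 1) / real s ^ 15 \<le> real d * (real s ^ 4 - 1) / real s ^ 15"
    using pos by (intro divide_right_mono) auto
  also have "\<dots> = real d / real s ^ 11 - real d / real s ^ 15"
    using pos by (simp add: field_simps flip: power_add)
  finally have *: "real N * (real s ^ 4 - 1) / real s ^ 15 \<le> real d / real s ^ 11 - real d / real s ^ 15" .
  have "real s ^ 5 \<le> real d / real s ^ 15"
    using d_bounds pos by (simp add: field_simps flip: power_add)
  moreover have "real d / real s ^ 11 \<le> 2 * real s ^ 9"
    using d_bounds pos by (simp add: field_simps flip: power_add)
  moreover have "0 \<le> real s ^ 5" "0 \<le> real s ^ 9" by simp_all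
  ultimately show "real N * (real s ^ 4 - 1) / real s ^ 15 + real s ^ 5 / 4 \<le> 3 * real s ^ 9"
    "real N * (real s ^ 4 - 1) / real s ^ 15 + real s ^ 5 / 4 \<le> real d / real s ^ 11 - real s ^ 5 / 2"
    using * by linarith+
qed

text \<open>Three rounds select the hash function and four colour the bins. The selection adds at
  most one tolerance to the vertices given up, and the uncoloured scale drops by the factor s ^
  4.\<close>

lemma hash_stage:
  assumes P: "pub C r P" and inv: "\<And>I. I \<in> C \<Longrightarrow> invariant j (e + 4) I (P I)"
    and e: "e \<in> {11, 7, 3}" and j: "j < 4"
  shows "\<exists>P'. pub C (r + 7) P' \<and> (\<forall>I\<in>C. invariant (j + 1) e I (P' I))"
proof -
  have scale: "\<sigma> d ^ e \<in> scales (\<sigma> d)" for d using e by (auto simp: scales_def)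
  define ok where "ok n d K T b \<longleftrightarrow> T \<subseteq> {..<U n} \<and> card T \<le> d + 1 \<and> b < K \<and>
       real (card T) \<ge> real d * real K / real (\<sigma> d) ^ 11 - real K * real (\<sigma> d) ^ 5 / 4" for n d K T b
  have "\<exists>fam. \<forall>I\<in>C. \<forall>T b. ok (fst I) (deg I) (\<sigma> (deg I) ^ e) T b \<longrightarrow>
     real (card {i. i < fst I \<and> bad_hash (\<sigma> (deg I)) (deg I) (fam (fst I, deg I) i) T b}) \<le> tolerance (fst I) (deg I)"
    (is "\<exists>fam. \<forall>I\<in>C. ?Q (fst I) (deg I) (fam (fst I, deg I))")
  proof (intro exI ballI)
    fix I assume "I \<in> C"
    from someI_ex[OF exists_hash_family[OF admissible large_enough scale, OF this this]]
    show "?Q (fst I) (deg I) ((\<lambda>(n, d). SOME fam. ?Q n d fam) (fst I, deg I))" unfolding ok_def by simp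
  qed
  then obtain fam where fam: "\<And>I T b. I \<in> C \<Longrightarrow> ok (fst I) (deg I) (\<sigma> (deg I) ^ e) T b \<Longrightarrow>
     real (card {i. i < fst I \<and> bad_hash (\<sigma> (deg I)) (deg I) (fam (fst I, deg I) i) T b}) \<le> tolerance (fst I) (deg I)"
    by blast
  define act :: "state \<Rightarrow> nat set" where "act = (\<lambda>(n, d, y, B, f). {v. v < n \<and> \<sigma> d ^ e \<le> y v \<and> y v < \<sigma> d ^ (e + 4) \<and> v \<notin> B})"
  \<comment> \<open>Only active vertices complain: the lower bound on free colours is established
    just for them.\<close>
  define bad where "bad i p g = (case p of (n, d, y, B, f) \<Rightarrow> (case i of (_, v, N, L) \<Rightarrow>
    v \<in> act p \<and> bad_hash (\<sigma> d) d g (free N L f) (y v mod \<sigma> d ^ e)))"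
    for i :: "nat \<times> nat \<times> nat set \<times> nat set" and p :: state and g
  have "\<exists>g B1. pub C (r + 3) (\<lambda>I. (P I, g I, B1 I)) \<and>
      (\<forall>I\<in>C. fst I > 0 \<longrightarrow> g I \<in> fam (fst (P I), fst (snd (P I))) ` {..<fst I} \<and> B1 I = {v. v < fst I \<and> bad (inp I v) (P I) (g I)} \<and>
       (\<forall>i<fst I. card (B1 I) \<le> card {v. v < fst I \<and> bad (inp I v) (P I) (fam (fst (P I), fst (snd (P I))) i)}))"
    by (rule pub_choose[OF P, where fam="\<lambda>p. fam (fst p, fst (snd p))" and bad=bad])
  then obtain g B1 where gB1: "pub C (r + 3) (\<lambda>I. (P I, g I, B1 I))"
    and B1_eq: "\<And>I. I \<in> C \<Longrightarrow> fst I > 0 \<Longrightarrow> B1 I = {v. v < fst I \<and> bad (inp I v) (P I) (g I)}"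
    and B1_min: "\<And>I i. I \<in> C \<Longrightarrow> fst I > 0 \<Longrightarrow> i < fst I \<Longrightarrow>
      card (B1 I) \<le> card {v. v < fst I \<and> bad (inp I v) (P I) (fam (fst (P I), fst (snd (P I))) i)}"
    by blast
  have pos: "fst I > 0" "deg I < fst I" if "I \<in> C" for I
    using large_enough_bounds[OF large_enough[OF that]] by auto
  have s_pos: "\<sigma> (deg I) > 0" if "I \<in> C" for I
    using admissible[OF that] by (simp add: admissible_def)
  have K_le: "\<sigma> (deg I) ^ e \<le> \<sigma> (deg I) ^ 11" "\<sigma> (deg I) ^ e > 0" if "I \<in> C" for I
    using scales_le[OF scale s_pos[OF that]] by auto
  have B1_card: "real (card (B1 I)) \<le> tolerance (fst I) (deg I)" if I: "I \<in> C" for I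
  proof -
    obtain n d y B f where PI: "P I = (n, d, y, B, f)" by (cases "P I")
    note D = invariantD[OF inv[OF I, unfolded PI]]
    let ?s = "\<sigma> (deg I)"
    have okv: "ok (fst I) (deg I) (?s ^ e) (free (nbs I v) (pal I v) f) (y v mod ?s ^ e)"
      if v: "v < fst I" "v \<in> act (P I)" for v
      unfolding ok_def
    proof (intro conjI)
      have sub: "free (nbs I v) (pal I v) f \<subseteq> pal I v" by (auto simp: free_def)
      then show "free (nbs I v) (pal I v) f \<subseteq> {..<U (fst I)}" using colours[OF I v(1)] by blast
      show "card (free (nbs I v) (pal I v) f) \<le> deg I + 1"
        using card_mono[OF finite_pal[OF wf[OF I] v(1)] sub] card_pal[OF wf[OF I] v(1)] by simp
      show "y v mod ?s ^ e < ?s ^ e" using K_le[OF I] by simp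
      have good: "good_partition n (\<sigma> d) y (nbs I v)" using D(4)[of v] v PI by (auto simp: act_def)
      have K_real: "real (?s ^ e) \<le> real ?s ^ 11" using K_le(1)[OF I] by (metis of_nat_le_iff of_nat_power)
      \<comment> \<open>The free colours number at least \<Delta> + 1 - |N| plus the uncoloured
        neighbours, which are about |N| K / s ^ 11. As K \<le> s ^ 11, the total is least when |N| =
        \<Delta>, giving \<Delta> K / s ^ 11 up to the deviation.\<close>
      have "real (card (nbs I v)) * (1 - real (?s ^ e) / real ?s ^ 11) \<le> real (deg I) * (1 - real (?s ^ e) / real ?s ^ 11)"
        using card_nbs[OF v(1)] K_real s_pos[OF I] by (intro mult_right_mono) (auto simp: field_simps)
      moreover have "real (card {u \<in> nbs I v. y u \<in> {..<?s ^ 4 * ?s ^ e}}) >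
        real (card (nbs I v)) * real (?s ^ e) / real ?s ^ 11 - real (?s ^ e) * real ?s ^ 5 / 4"
        using good scale[of d] D(1,2) unfolding good_partition_def by blast
      \<comment> \<open>Neighbours of the current stage count as slack too, hence the threshold s ^
        4 K and the fraction s ^ 4 K / s ^ 15 = K / s ^ 11.\<close>
      moreover have "card {u \<in> nbs I v. y u \<in> {..<?s ^ 4 * ?s ^ e}} \<le> card {u \<in> nbs I v. f u = None}"
        using finite_nbs[OF wf[OF I]] D(2,5) by (intro card_mono) (auto simp: power_add mult.commute)
      moreover note card_free[OF wf[OF I] v(1), of f] card_nbs[OF v(1)]
      ultimately show "real (card (free (nbs I v) (pal I v) f)) \<ge>
          real (deg I) * real (?s ^ e) / real ?s ^ 11 - real (?s ^ e) * real ?s ^ 5 / 4"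
        unfolding right_diff_distrib by simp
    qed
    have "real (card {i. i < fst I \<and> bad (inp I v) (P I) (fam (fst I, deg I) i)}) \<le> tolerance (fst I) (deg I)"
      if "v < fst I" for v
    proof (cases "v \<in> act (P I)")
      case True
      then show ?thesis
        using fam[OF I okv[OF that True]] D(1,2) by (simp add: bad_def PI inp_def)
    next
      case False
      then have "{i. i < fst I \<and> bad (inp I v) (P I) (fam (fst I, deg I) i)} = {}"
        by (auto simp: bad_def PI inp_def)
      then show ?thesis by (simp only: card.empty of_nat_0) (simp add: tolerance_def)
    qed
    then have "\<exists>i<fst I. real (card {v. v < fst I \<and> bad (inp I v) (P I) (fam (fst I, deg I) i)})
        \<le> 1 / (16 * (real (deg I) + 1)) * real (fst I)"
      using pos[OF I] by (intro exists_good_member) (auto simp: tolerance_def)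
    then obtain i where i: "i < fst I" "real (card {v. v < fst I \<and> bad (inp I v) (P I) (fam (fst I, deg I) i)}) \<le> tolerance (fst I) (deg I)"
      by (auto simp: tolerance_def)
    have "card (B1 I) \<le> card {v. v < fst I \<and> bad (inp I v) (P I) (fam (fst I, deg I) i)}"
      using B1_min[OF I pos(1)[OF I] i(1)] D(1,2) by (simp add: PI)
    with i(2) show ?thesis by linarith
  qed
  \<comment> \<open>A vertex with a bad hash joins B and sits out. It stays uncoloured and so takes
    no colour from its neighbours.\<close>
  define Q where "Q I = (let (n, d, y, B, f) = P I in ((n, d, y, B \<union> B1 I, f), g I, U n))" for I
  have "pub C (r + 3) Q"
    by (rule pub_map[OF gB1, where h="\<lambda>_ (p, g, B1). (let (n, d, y, B, f) = p in ((n, d, y, B \<union> B1, f), g, U n))"])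
       (simp add: Q_def)
  then have "\<exists>f'. pub C (r + 3 + 4) (\<lambda>I. (Q I, f' I)) \<and> (\<forall>I\<in>C. partial_colouring I (f' I) \<and>
    (\<forall>v\<in>act (fst (Q I)). f' I v \<noteq> None) \<and> (\<forall>v. v \<notin> act (fst (Q I)) \<longrightarrow> f' I v = (\<lambda>((n, d, y, B, f), g, u). f) (Q I) v))"
  proof (rule pub_colour_bins[where f="\<lambda>((n, d, y, B, f), g, u). f" and act="\<lambda>q. act (fst q)" and B="a + 4"
      and leader="\<lambda>((n, d, y, B, f), g, u) v. y v mod \<sigma> d ^ e" and hash="\<lambda>((n, d, y, B, f), g, u). g"
      and d="\<lambda>((n, d, y, B, f), g, u). 3 * \<sigma> d ^ 9" and M="\<lambda>((n, d, y, B, f), g, u). n + u", OF _ wf])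
    fix I assume I: "I \<in> C"
    obtain n d y B f where PI: "P I = (n, d, y, B, f)" by (cases "P I")
    note D = invariantD[OF inv[OF I, unfolded PI]]
    have QI: "Q I = ((n, d, y, B \<union> B1 I, f), g I, U n)" by (simp add: Q_def PI)
    let ?s = "\<sigma> d"
    have s: "?s = \<sigma> (deg I)" using D(2) by simp
    show "partial_colouring I ((\<lambda>((n, d, y, B, f), g, u). f) (Q I))" using D(3) by (simp add: QI)
    show act_sub: "act (fst (Q I)) \<subseteq> {..<fst I}" using D(1) by (auto simp: QI act_def)
    show "pal I v \<subseteq> {..<(\<lambda>((n, d, y, B, f), g, u). n + u) (Q I)}" if "v < fst I" for v
      using colours[OF I that] D(1) by (auto simp: QI)
    show "fst I \<le> (\<lambda>((n, d, y, B, f), g, u). n + u) (Q I)" using D(1) by (simp add: QI)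
    show "2 * (\<lambda>((n, d, y, B, f), g, u). n + u) (Q I) < fst I ^ (a + 4)" if "2 \<le> fst I"
      using colour_bound[OF that U_le[OF I]] D(1) by (simp add: QI)
    let ?lead = "(\<lambda>((n, d, y, B, f), g, u) v. y v mod \<sigma> d ^ e) (Q I)"
    have lead: "?lead = (\<lambda>v. y v mod ?s ^ e)" by (simp add: QI)
    have K: "0 < ?s ^ e" "?s ^ e \<le> n"
      using K_le[OF I] admissible_pow_le[OF admissible[OF I], of 11] pos[OF I] D(1,2) by auto
    have lead_less: "?lead v < ?s ^ e" for v using K by (simp add: lead)
    show "?lead v < fst I" for v using lead_less[of v] K D(1) by linarith
    show "(\<lambda>((n, d, y, B, f), g, u). f) (Q I) v = None" if "v \<in> act (fst (Q I))" for v
      using that D(5)[of v] by (auto simp: QI act_def)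
    have bin: "{u \<in> X. u \<in> act (fst (Q I)) \<and> ?lead u = b} \<subseteq> {u \<in> X. y u \<in> bin ?s (?s ^ e) b}" for X b
      by (auto simp: QI act_def bin_def power_add mult.commute)
    have bin_deg: "real (card {u \<in> nbs I v. u \<in> act (fst (Q I)) \<and> ?lead u = ?lead v}) <
        real (card (nbs I v)) * (real ?s ^ 4 - 1) / real ?s ^ 15 + real ?s ^ 5 / 4" if v: "v \<in> act (fst (Q I))" for v
    proof -
      have good: "good_partition n ?s y (nbs I v)" using D(4)[of v] v by (auto simp: act_def QI)
      have "card {u \<in> nbs I v. u \<in> act (fst (Q I)) \<and> ?lead u = ?lead v} \<le> card {u \<in> nbs I v. y u \<in> bin ?s (?s ^ e) (?lead v)}"
        using finite_nbs[OF wf[OF I]] by (intro card_mono bin) auto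
      moreover have "real (card {u \<in> nbs I v. y u \<in> bin ?s (?s ^ e) (?lead v)}) <
        real (card (nbs I v)) * (real ?s ^ 4 - 1) / real ?s ^ 15 + real ?s ^ 5 / 4"
        using good scale lead_less[of v] unfolding good_partition_def by blast
      ultimately show ?thesis by linarith
    qed
    have cN: "card (nbs I v) \<le> d" if "v \<in> act (fst (Q I))" for v
      using card_nbs[of v I] that act_sub D(2) by auto
    show "card {u \<in> nbs I v. u \<in> act (fst (Q I)) \<and> ?lead u = ?lead v} \<le> (\<lambda>((n, d, y, B, f), g, u). 3 * \<sigma> d ^ 9) (Q I)"
      if v: "v \<in> act (fst (Q I))" for v
    proof -
      have "real (card {u \<in> nbs I v. u \<in> act (fst (Q I)) \<and> ?lead u = ?lead v}) \<le> real (3 * ?s ^ 9)"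
        using bin_deg[OF v] bin_estimates(4)[OF I s D(2) cN[OF v]] by simp
      then show ?thesis unfolding of_nat_le_iff by (simp add: QI)
    qed
    show "card {u \<in> nbs I v. u \<in> act (fst (Q I)) \<and> ?lead u = ?lead v}
        < card {c \<in> free (nbs I v) (pal I v) ((\<lambda>((n, d, y, B, f), g, u). f) (Q I)).
            (\<lambda>((n, d, y, B, f), g, u). g) (Q I) c = ?lead v}"
      if v: "v \<in> act (fst (Q I))" for v
    proof -
      have "v \<in> act (P I)" "v \<notin> B1 I" "v < fst I" using v D(1) by (auto simp: QI PI act_def)
      then have "\<not> bad_hash ?s d (g I) (free (nbs I v) (pal I v) f) (y v mod ?s ^ e)"
        using B1_eq[OF I pos(1)[OF I]] by (auto simp: bad_def PI inp_def)
      then have "real (card {c \<in> free (nbs I v) (pal I v) f. g I c = ?lead v}) > real d / real ?s ^ 11 - real ?s ^ 5 / 2"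
        by (simp add: bad_hash_def lead not_le)
      with bin_deg[OF v] bin_estimates(5)[OF I s D(2) cN[OF v]]
      have "real (card {u \<in> nbs I v. u \<in> act (fst (Q I)) \<and> ?lead u = ?lead v}) <
        real (card {c \<in> free (nbs I v) (pal I v) f. g I c = ?lead v})" by linarith
      then show ?thesis unfolding of_nat_less_iff by (simp add: QI)
    qed
    show "card {v \<in> act (fst (Q I)). ?lead v = b} * (2 * (\<lambda>((n, d, y, B, f), g, u). 3 * \<sigma> d ^ 9) (Q I) + 1) \<le> fst I" for b
    proof (cases "b < ?s ^ e")
      case True
      obtain v where "good_partition n ?s y (nbs I v)"
        using ex_good_vertex[OF I inv[OF I, unfolded PI]] j by auto
      then have "real (card {u \<in> {..<n}. y u \<in> bin ?s (?s ^ e) b}) < 2 * real n / real ?s ^ 11"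
        using scale True unfolding good_partition_def by blast
      moreover have "card {v \<in> act (fst (Q I)). ?lead v = b} \<le> card {u \<in> {..<n}. y u \<in> bin ?s (?s ^ e) b}"
        using bin[of "{..<n}" b] act_sub D(1) by (intro card_mono) auto
      ultimately have "real (card {v \<in> act (fst (Q I)). ?lead v = b}) \<le> 2 * real n / real ?s ^ 11" by linarith
      \<comment> \<open>A vertex sends at most 6 s ^ 9 + 1 \<le> 7 s ^ 9 words, so a leader gets at
        most 14 n / s ^ 2 of them.\<close>
      then have "real (card {v \<in> act (fst (Q I)). ?lead v = b}) * (2 * (3 * real ?s ^ 9) + 1) \<le>
          2 * real n / real ?s ^ 11 * (7 * real ?s ^ 9)"
        using bin_estimates(1)[OF I s D(2)] by (intro mult_mono) auto
      also have "\<dots> = real n * (14 / real ?s ^ 2)"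
        using bin_estimates(1)[OF I s D(2)] by (simp add: field_simps flip: power_add)
      also have "\<dots> \<le> real n * 1"
      proof (intro mult_left_mono)
        have "41 \<le> real ?s" using admissible[OF I] D(2) by (simp add: admissible_def)
        then have "41 * 41 \<le> real ?s * real ?s" by (intro mult_mono) auto
        then show "14 / real ?s ^ 2 \<le> 1" by (simp add: field_simps power2_eq_square)
      qed auto
      finally have "real (card {v \<in> act (fst (Q I)). ?lead v = b} * (2 * (3 * ?s ^ 9) + 1)) \<le> real n" by (simp add: algebra_simps)
      then show ?thesis unfolding of_nat_le_iff using D(1) by (simp add: QI)
    next
      case False
      then have "{v \<in> act (fst (Q I)). ?lead v = b} = {}" using lead_less by auto
      then show ?thesis by (simp only: card.empty)
    qed
  qed
  then obtain f' where f': "pub C (r + 7) (\<lambda>I. (Q I, f' I))"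
    and f'_props: "\<And>I. I \<in> C \<Longrightarrow> partial_colouring I (f' I)"
      "\<And>I v. I \<in> C \<Longrightarrow> v \<in> act (fst (Q I)) \<Longrightarrow> f' I v \<noteq> None"
      "\<And>I v. I \<in> C \<Longrightarrow> v \<notin> act (fst (Q I)) \<Longrightarrow> f' I v = (\<lambda>((n, d, y, B, f), g, u). f) (Q I) v"
    by (auto simp: add.assoc)
  define P' where "P' I = (let ((n, d, y, B, f), _) = Q I in (n, d, y, B, f' I))" for I
  have "pub C (r + 7) P'"
    by (rule pub_map[OF f', where h="\<lambda>_ (q, f'). (let ((n, d, y, B, f), _) = q in (n, d, y, B, f'))"])
       (simp add: P'_def)
  moreover have "invariant (j + 1) e I (P' I)" if I: "I \<in> C" for I
  proof -
    obtain n d y B f where PI: "P I = (n, d, y, B, f)" by (cases "P I")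
    note D = invariantD[OF inv[OF I, unfolded PI]]
    have QI: "Q I = ((n, d, y, B \<union> B1 I, f), g I, U n)" by (simp add: Q_def PI)
    have P'I: "P' I = (n, d, y, B \<union> B1 I, f' I)" by (simp add: P'_def QI)
    have act: "act (n, d, y, B \<union> B1 I, f) = {v. v < n \<and> \<sigma> d ^ e \<le> y v \<and> y v < \<sigma> d ^ (e + 4) \<and> v \<notin> B \<union> B1 I}"
      by (simp add: act_def)
    have step: "\<sigma> d ^ e \<le> \<sigma> d ^ (e + 4)" using s_pos[OF I] D(2) by (intro power_increasing) auto
    show ?thesis
      unfolding P'I invariant_def prod.case
    proof (intro conjI allI impI)
      show "f' I v = None" if "y v < \<sigma> d ^ e" for v
        using f'_props(3)[OF I, of v] that D(5)[of v] step by (simp add: act QI)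
      show "f' I v \<noteq> None" if "v < n" "\<sigma> d ^ e \<le> y v" "v \<notin> B \<union> B1 I" for v
      proof (cases "y v < \<sigma> d ^ (e + 4)")
        case True
        with that show ?thesis using f'_props(2)[OF I, of v] by (simp add: act QI)
      next
        case False
        then have "f' I v = f v" using f'_props(3)[OF I, of v] by (simp add: act QI)
        with D(6)[of v] that False show ?thesis by simp
      qed
      show "B \<union> B1 I \<subseteq> {..<n}" using D(1,7) B1_eq[OF I pos(1)[OF I]] by auto
      have "real (card (B \<union> B1 I)) \<le> real (card B) + real (card (B1 I))"
        using card_Un_le[of B "B1 I"] by linarith
      also have "\<dots> \<le> real (j + 1) * tolerance n d"
        using D(8) B1_card[OF I] D(1,2) by (simp add: algebra_simps)
      finally show "real (card (B \<union> B1 I)) \<le> real (j + 1) * tolerance n d" .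
    qed (use D f'_props(1)[OF I] in auto)
  qed
  ultimately show ?thesis by blast
qed

lemma finish:
  assumes P: "pub C r P" and inv: "\<And>I. I \<in> C \<Longrightarrow> invariant 4 3 I (P I)"
  shows "\<exists>f. pub C (r + 8) f \<and> (\<forall>I\<in>C. partial_colouring I (f I) \<and> (\<forall>v<fst I. f I v \<noteq> None))"
proof -
  define Q where "Q I = (P I, U (fst I))" for I
  have Q: "pub C r Q"
    by (rule pub_map[OF P, where h="\<lambda>n p. (p, U n)"]) (simp add: Q_def)
  define act1 :: "state \<times> nat \<Rightarrow> nat set" where "act1 = (\<lambda>((n, d, y, B, f), u :: nat). {v. v < n \<and> y v < \<sigma> d ^ 3 \<and> v \<notin> B})"
  have "\<exists>f'. pub C (r + 4) (\<lambda>I. (Q I, f' I)) \<and> (\<forall>I\<in>C. partial_colouring I (f' I) \<and>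
    (\<forall>v\<in>act1 (Q I). f' I v \<noteq> None) \<and> (\<forall>v. v \<notin> act1 (Q I) \<longrightarrow> f' I v = (\<lambda>((n, d, y, B, f), u). f) (Q I) v))"
  proof (rule pub_colour_set[where f="\<lambda>((n, d, y, B, f), u). f" and act=act1 and B="a + 4"
      and d="\<lambda>((n, d, y, B, f), u). 4 * \<sigma> d ^ 8" and M="\<lambda>((n, d, y, B, f), u). n + u", OF Q wf])
    fix I assume I: "I \<in> C"
    obtain n d y B f where PI: "P I = (n, d, y, B, f)" by (cases "P I")
    note D = invariantD[OF inv[OF I, unfolded PI]]
    have QI: "Q I = ((n, d, y, B, f), U n)" using D(1) by (simp add: Q_def PI)
    let ?s = "\<sigma> d"
    have s: "?s = \<sigma> (deg I)" using D(2) by simp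
    show "partial_colouring I ((\<lambda>((n, d, y, B, f), u). f) (Q I))" using D(3) by (simp add: QI)
    show "act1 (Q I) \<subseteq> {..<fst I}" using D(1) by (auto simp: QI act1_def)
    show "pal I v \<subseteq> {..<(\<lambda>((n, d, y, B, f), u). n + u) (Q I)}" if "v < fst I" for v
      using colours[OF I that] D(1) by (auto simp: QI)
    show "fst I \<le> (\<lambda>((n, d, y, B, f), u). n + u) (Q I)" using D(1) by (simp add: QI)
    show "2 * (\<lambda>((n, d, y, B, f), u). n + u) (Q I) < fst I ^ (a + 4)" if "2 \<le> fst I"
      using colour_bound[OF that U_le[OF I]] D(1) by (simp add: QI)
    show "(\<lambda>((n, d, y, B, f), u). f) (Q I) v = None" if "v \<in> act1 (Q I)" for v
      using that D(5)[of v] by (auto simp: QI act1_def)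
    show "card {u \<in> nbs I v. u \<in> act1 (Q I)} \<le> (\<lambda>((n, d, y, B, f), u). 4 * \<sigma> d ^ 8) (Q I)" if v: "v \<in> act1 (Q I)" for v
    proof -
      have "good_partition n ?s y (nbs I v)" using D(4)[of v] v by (auto simp: act1_def QI)
      then have "real (card {u \<in> nbs I v. y u \<in> {..<?s ^ 3}}) < 4 * real ?s ^ 8" unfolding good_partition_def by blast
      moreover have "card {u \<in> nbs I v. u \<in> act1 (Q I)} \<le> card {u \<in> nbs I v. y u \<in> {..<?s ^ 3}}"
        using finite_nbs[OF wf[OF I]] by (intro card_mono) (auto simp: act1_def QI)
      ultimately have "real (card {u \<in> nbs I v. u \<in> act1 (Q I)}) \<le> real (4 * ?s ^ 8)" by simp
      then show ?thesis unfolding of_nat_le_iff by (simp add: QI)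
    qed
    show "card (act1 (Q I)) * (2 * (\<lambda>((n, d, y, B, f), u). 4 * \<sigma> d ^ 8) (Q I) + 1) \<le> fst I"
    proof -
      obtain v where "good_partition n ?s y (nbs I v)"
        using ex_good_vertex[OF I inv[OF I, unfolded PI]] by auto
      then have "real (card {u \<in> {..<n}. y u \<in> {..<?s ^ 3}}) < 2 * real n / real ?s ^ 12"
        unfolding good_partition_def by blast
      moreover have "card (act1 (Q I)) \<le> card {u \<in> {..<n}. y u \<in> {..<?s ^ 3}}"
        by (intro card_mono) (auto simp: act1_def QI)
      ultimately have "real (card (act1 (Q I))) \<le> 2 * real n / real ?s ^ 12" by linarith
      then have "real (card (act1 (Q I))) * (2 * (4 * real ?s ^ 8) + 1) \<le> 2 * real n / real ?s ^ 12 * (9 * real ?s ^ 8)"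
        using bin_estimates(1)[OF I s D(2)] by (intro mult_mono) auto
      also have "\<dots> = real n * (18 / real ?s ^ 4)"
        using bin_estimates(1)[OF I s D(2)] by (simp add: field_simps flip: power_add)
      also have "\<dots> \<le> real n * 1"
      proof (intro mult_left_mono)
        have "41 \<le> real ?s" using admissible[OF I] D(2) by (simp add: admissible_def)
        then have "41 ^ 4 \<le> real ?s ^ 4" by (intro power_mono) auto
        then show "18 / real ?s ^ 4 \<le> 1" by (simp add: divide_le_eq)
      qed auto
      finally have "real (card (act1 (Q I)) * (2 * (4 * ?s ^ 8) + 1)) \<le> real n" by (simp add: algebra_simps)
      then show ?thesis unfolding of_nat_le_iff using D(1) by (simp add: QI)
    qed
  qed
  then obtain f1 where f1: "pub C (r + 4) (\<lambda>I. (Q I, f1 I))"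
    and f1_props: "\<And>I. I \<in> C \<Longrightarrow> partial_colouring I (f1 I)"
      "\<And>I v. I \<in> C \<Longrightarrow> v \<in> act1 (Q I) \<Longrightarrow> f1 I v \<noteq> None"
      "\<And>I v. I \<in> C \<Longrightarrow> v \<notin> act1 (Q I) \<Longrightarrow> f1 I v = (\<lambda>((n, d, y, B, f), u). f) (Q I) v"
    by blast
  define R where "R I = (fst I, deg I, f1 I)" for I
  have R: "pub C (r + 4) R"
  proof (rule pub_map[OF f1, where h="\<lambda>n (((_, d, _), _), f). (n, d, f)"])
    fix I assume I: "I \<in> C"
    obtain n d y B f where PI: "P I = (n, d, y, B, f)" by (cases "P I")
    show "R I = (\<lambda>n (((_, d, _), _), f). (n, d, f)) (fst I) (Q I, f1 I)"
      using invariantD(2)[OF inv[OF I, unfolded PI]] by (simp add: R_def Q_def PI)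
  qed
  define act2 :: "nat \<times> nat \<times> (nat \<Rightarrow> nat option) \<Rightarrow> nat set" where "act2 = (\<lambda>(n, d, f). {v. v < n \<and> f v = None})"
  have "\<exists>f'. pub C (r + 4 + 4) (\<lambda>I. (R I, f' I)) \<and> (\<forall>I\<in>C. partial_colouring I (f' I) \<and>
    (\<forall>v\<in>act2 (R I). f' I v \<noteq> None) \<and> (\<forall>v. v \<notin> act2 (R I) \<longrightarrow> f' I v = (\<lambda>(n, d, f). f) (R I) v))"
  proof (rule pub_colour_set[where f="\<lambda>(n, d, f). f" and act=act2 and B="a + 4"
      and d="\<lambda>(n, d, f). d" and M="\<lambda>(n, d, f). n + U n", OF R wf])
    fix I assume I: "I \<in> C"
    obtain n d y B f where PI: "P I = (n, d, y, B, f)" by (cases "P I")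
    note D = invariantD[OF inv[OF I, unfolded PI]]
    have QI: "Q I = ((n, d, y, B, f), U n)" using D(1) by (simp add: Q_def PI)
    show "partial_colouring I ((\<lambda>(n, d, f). f) (R I))" using f1_props(1)[OF I] by (simp add: R_def)
    show "act2 (R I) \<subseteq> {..<fst I}" by (auto simp: R_def act2_def)
    show "pal I v \<subseteq> {..<(\<lambda>(n, d, f). n + U n) (R I)}" if "v < fst I" for v
      using colours[OF I that] by (auto simp: R_def)
    show "fst I \<le> (\<lambda>(n, d, f). n + U n) (R I)" by (simp add: R_def)
    show "2 * (\<lambda>(n, d, f). n + U n) (R I) < fst I ^ (a + 4)" if "2 \<le> fst I"
      using colour_bound[OF that U_le[OF I]] by (simp add: R_def)
    show "(\<lambda>(n, d, f). f) (R I) v = None" if "v \<in> act2 (R I)" for v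
      using that by (auto simp: R_def act2_def)
    show "card {u \<in> nbs I v. u \<in> act2 (R I)} \<le> (\<lambda>(n, d, f). d) (R I)" if v: "v \<in> act2 (R I)" for v
    proof -
      have "card {u \<in> nbs I v. u \<in> act2 (R I)} \<le> card (nbs I v)"
        using finite_nbs[OF wf[OF I]] by (intro card_mono) auto
      also have "\<dots> \<le> deg I" using v by (intro card_nbs) (auto simp: R_def act2_def)
      finally show ?thesis by (simp add: R_def)
    qed
    show "card (act2 (R I)) * (2 * (\<lambda>(n, d, f). d) (R I) + 1) \<le> fst I"
    proof -
      have "act2 (R I) \<subseteq> B"
      proof
        fix v assume "v \<in> act2 (R I)"
        then have v: "v < n" "f1 I v = None" using D(1) by (auto simp: R_def act2_def)
        then have "v \<notin> act1 (Q I)" using f1_props(2)[OF I] by blast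
        with f1_props(3)[OF I, of v] v have "f v = None" "\<not> (y v < \<sigma> d ^ 3 \<and> v \<notin> B)" by (auto simp: QI act1_def)
        with D(6)[of v] v show "v \<in> B" by (meson not_le)
      qed
      then have "card (act2 (R I)) \<le> card B" using finite_subset[OF D(7)] by (intro card_mono) auto
      then have "real (card (act2 (R I))) * (2 * real d + 1) \<le> (4 * tolerance n d) * (4 * (real d + 1))"
        using D(8) by (intro mult_mono) auto
      also have "\<dots> = real n" by (simp add: tolerance_def field_simps)
      finally have "real (card (act2 (R I)) * (2 * d + 1)) \<le> real n" by (simp add: algebra_simps)
      then show ?thesis unfolding of_nat_le_iff using D(1,2) by (simp add: R_def)
    qed
  qed
  then obtain f2 where f2: "pub C (r + 8) (\<lambda>I. (R I, f2 I))"
    and f2_props: "\<And>I. I \<in> C \<Longrightarrow> partial_colouring I (f2 I)"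
      "\<And>I v. I \<in> C \<Longrightarrow> v \<in> act2 (R I) \<Longrightarrow> f2 I v \<noteq> None"
      "\<And>I v. I \<in> C \<Longrightarrow> v \<notin> act2 (R I) \<Longrightarrow> f2 I v = (\<lambda>(n, d, f). f) (R I) v"
    by (auto simp: add.assoc)
  have "pub C (r + 8) f2" by (rule pub_map[OF f2, where h="\<lambda>_. snd"]) simp
  moreover have "f2 I v \<noteq> None" if "I \<in> C" "v < fst I" for I v
    using f2_props(2,3)[OF that(1), of v] that(2) by (cases "v \<in> act2 (R I)") (auto simp: act2_def R_def)
  ultimately show ?thesis using f2_props(1) by blast
qed

lemma pub_colouring:
  "\<exists>r f. pub C r f \<and> (\<forall>I\<in>C. partial_colouring I (f I) \<and> (\<forall>v<fst I. f I v \<noteq> None))"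
proof -
  have stage: "\<exists>P'. pub C (r + 7) P' \<and> (\<forall>I\<in>C. invariant j' e I (P' I))"
    if "\<exists>P. pub C r P \<and> (\<forall>I\<in>C. invariant j e' I (P I))" "e \<in> {11, 7, 3}" "j < 4" "j' = j + 1" "e' = e + 4"
    for r j j' e e'
    using that hash_stage by blast
  have "\<exists>P. pub C (3 + 7) P \<and> (\<forall>I\<in>C. invariant 2 11 I (P I))"
    by (rule stage[OF start]) auto
  then have "\<exists>P. pub C (3 + 7 + 7) P \<and> (\<forall>I\<in>C. invariant 3 7 I (P I))"
    by (rule stage) auto
  then have "\<exists>P. pub C (3 + 7 + 7 + 7) P \<and> (\<forall>I\<in>C. invariant 4 3 I (P I))"
    by (rule stage) auto
  then obtain P3 where P3: "pub C (3 + 7 + 7 + 7) P3" "\<And>I. I \<in> C \<Longrightarrow> invariant 4 3 I (P3 I)" by blast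
  from finish[OF P3] show ?thesis by blast
qed

end

section \<open>Instances of bounded degree or bounded size\<close>

lemma card_residue_class_le:
  assumes "m > 0" shows "card {v. v < n \<and> v mod m = t} \<le> n div m + 1"
proof -
  have "inj_on (\<lambda>v. v div m) {v. v < n \<and> v mod m = t}"
    by (rule inj_onI) (metis (mono_tags, lifting) div_mult_mod_eq mem_Collect_eq)
  moreover have "(\<lambda>v. v div m) ` {v. v < n \<and> v mod m = t} \<subseteq> {..n div m}"
    by (auto intro: div_le_mono)
  ultimately have "card {v. v < n \<and> v mod m = t} \<le> card {..n div m}"
    by (rule card_inj_on_le) auto
  then show ?thesis by simp
qed

text \<open>The vertices are coloured by residue classes modulo m, one class after the other with a
  single leader. As m depends on d only, the number of rounds is constant.\<close>

lemma pub_colouring_small_degree: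
  assumes wf: "\<And>I. I \<in> C \<Longrightarrow> wf_inst I"
    and colours: "\<And>I v. I \<in> C \<Longrightarrow> v < fst I \<Longrightarrow> pal I v \<subseteq> {..<U (fst I)}"
    and U: "\<And>I. I \<in> C \<Longrightarrow> fst I \<ge> 2 \<Longrightarrow> 2 * (fst I + U (fst I)) < fst I ^ B"
    and d: "\<And>I. I \<in> C \<Longrightarrow> deg I \<le> d" and n: "\<And>I. I \<in> C \<Longrightarrow> 4 * d + 2 \<le> fst I"
  shows "\<exists>r f. pub C r f \<and> (\<forall>I\<in>C. partial_colouring I (f I) \<and> (\<forall>v<fst I. f I v \<noteq> None))"
proof -
  \<comment> \<open>m = 2 (2 d + 1): a class has at most n div m + 1 vertices, so its words number
    at most (n + m) / 2 \<le> n.\<close>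
  define m where "m = 4 * d + 2"
  have "\<exists>r f. pub C r f \<and> (\<forall>I\<in>C. partial_colouring I (f I) \<and>
     (\<forall>v. f I v \<noteq> None \<longleftrightarrow> v < fst I \<and> v mod m < t))" for t
  proof (induction t)
    case 0
    have "pub C 0 (\<lambda>_ _. None)" by (rule pub_map[OF pub_unit, where h="\<lambda>_ _ _. None"]) simp
    then show ?case by (intro exI conjI) (auto simp: partial_colouring_def)
  next
    case (Suc t)
    then obtain r f where f: "pub C r f" and f_props: "\<And>I. I \<in> C \<Longrightarrow> partial_colouring I (f I)"
      "\<And>I v. I \<in> C \<Longrightarrow> f I v \<noteq> None \<longleftrightarrow> v < fst I \<and> v mod m < t" by blast
    define P where "P I = (fst I, f I)" for I
    have P: "pub C r P" by (rule pub_map[OF f, where h="\<lambda>n f. (n, f)"]) (simp add: P_def)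
    define act where "act = (\<lambda>(n, f :: nat \<Rightarrow> nat option). {v. v < n \<and> v mod m = t})"
    have "\<exists>f'. pub C (r + 4) (\<lambda>I. (P I, f' I)) \<and> (\<forall>I\<in>C. partial_colouring I (f' I) \<and>
      (\<forall>v\<in>act (P I). f' I v \<noteq> None) \<and> (\<forall>v. v \<notin> act (P I) \<longrightarrow> f' I v = snd (P I) v))"
    proof (rule pub_colour_set[where f=snd and act=act and d="\<lambda>_. d" and M="\<lambda>p. fst p + U (fst p)" and B=B, OF P wf])
      fix I assume I: "I \<in> C"
      show "snd (P I) v = None" if "v \<in> act (P I)" for v
        using f_props(2)[OF I, of v] that by (auto simp: P_def act_def)
      show "card {u \<in> nbs I v. u \<in> act (P I)} \<le> d" if v: "v \<in> act (P I)" for v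
      proof -
        have "card {u \<in> nbs I v. u \<in> act (P I)} \<le> card (nbs I v)"
          using finite_nbs[OF wf[OF I]] by (intro card_mono) auto
        also have "\<dots> \<le> deg I" using v by (intro card_nbs) (auto simp: P_def act_def)
        finally show ?thesis using d[OF I] by simp
      qed
      show "card (act (P I)) * (2 * d + 1) \<le> fst I"
      proof -
        have "card (act (P I)) * (2 * d + 1) \<le> (fst I div m + 1) * (2 * d + 1)"
          using card_residue_class_le[of m "fst I" t] by (intro mult_right_mono) (auto simp: act_def P_def m_def)
        also have "2 * ((fst I div m + 1) * (2 * d + 1)) = fst I div m * m + m" by (simp add: m_def algebra_simps)
        then have "(fst I div m + 1) * (2 * d + 1) \<le> fst I"
          using n[OF I] div_times_less_eq_dividend[of "fst I" m] by (simp add: m_def)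
        finally show ?thesis .
      qed
      show "partial_colouring I (snd (P I))" using f_props(1)[OF I] by (simp add: P_def)
      show "act (P I) \<subseteq> {..<fst I}" by (auto simp: P_def act_def)
      show "pal I v \<subseteq> {..<fst (P I) + U (fst (P I))}" if "v < fst I" for v
        using colours[OF I that] by (auto simp: P_def)
      show "fst I \<le> fst (P I) + U (fst (P I))" by (simp add: P_def)
      show "2 * (fst (P I) + U (fst (P I))) < fst I ^ B" if "2 \<le> fst I" using U[OF I that] by (simp add: P_def)
    qed
    then obtain f' where f': "pub C (r + 4) (\<lambda>I. (P I, f' I))" and f'_props: "\<And>I. I \<in> C \<Longrightarrow> partial_colouring I (f' I)"
      "\<And>I v. I \<in> C \<Longrightarrow> v \<in> act (P I) \<Longrightarrow> f' I v \<noteq> None"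
      "\<And>I v. I \<in> C \<Longrightarrow> v \<notin> act (P I) \<Longrightarrow> f' I v = snd (P I) v" by blast
    have "pub C (r + 4) f'" by (rule pub_map[OF f', where h="\<lambda>_. snd"]) simp
    moreover have "f' I v \<noteq> None \<longleftrightarrow> v < fst I \<and> v mod m < Suc t" if I: "I \<in> C" for I v
    proof (cases "v \<in> act (P I)")
      case True
      with f'_props(2)[OF I True] show ?thesis by (simp add: act_def P_def)
    next
      case False
      with f'_props(3)[OF I False] f_props(2)[OF I, of v] show ?thesis by (auto simp: act_def P_def less_Suc_eq)
    qed
    ultimately show ?case using f'_props(1) by blast
  qed
  from this[of m] obtain r f where f: "pub C r f" "\<forall>I\<in>C. partial_colouring I (f I) \<and>
     (\<forall>v. f I v \<noteq> None \<longleftrightarrow> v < fst I \<and> v mod m < m)" by blast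
  have "m > 0" by (simp add: m_def)
  then have "\<forall>I\<in>C. partial_colouring I (f I) \<and> (\<forall>v<fst I. f I v \<noteq> None)" using f(2) by simp
  with f(1) show ?thesis by blast
qed

section \<open>Gluing classes of instances, each with its own constant number of rounds\<close>

definition solvable :: "inst set \<Rightarrow> bool" where
  "solvable C \<longleftrightarrow> (\<exists>r f. know C r f \<and> (\<forall>I\<in>C. proper_list_colouring (fst I) (fst (snd I)) (pal I) (f I)))"

lemma proper_list_colouringI:
  assumes "wf_inst I" "\<And>v. v < fst I \<Longrightarrow> f v \<in> pal I v" "\<And>u v. v < fst I \<Longrightarrow> u \<in> nbs I v \<Longrightarrow> f u \<noteq> f v"
  shows "proper_list_colouring (fst I) (fst (snd I)) (pal I) f"
proof -
  have "f u \<noteq> f v" if "{u, v} \<in> fst (snd I)" for u v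
  proof -
    have "u \<in> nbs I v" using that by (simp add: neighbours_def)
    then show ?thesis using assms(3) nbs_bounds[OF assms(1)] by blast
  qed
  then show ?thesis using assms(2) by (auto simp: proper_list_colouring_def)
qed

lemma solvableI:
  assumes "\<exists>r f. pub C r f \<and> (\<forall>I\<in>C. partial_colouring I (f I) \<and> (\<forall>v<fst I. f I v \<noteq> None))"
    and wf: "\<And>I. I \<in> C \<Longrightarrow> wf_inst I"
  shows "solvable C"
proof -
  obtain r f where f: "pub C r f" "\<And>I. I \<in> C \<Longrightarrow> partial_colouring I (f I)"
    "\<And>I v. I \<in> C \<Longrightarrow> v < fst I \<Longrightarrow> f I v \<noteq> None" using assms(1) by blast
  have "know C r (\<lambda>I v. the (f I v))"
    by (rule know_map[OF f(1)[unfolded pub_def], where h="\<lambda>(i, f). the (f (fst (snd i)))"]) (simp add: inp_def)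
  moreover have "proper_list_colouring (fst I) (fst (snd I)) (pal I) (\<lambda>v. the (f I v))" if I: "I \<in> C" for I
  proof (rule proper_list_colouringI[OF wf[OF I]])
    show "the (f I v) \<in> pal I v" if v: "v < fst I" for v
      using f(2)[OF I] f(3)[OF I v] by (auto simp: partial_colouring_def)
    show "the (f I u) \<noteq> the (f I v)" if v: "v < fst I" and uv: "u \<in> nbs I v" for u v
    proof -
      obtain c c' where "f I u = Some c" "f I v = Some c'"
        using f(3)[OF I v] f(3)[OF I nbs_bounds(1)[OF wf[OF I] uv]] by blast
      with f(2)[OF I] uv show ?thesis by (auto simp: partial_colouring_def)
    qed
  qed
  ultimately show ?thesis unfolding solvable_def by blast
qed

lemma solvable_Un:
  assumes "solvable C" "solvable C'"
    and "\<And>I v. I \<in> C \<Longrightarrow> v < fst I \<Longrightarrow> Q (inp I v)" "\<And>I v. I \<in> C' \<Longrightarrow> v < fst I \<Longrightarrow> \<not> Q (inp I v)"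
    and wf: "\<And>I. I \<in> C \<union> C' \<Longrightarrow> wf_inst I"
  shows "solvable (C \<union> C')"
proof -
  obtain r f where f: "know C r f" "\<And>I. I \<in> C \<Longrightarrow> proper_list_colouring (fst I) (fst (snd I)) (pal I) (f I)"
    using assms(1) unfolding solvable_def by blast
  obtain r' f' where f': "know C' r' f'" "\<And>I. I \<in> C' \<Longrightarrow> proper_list_colouring (fst I) (fst (snd I)) (pal I) (f' I)"
    using assms(2) unfolding solvable_def by blast
  have "know (C \<union> C') (max r r') (\<lambda>I v. if Q (inp I v) then f I v else f' I v)"
    using know_merge[OF f(1) f'(1), where P=Q] assms(3,4) by blast
  moreover have "proper_list_colouring (fst I) (fst (snd I)) (pal I) (\<lambda>v. if Q (inp I v) then f I v else f' I v)"
    if I: "I \<in> C \<union> C'" for I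
  proof -
    \<comment> \<open>Nothing is known about \<open>Q\<close> for arguments outside the vertex set,
      so the glued colouring is only compared with g on vertices.\<close>
    have "\<exists>g. proper_list_colouring (fst I) (fst (snd I)) (pal I) g \<and>
      (\<forall>v<fst I. (if Q (inp I v) then f I v else f' I v) = g v)"
    proof (cases "I \<in> C")
      case True
      then show ?thesis using f(2)[OF True] assms(3)[OF True] by (intro exI[of _ "f I"]) simp
    next
      case False
      then have I': "I \<in> C'" using I by blast
      then show ?thesis using f'(2)[OF I'] assms(4)[OF I'] by (intro exI[of _ "f' I"]) simp
    qed
    then obtain g where g: "proper_list_colouring (fst I) (fst (snd I)) (pal I) g"
      "\<And>v. v < fst I \<Longrightarrow> (if Q (inp I v) then f I v else f' I v) = g v" by blast
    show ?thesis
    proof (rule proper_list_colouringI[OF wf[OF I]])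
      show "(if Q (inp I v) then f I v else f' I v) \<in> pal I v" if "v < fst I" for v
        unfolding g(2)[OF that] using g(1) that by (simp add: proper_list_colouring_def)
      show "(if Q (inp I u) then f I u else f' I u) \<noteq> (if Q (inp I v) then f I v else f' I v)"
        if "v < fst I" "u \<in> nbs I v" for u v
        unfolding g(2)[OF that(1)] g(2)[OF nbs_bounds(1)[OF wf[OF I] that(2)]]
        using g(1) that(2) by (auto simp: proper_list_colouring_def neighbours_def)
    qed
  qed
  ultimately show ?thesis unfolding solvable_def by blast
qed

lemma set_encode_less:
  assumes "S \<subseteq> {..<m}" shows "set_encode S < 2 ^ m"
proof -
  have "set_encode S \<le> (\<Sum>i<m. 2 ^ i)"
    unfolding set_encode_def using assms by (intro sum_mono2) auto
  also have "\<dots> < 2 ^ m" by (induction m) auto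
  finally show ?thesis .
qed

text \<open>A neighbourhood together with a list is a subset of {..<2 * m}, hence a number below 2 ^
  (2 * m), which is at most n ^ (2 * m) for n \<ge> 2. One broadcast thus reveals the whole instance
  to everyone.\<close>

lemma solvable_bounded:
  assumes wf: "\<And>I. I \<in> C \<Longrightarrow> wf_inst I"
    and bounds: "\<And>I. I \<in> C \<Longrightarrow> fst I \<le> m" "\<And>I v. I \<in> C \<Longrightarrow> v < fst I \<Longrightarrow> pal I v \<subseteq> {..<m}"
  shows "solvable C"
proof -
  define S where "S N L = (\<lambda>u. 2 * u) ` N \<union> (\<lambda>c. 2 * c + 1) ` L" for N L :: "nat set"
  define w where "w i x = set_encode (S (fst (snd (snd i))) (snd (snd (snd i))))"
    for i :: "nat \<times> nat \<times> nat set \<times> nat set" and x :: unit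
  have S_sub: "S (nbs I v) (pal I v) \<subseteq> {..<2 * m}" if "I \<in> C" "v < fst I" for I v
  proof -
    have "u < m" if "u \<in> nbs I v" for u
      using nbs_bounds(1)[OF wf that] bounds(1) \<open>I \<in> C\<close> by (meson less_le_trans)
    moreover have "c < m" if "c \<in> pal I v" for c using bounds(2)[OF \<open>I \<in> C\<close> \<open>v < fst I\<close>] that by blast
    ultimately show ?thesis by (fastforce simp: S_def)
  qed
  have table: "pub C (Suc 0) (\<lambda>I. ((), \<lambda>v. if v < fst I then w (inp I v) () else 0))"
  proof (rule pub_broadcast[OF pub_unit, where B="2 * m"])
    fix I v assume "I \<in> C" "v < fst I" "2 \<le> fst I"
    then have "w (inp I v) () < 2 ^ (2 * m)"
      using set_encode_less[OF S_sub] by (simp add: w_def inp_def)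
    also have "\<dots> \<le> fst I ^ (2 * m)" using \<open>2 \<le> fst I\<close> by (intro power_mono) auto
    finally show "w (inp I v) () < fst I ^ (2 * m)" .
  qed
  define col where "col n t = (SOME g. \<forall>v<n. 2 * g v + 1 \<in> set_decode (t v) \<and> (\<forall>u. 2 * u \<in> set_decode (t v) \<longrightarrow> g u \<noteq> g v))"
    for n and t :: "nat \<Rightarrow> nat"
  define f where "f I = col (fst I) (\<lambda>v. if v < fst I then w (inp I v) () else 0)" for I
  have "pub C (Suc 0) f"
    by (rule pub_map[OF table, where h="\<lambda>n (_, t). col n t"]) (simp add: f_def)
  then have "know C (Suc 0) f"
    unfolding pub_def by (rule know_map[where h="\<lambda>(i, f). f (fst (snd i))"]) (simp add: inp_def)
  moreover have "proper_list_colouring (fst I) (fst (snd I)) (pal I) (f I)" if I: "I \<in> C" for I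
  proof -
    let ?t = "\<lambda>v. if v < fst I then w (inp I v) () else 0"
    have dec: "set_decode (?t v) = S (nbs I v) (pal I v)" if "v < fst I" for v
      using S_sub[OF I that] that finite_subset by (fastforce simp: w_def inp_def)
    have S_iff: "2 * x + 1 \<in> S N L \<longleftrightarrow> x \<in> L" "2 * x \<in> S N L \<longleftrightarrow> x \<in> N" for x N L
      by (auto simp: S_def) presburger+
    have "\<exists>g. (\<forall>v\<in>{..<fst I}. g v \<in> pal I v) \<and> (\<forall>v\<in>{..<fst I}. \<forall>u\<in>{..<fst I}. u \<in> nbs I v \<longrightarrow> g u \<noteq> g v)"
    proof (rule greedy_colouring)
      fix v assume "v \<in> {..<fst I}"
      then have v: "v < fst I" by simp
      have "card {u \<in> {..<fst I}. u \<in> nbs I v} \<le> card (nbs I v)"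
        using finite_nbs[OF wf[OF I]] by (intro card_mono) auto
      then show "card {u \<in> {..<fst I}. u \<in> nbs I v} < card (pal I v)"
        using card_nbs[OF v] card_pal[OF wf[OF I] v] by simp
    qed (use nbs_bounds[OF wf[OF I]] nbs_sym in auto)
    then obtain g where g: "\<And>v. v < fst I \<Longrightarrow> g v \<in> pal I v"
      "\<And>u v. v < fst I \<Longrightarrow> u \<in> nbs I v \<Longrightarrow> g u \<noteq> g v"
      using nbs_bounds(1)[OF wf[OF I]] by (metis lessThan_iff)
    have "\<exists>g. \<forall>v<fst I. 2 * g v + 1 \<in> set_decode (?t v) \<and> (\<forall>u. 2 * u \<in> set_decode (?t v) \<longrightarrow> g u \<noteq> g v)"
    proof (intro exI allI impI)
      fix v assume v: "v < fst I"
      show "2 * g v + 1 \<in> set_decode (?t v) \<and> (\<forall>u. 2 * u \<in> set_decode (?t v) \<longrightarrow> g u \<noteq> g v)"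
        unfolding dec[OF v] S_iff using g v by blast
    qed
    from someI_ex[OF this] have f: "2 * f I v + 1 \<in> set_decode (?t v) \<and> (\<forall>u. 2 * u \<in> set_decode (?t v) \<longrightarrow> f I u \<noteq> f I v)"
      if "v < fst I" for v
      using that unfolding f_def col_def by blast
    show ?thesis
    proof (rule proper_list_colouringI[OF wf[OF I]])
      show "f I v \<in> pal I v" if "v < fst I" for v using f[OF that] unfolding dec[OF that] S_iff by blast
      show "f I u \<noteq> f I v" if "v < fst I" "u \<in> nbs I v" for u v
        using f[OF that(1)] that(2) unfolding dec[OF that(1)] S_iff by blast
    qed
  qed
  ultimately show ?thesis unfolding solvable_def by blast
qed

section \<open>Growth rates\<close>

lemma polylog_less_root:
  assumes "(\<lambda>n. real (D n)) \<in> O(\<lambda>n. log 2 (real n) ^ k)"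
  shows "eventually (\<lambda>n. real (D n) \<le> real n powr (1 / 4)) at_top"
proof -
  have "(\<lambda>n::nat. log 2 (real n) ^ k) \<in> o(\<lambda>n. real n powr (1 / 4))"
    by real_asymp
  from landau_o.big_small_trans[OF assms this]
  have "eventually (\<lambda>n. norm (real (D n)) \<le> 1 * norm (real n powr (1 / 4))) at_top"
    by (rule landau_o.smallD) simp
  then show ?thesis by simp
qed

lemma polynomial_colours:
  assumes "(\<lambda>n. log 2 (real (U n))) \<in> O(\<lambda>n. log 2 (real n))"
  shows "\<exists>a. eventually (\<lambda>n. U n \<le> n ^ a) at_top"
proof -
  obtain c where "eventually (\<lambda>n. norm (log 2 (real (U n))) \<le> c * norm (log 2 (real n))) at_top"
    using landau_o.bigE[OF assms] by blast
  then have "eventually (\<lambda>n. U n \<le> n ^ nat \<lceil>c\<rceil>) at_top"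
    using eventually_ge_at_top[of 2]
  proof eventually_elim
    case (elim n)
    show ?case
    proof (cases "U n = 0")
      case False
      have pos: "log 2 (real n) \<ge> 0" using elim(2) by simp
      have "log 2 (real (U n)) \<le> c * log 2 (real n)" using elim pos by simp
      also have "\<dots> \<le> real (nat \<lceil>c\<rceil>) * log 2 (real n)" using pos by (intro mult_right_mono) linarith+
      also have "\<dots> = log 2 (real n ^ nat \<lceil>c\<rceil>)" using elim(2) by (simp add: log_nat_power)
      finally have "real (U n) \<le> real n ^ nat \<lceil>c\<rceil>" using False elim(2) by simp
      then show ?thesis by (simp flip: of_nat_power)
    qed simp
  qed
  then show ?thesis by blast
qed

text \<open>The union bound needs about d ^ 2 ln n to be small against n, and d \<le> n powr (1 / 4)
  leaves room for that.\<close>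

lemma eventually_large_enough:
  assumes D: "eventually (\<lambda>n. real (D n) \<le> real n powr (1 / 4)) at_top"
    and U: "eventually (\<lambda>n. U n \<le> n ^ a) at_top"
  shows "eventually (\<lambda>n. \<forall>d\<le>D n. large_enough n (U n) d) at_top"
proof -
  have 1: "eventually (\<lambda>n::nat. 32 * (real n powr (1 / 4) + 1)\<^sup>2 \<le> real n) at_top" by real_asymp
  \<comment> \<open>For large n, max n (U n) + 1 is at most n ^ (a + 2) = exp (A ln n).\<close>
  define A where "A = real (a + 2)"
  have "A > 0" by (simp add: A_def)
  then have 2: "eventually (\<lambda>n::nat. 128 * A * (real n powr (1 / 4) + 2)\<^sup>2 * ln (real n) < real n) at_top"
    by real_asymp
  from D U 1 2 eventually_ge_at_top[of 2] show ?thesis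
  proof eventually_elim
    case (elim n)
    show ?case
    proof (intro allI impI)
      fix d assume "d \<le> D n"
      then have d: "real d \<le> real n powr (1 / 4)" using elim(1) by linarith
      have n2: "real n \<ge> 2" using elim by simp
      have "real (32 * (d + 1)\<^sup>2) \<le> 32 * (real n powr (1 / 4) + 1)\<^sup>2"
        using d by (simp add: power_mono)
      also have "\<dots> \<le> real n" by (rule elim)
      finally have "32 * (d + 1)\<^sup>2 \<le> n" by (simp only: of_nat_le_iff)
      moreover have "(real (max n (U n)) + 1) ^ (d + 2) * exp (- real n / (128 * (real d + 1))) < 1"
      proof -
        have "n \<le> n ^ (a + 1)" using elim(5) by (intro self_le_power) auto
        moreover have "n ^ a \<le> n ^ (a + 1)" "1 \<le> n ^ (a + 1)" using elim(5) by (auto intro: power_increasing)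
        ultimately have "max n (U n) + 1 \<le> 2 * n ^ (a + 1)" using elim(2) by linarith
        also have "\<dots> \<le> n * n ^ (a + 1)" using elim(5) by (intro mult_right_mono) auto
        also have "\<dots> = n ^ (a + 2)" by simp
        finally have "real (max n (U n) + 1) \<le> real (n ^ (a + 2))" by (simp only: of_nat_le_iff)
        then have "real (max n (U n)) + 1 \<le> exp (A * ln (real n))"
          using n2 by (simp add: A_def exp_of_nat_mult[of "a + 2", simplified] flip: powr_realpow powr_def)
        then have "(real (max n (U n)) + 1) ^ (d + 2) \<le> exp (A * ln (real n)) ^ (d + 2)"
          by (intro power_mono) auto
        also have "\<dots> = exp (real (d + 2) * (A * ln (real n)))" by (simp only: exp_of_nat_mult)
        finally have "(real (max n (U n)) + 1) ^ (d + 2) * exp (- real n / (128 * (real d + 1))) \<le>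
            exp (real (d + 2) * (A * ln (real n))) * exp (- real n / (128 * (real d + 1)))"
          by (intro mult_right_mono) auto
        also have "\<dots> = exp (real (d + 2) * (A * ln (real n)) - real n / (128 * (real d + 1)))"
          by (simp add: mult_exp_exp)
        also have "\<dots> < 1"
        proof -
          have ln: "ln (real n) \<ge> 0" using n2 by simp
          have "(real d + 1) * (real d + 2) \<le> (real n powr (1 / 4) + 2)\<^sup>2"
            unfolding power2_eq_square using d by (intro mult_mono) auto
          then have "128 * A * ((real d + 1) * (real d + 2)) * ln (real n) \<le> 128 * A * (real n powr (1 / 4) + 2)\<^sup>2 * ln (real n)"
            using ln \<open>A > 0\<close> by (intro mult_right_mono mult_left_mono) auto
          also have "\<dots> < real n" by (rule elim)
          finally have "real (d + 2) * (A * ln (real n)) * (128 * (real d + 1)) < real n" by (simp add: algebra_simps)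
          then have "real (d + 2) * (A * ln (real n)) < real n / (128 * (real d + 1))"
            by (subst pos_less_divide_eq) auto
          then show ?thesis by simp
        qed
        finally show ?thesis .
      qed
      ultimately show "large_enough n (U n) d" by (simp add: large_enough_def)
    qed
  qed
qed

theorem theorem4p4:
  fixes D U :: "nat \<Rightarrow> nat" and c :: nat
  assumes polylog_degree: "\<exists>k::nat. (\<lambda>n. real (D n)) \<in> O(\<lambda>n. log 2 (real n) ^ k)"
    and log_size_colours: "(\<lambda>n. log 2 (real (U n))) \<in> O(\<lambda>n. log 2 (real n))"
  shows "\<exists>A R. logarithmic_messages A \<and>
    (\<forall>n E \<Psi>. n \<ge> 1 \<and> simple_graph n E \<and> max_degree n E \<le> D n \<and>
        list_assignment n E \<Psi> \<and> (\<forall>v<n. \<Psi> v \<subseteq> {..<U n}) \<longrightarrow>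
      measure_pmf.prob (coin_space A n)
        {\<omega>. proper_list_colouring n E \<Psi> (result A R n E \<Psi> \<omega>)} \<ge> 1 - 1 / real n ^ c)"
proof -
  obtain a where a: "eventually (\<lambda>n. U n \<le> n ^ a) at_top" using polynomial_colours[OF log_size_colours] by blast
  have "eventually (\<lambda>n. real (D n) \<le> real n powr (1 / 4)) at_top"
    using polylog_degree polylog_less_root by blast
  note large = eventually_large_enough[OF this a]
  from eventually_small_probability obtain s0
    where s0: "\<And>s. s \<ge> s0 \<Longrightarrow> 11 * real s ^ 11 * exp (- real s / 192) \<le> 1 / (32 * (2 * real s ^ 20 + 1))" by blast
  \<comment> \<open>The root s of any d \<ge> d0 is then at least both 41 and s0.\<close>
  define d0 where "d0 = (40 + (s0 + 1)) ^ 20"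
  have "\<exists>s. admissible s d" if d: "d \<ge> d0" for d
  proof -
    obtain s where s: "s \<ge> 40 + (s0 + 1)" "s ^ 20 \<le> d" "d \<le> 2 * s ^ 20"
      using exists_root[OF d[unfolded d0_def]] by blast
    then have "41 \<le> s" "s0 \<le> s" by linarith+
    with s s0[of s] have "admissible s d" unfolding admissible_def by blast
    then show ?thesis ..
  qed
  then obtain \<sigma> where \<sigma>: "\<And>d. d \<ge> d0 \<Longrightarrow> admissible (\<sigma> d) d" by metis
  from a large eventually_ge_at_top[of "4 * d0 + 2"]
  have "eventually (\<lambda>n. U n \<le> n ^ a \<and> (\<forall>d\<le>D n. large_enough n (U n) d) \<and> 4 * d0 + 2 \<le> n) at_top"
    by eventually_elim blast
  then obtain n0 where n0: "\<And>n. n \<ge> n0 \<Longrightarrow> U n \<le> n ^ a" "\<And>n d. n \<ge> n0 \<Longrightarrow> d \<le> D n \<Longrightarrow> large_enough n (U n) d"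
    "\<And>n. n \<ge> n0 \<Longrightarrow> 4 * d0 + 2 \<le> n" unfolding eventually_at_top_linorder by blast
  define C :: "inst set" where "C = {(n, E, \<Psi>). n \<ge> 1 \<and> simple_graph n E \<and> max_degree n E \<le> D n \<and>
        list_assignment n E \<Psi> \<and> (\<forall>v<n. \<Psi> v \<subseteq> {..<U n})}"
  have C: "wf_inst I" "deg I \<le> D (fst I)" "v < fst I \<Longrightarrow> pal I v \<subseteq> {..<U (fst I)}" if "I \<in> C" for I v
    using that by (cases I; simp add: C_def wf_inst_def)+
  define C1 where "C1 = {I \<in> C. fst I < n0}"
  define C2 where "C2 = {I \<in> C. fst I \<ge> n0 \<and> deg I < d0}"
  define C3 where "C3 = {I \<in> C. fst I \<ge> n0 \<and> deg I \<ge> d0}"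
  interpret large_degree C3 \<sigma> U a
    by standard (use C \<sigma> n0 in \<open>auto simp: C3_def\<close>)
  have s3: "solvable C3" by (rule solvableI[OF pub_colouring wf])
  have s2: "solvable C2"
  proof (rule solvableI[OF pub_colouring_small_degree[where U=U and d=d0 and B="a + 4"]])
    fix I assume I: "I \<in> C2"
    then have *: "I \<in> C" "fst I \<ge> n0" "deg I < d0" by (auto simp: C2_def)
    then show "wf_inst I" "deg I \<le> d0" "4 * d0 + 2 \<le> fst I"
      and "\<And>v. v < fst I \<Longrightarrow> pal I v \<subseteq> {..<U (fst I)}"
      using C n0(3) by auto
    show "2 * (fst I + U (fst I)) < fst I ^ (a + 4)" if "2 \<le> fst I"
      using that n0(1)[OF *(2)] by (rule colour_bound)
    show "wf_inst I" using C(1)[OF *(1)] .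
  qed
  \<comment> \<open>The list size is \<Delta> + 1, so every vertex tests \<Delta> < d0 on its own
    list.\<close>
  have s23: "solvable (C2 \<union> C3)"
    by (rule solvable_Un[OF s2 s3, where Q="\<lambda>i. card (snd (snd (snd i))) \<le> d0"])
       (use C card_pal in \<open>auto simp: C2_def C3_def inp_def\<close>)
  have s1: "solvable C1"
  \<comment> \<open>One constant bounding n and all colour names for every n < n0.\<close>
  proof (rule solvable_bounded[where m="n0 + (\<Sum>n<n0. U n)"])
    fix I assume I: "I \<in> C1"
    then show "wf_inst I" "fst I \<le> n0 + (\<Sum>n<n0. U n)" using C(1) by (auto simp: C1_def)
    show "pal I v \<subseteq> {..<n0 + (\<Sum>n<n0. U n)}" if "v < fst I" for v
    proof -
      have "U (fst I) \<le> (\<Sum>n<n0. U n)" using I by (intro member_le_sum) (auto simp: C1_def)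
      then show ?thesis using C(3)[of I v] I that by (force simp: C1_def)
    qed
  qed
  have "solvable (C1 \<union> (C2 \<union> C3))"
    by (rule solvable_Un[OF s1 s23, where Q="\<lambda>i. fst i < n0"]) (use C in \<open>auto simp: C1_def C2_def C3_def inp_def\<close>)
  moreover have "C1 \<union> (C2 \<union> C3) = C" by (auto simp: C1_def C2_def C3_def)
  ultimately have "solvable C" by simp
  then obtain r f where f: "know C r f" "\<And>I. I \<in> C \<Longrightarrow> proper_list_colouring (fst I) (fst (snd I)) (pal I) (f I)"
    unfolding solvable_def by blast
  from know_imp_algorithm[OF f(1)] obtain A where A: "logarithmic_messages A"
    "\<And>n E \<Psi>. (n, E, \<Psi>) \<in> C \<Longrightarrow>
     measure_pmf.prob (coin_space A n) {\<omega>. \<forall>v<n. result A r n E \<Psi> \<omega> v = f (n, E, \<Psi>) v} = 1" by blast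
  show ?thesis
  proof (intro exI conjI allI impI)
    show "logarithmic_messages A" by (rule A)
    fix n E \<Psi> assume "n \<ge> 1 \<and> simple_graph n E \<and> max_degree n E \<le> D n \<and>
        list_assignment n E \<Psi> \<and> (\<forall>v<n. \<Psi> v \<subseteq> {..<U n})"
    then have I: "(n, E, \<Psi>) \<in> C" by (simp add: C_def)
    have "{\<omega>. \<forall>v<n. result A r n E \<Psi> \<omega> v = f (n, E, \<Psi>) v} \<subseteq> {\<omega>. proper_list_colouring n E \<Psi> (result A r n E \<Psi> \<omega>)}"
    proof
      fix \<omega> assume "\<omega> \<in> {\<omega>. \<forall>v<n. result A r n E \<Psi> \<omega> v = f (n, E, \<Psi>) v}"
      then have eq: "\<And>v. v < n \<Longrightarrow> result A r n E \<Psi> \<omega> v = f (n, E, \<Psi>) v" by blast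
      have "proper_list_colouring (fst (n, E, \<Psi>)) (fst (snd (n, E, \<Psi>))) (pal (n, E, \<Psi>)) (result A r n E \<Psi> \<omega>)"
      proof (rule proper_list_colouringI[OF C(1)[OF I]])
        show "result A r n E \<Psi> \<omega> v \<in> pal (n, E, \<Psi>) v" if "v < fst (n, E, \<Psi>)" for v
          using eq[of v] f(2)[OF I] that by (simp add: proper_list_colouring_def)
        show "result A r n E \<Psi> \<omega> u \<noteq> result A r n E \<Psi> \<omega> v" if "v < fst (n, E, \<Psi>)" "u \<in> nbs (n, E, \<Psi>) v" for u v
          using eq[of v] eq[of u] f(2)[OF I] that nbs_bounds(1)[OF C(1)[OF I] that(2)]
          by (simp add: proper_list_colouring_def neighbours_def)
      qed
      then show "\<omega> \<in> {\<omega>. proper_list_colouring n E \<Psi> (result A r n E \<Psi> \<omega>)}" by simp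
    qed
    then have "measure_pmf.prob (coin_space A n) {\<omega>. \<forall>v<n. result A r n E \<Psi> \<omega> v = f (n, E, \<Psi>) v}
      \<le> measure_pmf.prob (coin_space A n) {\<omega>. proper_list_colouring n E \<Psi> (result A r n E \<Psi> \<omega>)}"
      by (intro measure_pmf.finite_measure_mono) auto
    with A(2)[OF I] have "1 \<le> measure_pmf.prob (coin_space A n) {\<omega>. proper_list_colouring n E \<Psi> (result A r n E \<Psi> \<omega>)}"
      by simp
    moreover have "1 - 1 / real n ^ c \<le> 1" by simp
    ultimately show "1 - 1 / real n ^ c \<le> measure_pmf.prob (coin_space A n) {\<omega>. proper_list_colouring n E \<Psi> (result A r n E \<Psi> \<omega>)}"
      by linarith
  qed
qed

end
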